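(* For every (arbitrarily small) constant $\delta\in(0,1)$, there is an algorithm that, given an instance of the problem FEO (defined in the context) with optimal value $\mathsf{OPT}$, finds a feasible solution $\mathbf{x}$ of FEO such that $\mathcal{F}(\mathbf{x})\ge(1-\delta)\cdot\mathsf{OPT}$, and whose execution time is polynomial in $\frac1\delta$ and in the input size.
   Context: Setting. $\mathcal N=\{1,\dots,N\}$ is a set of users, $B>0$ is a total bandwidth, and for each $i\in\mathcal N$ there are bounds $0<\underline\xi_i\le\overline\xi_i$. Let $T_{\text{pri}},\kappa,k_B,T_{\text{temp}}>0$ be constants and, for each $i$, let $h_i^{\text C},h_i^{\text R}$ (channel gains) and $P_i^{r,\text C},P_i^{r,\text R}$ (received powers) be given; put $\tau_i=\frac{\|h_i^{\text C}\|^2P_i^{r,\text C}}{k_BT_{\text{temp}}}>0$ and $\nu_i=\kappa\frac{\|h_i^{\text R}\|^2P_i^{r,\text R}}{k_BT_{\text{temp}}}>0$. For $x>0$ define $$g_i(x)=x\log_2\Big(1+\frac{\tau_i}{x}\Big),\quad f_i(x)=\frac{1}{2T_{\text{pri}}}\log_2(1+\nu_ix),\quad u_i(x)=f_i(x)+g_i(x).$$ Standing assumptions: $\sum_{i}\underline\xi_i\le B<\sum_i\overline\xi_i$ and $u_i(\underline\xi_i)\ge1$ for every $i$. For $p\ge1$ and $\alpha\in[0,1]$ let $\mathcal F_p(\mathbf x)=\big(\sum_{i\in\mathcal N}u_i(x_i)^p\big)^{1/p}$, $\mathcal F_{\min}(\mathbf x)=\min_{i\in\mathcal N}u_i(x_i)$,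 and $\mathcal F(\mathbf x)=\alpha\mathcal F_p(\mathbf x)+(1-\alpha)\mathcal F_{\min}(\mathbf x)$. Problem FEO: maximize $\mathcal F(\mathbf x)$ over $\mathbf x\in\mathbb R_{\ge0}^N$ subject to $\sum_{i\in\mathcal N}x_i\le B$ and $x_i\in[\underline\xi_i,\overline\xi_i]$ for all $i\in\mathcal N$. Its optimal value is $\mathsf{OPT}$. The input size is the total size in binary encoding of the parameters $N,B,\kappa,k_B,T_{\text{temp}},T_{\text{pri}},h_i^{\text C},h_i^{\text R},P_i^{r,\text C},P_i^{r,\text R},\underline\xi_i,\overline\xi_i$, $i\in\mathcal N$. *)

theory Defs
  imports Complex_Main "HOL-Library.Log_Nat"
begin

section \<open>The optimization problem\<close>

text \<open>
  Users are numbered from 1 to \<open>users\<close>; the per-user fields are only meaningful on \<open>{1..users}\<close>.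
  All numerical data are rational, so that they have a binary encoding. A channel gain is a complex
  vector of arbitrary finite dimension (dimension 1 being the scalar case), given by the list of the
  real and imaginary parts of its entries.
\<close>

record feo =
  users :: nat
  bandwidth :: rat
  kappa :: rat
  boltzmann :: rat
  temp :: rat
  pri :: rat
  gainC :: "nat \<Rightarrow> (rat \<times> rat) list"
  gainR :: "nat \<Rightarrow> (rat \<times> rat) list"
  powerC :: "nat \<Rightarrow> rat"
  powerR :: "nat \<Rightarrow> rat"
  lower :: "nat \<Rightarrow> rat"
  upper :: "nat \<Rightarrow> rat"

definition vec_norm :: "(rat \<times> rat) list \<Rightarrow> real" where
  "vec_norm h = sqrt (\<Sum>(a, b)\<leftarrow>h. (cmod (Complex (of_rat a) (of_rat b)))\<^sup>2)"

definition tau :: "feo \<Rightarrow> nat \<Rightarrow> real" where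
  "tau I i = (vec_norm (gainC I i))\<^sup>2 * of_rat (powerC I i) / (of_rat (boltzmann I) * of_rat (temp I))"

definition nu :: "feo \<Rightarrow> nat \<Rightarrow> real" where
  "nu I i = of_rat (kappa I) *
     ((vec_norm (gainR I i))\<^sup>2 * of_rat (powerR I i) / (of_rat (boltzmann I) * of_rat (temp I)))"

definition g :: "feo \<Rightarrow> nat \<Rightarrow> real \<Rightarrow> real" where
  "g I i x = x * log 2 (1 + tau I i / x)"

definition f :: "feo \<Rightarrow> nat \<Rightarrow> real \<Rightarrow> real" where
  "f I i x = 1 / (2 * of_rat (pri I)) * log 2 (1 + nu I i * x)"

definition u :: "feo \<Rightarrow> nat \<Rightarrow> real \<Rightarrow> real" where
  "u I i x = f I i x + g I i x"

definition feo_instance :: "feo \<Rightarrow> bool" where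
  "feo_instance I \<longleftrightarrow>
     users I \<ge> 1 \<and> bandwidth I > 0 \<and>
     kappa I > 0 \<and> boltzmann I > 0 \<and> temp I > 0 \<and> pri I > 0 \<and>
     (\<forall>i\<in>{1..users I}. tau I i > 0 \<and> nu I i > 0 \<and>
        0 < lower I i \<and> lower I i \<le> upper I i \<and> u I i (of_rat (lower I i)) \<ge> 1) \<and>
     (\<Sum>i\<in>{1..users I}. lower I i) \<le> bandwidth I \<and>
     bandwidth I < (\<Sum>i\<in>{1..users I}. upper I i)"

definition F_norm :: "real \<Rightarrow> feo \<Rightarrow> (nat \<Rightarrow> real) \<Rightarrow> real" where
  "F_norm p I x = (\<Sum>i\<in>{1..users I}. u I i (x i) powr p) powr (1 / p)"

definition F_min :: "feo \<Rightarrow> (nat \<Rightarrow> real) \<Rightarrow> real" where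
  "F_min I x = (MIN i\<in>{1..users I}. u I i (x i))"

definition F :: "real \<Rightarrow> real \<Rightarrow> feo \<Rightarrow> (nat \<Rightarrow> real) \<Rightarrow> real" where
  "F p \<alpha> I x = \<alpha> * F_norm p I x + (1 - \<alpha>) * F_min I x"

definition feasible :: "feo \<Rightarrow> (nat \<Rightarrow> real) set" where
  "feasible I = {x. (\<Sum>i\<in>{1..users I}. x i) \<le> of_rat (bandwidth I) \<and>
     (\<forall>i\<in>{1..users I}. 0 \<le> x i \<and> of_rat (lower I i) \<le> x i \<and> x i \<le> of_rat (upper I i))}"

definition OPT :: "real \<Rightarrow> real \<Rightarrow> feo \<Rightarrow> real" where
  "OPT p \<alpha> I = (SUP x\<in>feasible I. F p \<alpha> I x)"


section \<open>Binary encoding\<close>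

text \<open>One bit for the sign, followed by the binary digits of the absolute value.\<close>

definition bits :: "int \<Rightarrow> nat" where
  "bits z = 1 + nat (bitlen \<bar>z\<bar>)"

definition enc_rat :: "rat \<Rightarrow> int list" where
  "enc_rat r = [fst (quotient_of r), snd (quotient_of r)]"

text \<open>Vectors are preceded by their dimension, so that the encoding is self-delimiting.\<close>

definition enc_vec :: "(rat \<times> rat) list \<Rightarrow> int list" where
  "enc_vec h = int (length h) # concat (map (\<lambda>(a, b). enc_rat a @ enc_rat b) h)"

definition enc_user :: "feo \<Rightarrow> nat \<Rightarrow> int list" where
  "enc_user I i = enc_vec (gainC I i) @ enc_vec (gainR I i) @
     enc_rat (powerC I i) @ enc_rat (powerR I i) @ enc_rat (lower I i) @ enc_rat (upper I i)"

definition encode :: "feo \<Rightarrow> int list" where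
  "encode I = int (users I) # enc_rat (bandwidth I) @ enc_rat (kappa I) @ enc_rat (boltzmann I) @
     enc_rat (temp I) @ enc_rat (pri I) @ concat (map (enc_user I) [1..<Suc (users I)])"

definition input_size :: "feo \<Rightarrow> nat" where
  "input_size I = (\<Sum>z\<leftarrow>encode I. bits z)"


section \<open>Algorithms and execution time\<close>

text \<open>
  Algorithms are while-programs over finitely many integer arrays (a scalar is an array used at one
  index only), i.e. structured random access machine programs, with the logarithmic cost criterion:
  every intermediate value, including every index, is charged its bit length. Execution time is thus
  polynomially related to Turing machine time.

  The objective of the problem involves fixed real numbers which are not part of the input and need
  not be rational, nor even computable. A program accesses them in the usual way of bit-complexity
  over the reals: \<open>Approx j e\<close> yields \<open>\<lfloor>c j * 2 ^ k\<rfloor>\<close> for the value \<open>k\<close> of \<open>e\<close>, at a cost of at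
  least \<open>k\<close>. Here \<open>c\<close> is the sequence of fixed reals.
\<close>

type_synonym state = "string \<Rightarrow> int \<Rightarrow> int"

datatype aexp =
    Const int
  | Read string aexp
  | Plus aexp aexp
  | Minus aexp aexp
  | Times aexp aexp
  | Div aexp aexp
  | Approx nat aexp

datatype bexp = Less aexp aexp | Not bexp | And bexp bexp

datatype com =
    Skip
  | Write string aexp aexp
  | Seq com com
  | If bexp com com
  | While bexp com

fun aval :: "(nat \<Rightarrow> real) \<Rightarrow> aexp \<Rightarrow> state \<Rightarrow> int" where
  "aval c (Const z) s = z"
| "aval c (Read x a) s = s x (aval c a s)"
| "aval c (Plus a b) s = aval c a s + aval c b s"
| "aval c (Minus a b) s = aval c a s - aval c b s"
| "aval c (Times a b) s = aval c a s * aval c b s"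
| "aval c (Div a b) s = aval c a s div aval c b s"
| "aval c (Approx j a) s = \<lfloor>c j * 2 ^ nat (aval c a s)\<rfloor>"

fun acost :: "(nat \<Rightarrow> real) \<Rightarrow> aexp \<Rightarrow> state \<Rightarrow> nat" where
  "acost c (Const z) s = bits z"
| "acost c (Read x a) s = acost c a s + bits (aval c (Read x a) s)"
| "acost c (Plus a b) s = acost c a s + acost c b s + bits (aval c (Plus a b) s)"
| "acost c (Minus a b) s = acost c a s + acost c b s + bits (aval c (Minus a b) s)"
| "acost c (Times a b) s = acost c a s + acost c b s + bits (aval c (Times a b) s)"
| "acost c (Div a b) s = acost c a s + acost c b s + bits (aval c (Div a b) s)"
| "acost c (Approx j a) s = acost c a s + nat (aval c a s) + bits (aval c (Approx j a) s)"

fun bval :: "(nat \<Rightarrow> real) \<Rightarrow> bexp \<Rightarrow> state \<Rightarrow> bool" where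
  "bval c (Less a b) s \<longleftrightarrow> aval c a s < aval c b s"
| "bval c (Not b) s \<longleftrightarrow> \<not> bval c b s"
| "bval c (And b b') s \<longleftrightarrow> bval c b s \<and> bval c b' s"

fun bcost :: "(nat \<Rightarrow> real) \<Rightarrow> bexp \<Rightarrow> state \<Rightarrow> nat" where
  "bcost c (Less a b) s = 1 + acost c a s + acost c b s"
| "bcost c (Not b) s = 1 + bcost c b s"
| "bcost c (And b b') s = 1 + bcost c b s + bcost c b' s"

text \<open>\<open>exec c P s t s'\<close>: started in state \<open>s\<close>, the program \<open>P\<close> halts in state \<open>s'\<close> after time \<open>t\<close>.\<close>

inductive exec :: "(nat \<Rightarrow> real) \<Rightarrow> com \<Rightarrow> state \<Rightarrow> nat \<Rightarrow> state \<Rightarrow> bool"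
  for c :: "nat \<Rightarrow> real"
where
  Skip: "exec c Skip s 1 s"
| Write: "exec c (Write x a b) s (1 + acost c a s + acost c b s)
            (s(x := (s x)(aval c a s := aval c b s)))"
| Seq: "exec c P s t s' \<Longrightarrow> exec c Q s' t' s'' \<Longrightarrow> exec c (Seq P Q) s (t + t') s''"
| IfTrue: "bval c b s \<Longrightarrow> exec c P s t s' \<Longrightarrow> exec c (If b P Q) s (1 + bcost c b s + t) s'"
| IfFalse: "\<not> bval c b s \<Longrightarrow> exec c Q s t s' \<Longrightarrow> exec c (If b P Q) s (1 + bcost c b s + t) s'"
| WhileFalse: "\<not> bval c b s \<Longrightarrow> exec c (While b P) s (1 + bcost c b s) s"
| WhileTrue: "bval c b s \<Longrightarrow> exec c P s t s' \<Longrightarrow> exec c (While b P) s' t' s'' \<Longrightarrow>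
    exec c (While b P) s (1 + bcost c b s + t + t') s''"

lemma exec_deterministic:
  assumes "exec c P s t s'" and "exec c P s t2 s2"
  shows "t2 = t \<and> s2 = s'"
  using assms
proof (induction arbitrary: t2 s2 rule: exec.induct)
  case (Skip s)
  then show ?case by (auto elim: exec.cases)
next
  case (Write x a b s)
  then show ?case by (auto elim: exec.cases)
next
  case (Seq P s t s' Q t' s'')
  from Seq.prems show ?case by (cases rule: exec.cases) (use Seq.IH in blast)+
next
  case (IfTrue b s P t s' Q)
  from IfTrue.prems show ?case by (cases rule: exec.cases) (use IfTrue.IH IfTrue.hyps in blast)+
next
  case (IfFalse b s Q t s' P)
  from IfFalse.prems show ?case by (cases rule: exec.cases) (use IfFalse.IH IfFalse.hyps in blast)+
next
  case (WhileFalse b s P)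
  from WhileFalse.prems show ?case by (cases rule: exec.cases) (use WhileFalse.hyps in blast)+
next
  case (WhileTrue b s P t s' t' s'')
  from WhileTrue.prems show ?case
    by (cases rule: exec.cases) (use WhileTrue.IH WhileTrue.hyps in blast)+
qed

text \<open>The input is in the array \<open>in\<close>, from index 0 on; everything else is initially 0.\<close>

definition init :: "int list \<Rightarrow> state" where
  "init zs = (\<lambda>x k. if x = ''in'' \<and> 0 \<le> k \<and> k < int (length zs) then zs ! nat k else 0)"

text \<open>The result is read off as a sequence of fractions.\<close>

definition result :: "state \<Rightarrow> nat \<Rightarrow> real" where
  "result s i = of_int (s ''num'' (int i)) / of_int (s ''den'' (int i))"

text \<open>The fixed reals of the problem: the exponent of the norm and the weight of the norm.\<close>

definition fixed_reals :: "real \<Rightarrow> real \<Rightarrow> nat \<Rightarrow> real" where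
  "fixed_reals p \<alpha> j = (if j = 0 then p else \<alpha>)"

end

theory Submission
  imports Defs
begin

text \<open>
  Since \<open>u\<^sub>i(x)\<close> is increasing and \<open>u\<^sub>i(x) / x\<close> is decreasing, rounding \<open>x\<^sub>i\<close> down to \<open>lower\<^sub>i * \<beta> ^ j\<close>
  decreases \<open>u\<^sub>i\<close> by at most the factor \<open>\<beta>\<close>, so that polynomially many candidates per user suffice. Their
  values \<open>u\<^sub>i\<close>, the powers \<open>u\<^sub>i ^ p\<close> and the partial sums of these powers are all rounded to
  powers of \<open>\<beta>\<close>, which turns real powers into products of exponents by \<open>p\<close> and logarithms into a search
  in the grid. For every value of the minimum, a dynamic program over the users computes the
  least bandwidth with which each rounded sum can be reached. With \<open>\<beta> = 1 + 1 / R\<^sup>2\<close> and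
  \<open>R = 12 N / \<delta>\<close>, the total loss over the \<open>N\<close> rounded additions is at most the factor \<open>1 - \<delta>\<close>.

  Running times are never computed: the families of integers computable in polynomial time are closed
  under arithmetic and under iterations whose intermediate values have polynomially many bits. Tables are
  coded as single integers.
\<close>

section \<open>Polynomial-time computable families of integers\<close>

text \<open>The obstacles are the transcendental values \<open>u\<close>, the real exponent
  \<open>p\<close> and the minimum, which is not additive. As the objective is homogeneous in the
  values \<open>u\<close>, these are needed only up to a common factor: natural logarithms are used,
  scaled by 4 to make all values at least 1, and the factor \<open>4 * ln 2\<close> cancels when the
  returned solution is compared with a feasible one. The minimum enters as a guessed level imposed
  on every user as a lower bound; a guess that is too low merely underestimates the objective.
  Bandwidth, by contrast, is treated exactly, since feasibility tolerates no error: a common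
  denominator makes all grid points integral. The constants of the time bound must not depend on
  \<delta>. Therefore families are indexed by pairs of an instance and a natural number
  \<open>d\<close> standing for \<open>1 / \<delta>\<close>, and the value of \<open>d\<close>, not
  its bit length, counts towards the size.\<close>

lemma bits_le:
  assumes "\<bar>z\<bar> \<le> 2 ^ m"
  shows "bits z \<le> m + 2"
proof -
  have "\<bar>z\<bar> < 2 ^ Suc m" using assms by (simp add: order.strict_trans1)
  then have "bitlen \<bar>z\<bar> \<le> int (Suc m)" by (simp only: bitlen_le_iff_power nat_int) simp
  then show ?thesis by (simp add: bits_def)
qed

lemma abs_le_power_mono: "\<bar>x\<bar> \<le> 2 ^ m \<Longrightarrow> m \<le> n \<Longrightarrow> \<bar>x\<bar> \<le> (2 :: int) ^ n"
  using power_increasing[of m n "2::int"] by linarith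

lemma abs_le_bits: "\<bar>z\<bar> \<le> 2 ^ bits z"
proof -
  have "\<bar>z\<bar> < 2 ^ nat (bitlen \<bar>z\<bar>)"
    using bitlen_bounds[of "\<bar>z\<bar>"] by (cases "z = 0") auto
  also have "\<dots> \<le> 2 ^ bits z" by (rule power_increasing) (auto simp: bits_def)
  finally show ?thesis by simp
qed

text \<open>A family is indexed by an arbitrary type; \<open>vars\<close> lists the quantities (such as loop
  counters) which a program computing a family finds in its variables.\<close>

record 'q ctx =
  pts :: "'q set"
  inp :: "'q \<Rightarrow> int list"
  extra :: "'q \<Rightarrow> nat"
  vars :: "('q \<Rightarrow> int) list"

text \<open>The summand 2 keeps the size at least 2, so that a polynomial bound can be written as a
  pure power: constants and sums are absorbed into the exponent. \<open>extra\<close> is counted by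
  its value, the input by its bit length.\<close>

definition sz :: "'q ctx \<Rightarrow> 'q \<Rightarrow> nat" where
  "sz \<Gamma> q = 2 + extra \<Gamma> q + (\<Sum>z\<leftarrow>inp \<Gamma> q. bits z)"

definition pb :: "'q ctx \<Rightarrow> ('q \<Rightarrow> nat) \<Rightarrow> bool" where
  "pb \<Gamma> n \<longleftrightarrow> (\<exists>k. \<forall>q\<in>pts \<Gamma>. n q \<le> sz \<Gamma> q ^ k)"

lemma sz_ge_2: "2 \<le> sz \<Gamma> q"
  by (simp add: sz_def)

lemma pb_mono:
  assumes "pb \<Gamma> a" "\<And>q. q \<in> pts \<Gamma> \<Longrightarrow> b q \<le> a q"
  shows "pb \<Gamma> b"
  using assms order_trans unfolding pb_def by meson

lemma pb_const: "pb \<Gamma> (\<lambda>_. n)"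
proof -
  have "n \<le> sz \<Gamma> q ^ n" for q
    using less_exp[of n] power_mono[OF sz_ge_2, of n \<Gamma> q] by linarith
  then show ?thesis unfolding pb_def by blast
qed

lemma pb_mult:
  assumes "pb \<Gamma> a" "pb \<Gamma> b"
  shows "pb \<Gamma> (\<lambda>q. a q * b q)"
proof -
  obtain j k where "\<forall>q\<in>pts \<Gamma>. a q \<le> sz \<Gamma> q ^ j" "\<forall>q\<in>pts \<Gamma>. b q \<le> sz \<Gamma> q ^ k"
    using assms unfolding pb_def by blast
  then have "\<forall>q\<in>pts \<Gamma>. a q * b q \<le> sz \<Gamma> q ^ (j + k)"
    by (simp add: power_add mult_mono)
  then show ?thesis unfolding pb_def by blast
qed

text \<open>Since \<open>a + b \<le> (a + 1) * (b + 1)\<close>, sums reduce to products; the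
  increment costs one more factor of the size, which is at least 2.\<close>

lemma pb_add:
  assumes "pb \<Gamma> a" "pb \<Gamma> b"
  shows "pb \<Gamma> (\<lambda>q. a q + b q)"
proof -
  have "pb \<Gamma> (\<lambda>q. (a q + 1) * (b q + 1))" if "pb \<Gamma> (\<lambda>q. a q + 1)" "pb \<Gamma> (\<lambda>q. b q + 1)"
    using that by (rule pb_mult)
  moreover have "pb \<Gamma> (\<lambda>q. a q + 1)" if a: "pb \<Gamma> a" for a :: "'a \<Rightarrow> nat"
  proof -
    obtain j where j: "\<forall>q\<in>pts \<Gamma>. a q \<le> sz \<Gamma> q ^ j" using a unfolding pb_def by blast
    have "a q + 1 \<le> sz \<Gamma> q ^ Suc j" if "q \<in> pts \<Gamma>" for q
    proof -
      have "a q \<le> sz \<Gamma> q ^ j" using j that by blast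
      moreover have "1 \<le> sz \<Gamma> q ^ j" using sz_ge_2[of \<Gamma> q] by (simp add: Suc_le_eq)
      moreover have "2 * sz \<Gamma> q ^ j \<le> sz \<Gamma> q ^ Suc j" using sz_ge_2[of \<Gamma> q] by simp
      ultimately show ?thesis by linarith
    qed
    then show ?thesis unfolding pb_def by blast
  qed
  ultimately have "pb \<Gamma> (\<lambda>q. (a q + 1) * (b q + 1))" using assms by blast
  then show ?thesis by (rule pb_mono) (simp add: algebra_simps)
qed

lemma pb_size: "pb \<Gamma> (sz \<Gamma>)"
  unfolding pb_def by (rule exI[of _ 1]) simp

lemmas pb_intros = pb_const pb_mult pb_add pb_size

definition arr :: "int list \<Rightarrow> int \<Rightarrow> int" where
  "arr zs k = (if 0 \<le> k \<and> k < int (length zs) then zs ! nat k else 0)"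

lemma bits_arr_le: "bits (arr zs k) \<le> 1 + (\<Sum>z\<leftarrow>zs. bits z)"
proof (cases "0 \<le> k \<and> k < int (length zs)")
  case True
  then have "zs ! nat k \<in> set zs" by (auto intro!: nth_mem)
  then have "bits (zs ! nat k) \<in> set (map bits zs)" by simp
  from member_le_sum_list[OF this] True show ?thesis by (simp add: arr_def)
next
  case False
  then show ?thesis by (auto simp: arr_def bits_def)
qed

text \<open>Scalars live at index 0. Nothing is required of the other arrays, so a program has to
  work on a memory left dirty by earlier ones; this is what allows it to be a loop body.\<close>

definition matches :: "'q ctx \<Rightarrow> string list \<Rightarrow> 'q \<Rightarrow> state \<Rightarrow> bool" where
  "matches \<Gamma> ns q s \<longleftrightarrow>
     s ''in'' = arr (inp \<Gamma> q) \<and> list_all2 (\<lambda>x h. s x 0 = h q) ns (vars \<Gamma>)"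

lemma matches_frame:
  assumes "matches \<Gamma> ns q s" "\<And>x. x \<in> X \<Longrightarrow> s' x = s x" "''in'' \<in> X" "set ns \<subseteq> X"
  shows "matches \<Gamma> ns q s'"
proof -
  have "list_all2 (\<lambda>x h. s' x 0 = h q) ns (vars \<Gamma>)"
    using assms(1) unfolding matches_def
    by (elim conjE list.rel_mono_strong) (use assms(2,4) in auto)
  then show ?thesis using assms(1,2,3) unfolding matches_def by simp
qed

text \<open>The names in \<open>X\<close> must not be touched, so that programs can be combined by choosing fresh
  names.\<close>

definition realizes ::
    "(nat \<Rightarrow> real) \<Rightarrow> 'q ctx \<Rightarrow> string set \<Rightarrow> string list \<Rightarrow> com \<Rightarrow> string \<Rightarrow> ('q \<Rightarrow> nat) \<Rightarrow> ('q \<Rightarrow> int) \<Rightarrow> bool"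
  where
  "realizes c \<Gamma> X ns P r T h \<longleftrightarrow> (\<forall>q\<in>pts \<Gamma>. \<bar>h q\<bar> \<le> 2 ^ T q \<and>
     (\<forall>s. matches \<Gamma> ns q s \<longrightarrow>
        (\<exists>t s'. exec c P s t s' \<and> t \<le> T q \<and> s' r 0 = h q \<and> (\<forall>x\<in>X. s' x = s x))))"

text \<open>The program and its time bound are chosen after the forbidden names \<open>X\<close>,
  which takes the place of renaming variables in finished programs. Through \<open>realizes\<close>,
  the same \<open>T\<close> bounds the time and the bit length of the value.\<close>

definition computable :: "(nat \<Rightarrow> real) \<Rightarrow> 'q ctx \<Rightarrow> ('q \<Rightarrow> int) \<Rightarrow> bool" where
  "computable c \<Gamma> h \<longleftrightarrow> (\<forall>X ns. finite X \<longrightarrow> ''in'' \<in> X \<longrightarrow> set ns \<subseteq> X \<longrightarrow>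
     length ns = length (vars \<Gamma>) \<longrightarrow> (\<exists>P r T. r \<notin> X \<and> pb \<Gamma> T \<and> realizes c \<Gamma> X ns P r T h))"

lemma computableI:
  assumes "\<And>X ns. finite X \<Longrightarrow> ''in'' \<in> X \<Longrightarrow> set ns \<subseteq> X \<Longrightarrow> length ns = length (vars \<Gamma>) \<Longrightarrow>
    \<exists>P r T. r \<notin> X \<and> pb \<Gamma> T \<and> realizes c \<Gamma> X ns P r T h"
  shows "computable c \<Gamma> h"
  using assms unfolding computable_def by blast

lemma computableE:
  assumes "computable c \<Gamma> h" "finite X" "''in'' \<in> X" "set ns \<subseteq> X" "length ns = length (vars \<Gamma>)"
  obtains P r T where "r \<notin> X" "pb \<Gamma> T" "realizes c \<Gamma> X ns P r T h"
proof -
  note assms(1)[unfolded computable_def, rule_format, OF assms(2-)]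
  then show thesis using that by (elim exE conjE)
qed

lemma realizesI:
  assumes "\<And>q. q \<in> pts \<Gamma> \<Longrightarrow> \<bar>h q\<bar> \<le> 2 ^ T q"
    and "\<And>q s. q \<in> pts \<Gamma> \<Longrightarrow> matches \<Gamma> ns q s \<Longrightarrow>
      \<exists>t s'. exec c P s t s' \<and> t \<le> T q \<and> s' r 0 = h q \<and> (\<forall>x\<in>X. s' x = s x)"
  shows "realizes c \<Gamma> X ns P r T h"
  using assms unfolding realizes_def by blast

lemma realizes_bound: "realizes c \<Gamma> X ns P r T h \<Longrightarrow> q \<in> pts \<Gamma> \<Longrightarrow> \<bar>h q\<bar> \<le> 2 ^ T q"
  unfolding realizes_def by blast

lemma realizes_exec:
  assumes "realizes c \<Gamma> X ns P r T h" "q \<in> pts \<Gamma>" "matches \<Gamma> ns q s"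
  obtains t s' where "exec c P s t s'" "t \<le> T q" "s' r 0 = h q" "\<And>x. x \<in> X \<Longrightarrow> s' x = s x"
  using assms unfolding realizes_def by blast

lemma fresh_name:
  assumes "finite (X :: string set)"
  obtains x where "x \<notin> X"
  using ex_new_if_finite[OF infinite_UNIV_listI assms] by blast

lemma computable_bound:
  assumes "computable c \<Gamma> h"
  obtains T where "pb \<Gamma> T" "\<And>q. q \<in> pts \<Gamma> \<Longrightarrow> \<bar>h q\<bar> \<le> 2 ^ T q"
proof -
  \<comment> \<open>Only the bound on the values is extracted and no program is run, so any names
    serve for the variables, even the input array repeated.\<close>
  let ?ns = "replicate (length (vars \<Gamma>)) ''in''"
  obtain P r T where T: "r \<notin> {''in''}" "pb \<Gamma> T" "realizes c \<Gamma> {''in''} ?ns P r T h"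
    by (rule computableE[OF assms, of "{''in''}" ?ns]) (auto simp: set_replicate_conv_if)
  with that realizes_bound show ?thesis by metis
qed

lemma computable_cong:
  assumes "computable c \<Gamma> h" "\<And>q. q \<in> pts \<Gamma> \<Longrightarrow> h q = h' q"
  shows "computable c \<Gamma> h'"
proof (rule computableI)
  fix X :: "string set" and ns :: "string list"
  assume X: "finite X" "''in'' \<in> X" "set ns \<subseteq> X" "length ns = length (vars \<Gamma>)"
  obtain P r T where "r \<notin> X" "pb \<Gamma> T" "realizes c \<Gamma> X ns P r T h"
    using computableE[OF assms(1) X] .
  moreover from this(3) have "realizes c \<Gamma> X ns P r T h'"
    using assms(2) unfolding realizes_def by auto
  ultimately show "\<exists>P r T. r \<notin> X \<and> pb \<Gamma> T \<and> realizes c \<Gamma> X ns P r T h'" by blast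
qed

subsection \<open>Arithmetic\<close>

lemma bits_0 [simp]: "bits 0 = 1"
  by (simp add: bits_def)

lemma computable_const: "computable c \<Gamma> (\<lambda>_. z)"
proof (rule computableI)
  fix X :: "string set" and ns :: "string list"
  assume X: "finite X"
  obtain r where r: "r \<notin> X" using fresh_name[OF X] .
  let ?T = "\<lambda>_. 2 + bits z"
  have "realizes c \<Gamma> X ns (Write r (Const 0) (Const z)) r ?T (\<lambda>_. z)"
  proof (rule realizesI)
    show "\<bar>z\<bar> \<le> 2 ^ (2 + bits z)"
      using abs_le_bits[of z] power_increasing[of "bits z" "2 + bits z" "2::int"] by linarith
  next
    fix q and s :: state
    let ?s' = "s(r := (s r)(0 := z))"
    have "exec c (Write r (Const 0) (Const z)) s (2 + bits z) ?s'"
      using exec.Write[of c r "Const 0" "Const z" s] by (simp add: eval_nat_numeral)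
    with r show "\<exists>t s'. exec c (Write r (Const 0) (Const z)) s t s' \<and> t \<le> 2 + bits z \<and>
        s' r 0 = z \<and> (\<forall>x\<in>X. s' x = s x)"
      by (intro exI[of _ "2 + bits z"] exI[of _ ?s']) auto
  qed
  moreover have "pb \<Gamma> ?T" by (rule pb_const)
  ultimately show "\<exists>P r T. r \<notin> X \<and> pb \<Gamma> T \<and> realizes c \<Gamma> X ns P r T (\<lambda>_. z)" using r by blast
qed

text \<open>A variable does not contribute to the size of a point, so a bound on its bit length has
  to come from outside.\<close>

lemma computable_var:
  assumes "l < length (vars \<Gamma>)" "pb \<Gamma> T"
    and "\<And>q. q \<in> pts \<Gamma> \<Longrightarrow> \<bar>(vars \<Gamma> ! l) q\<bar> \<le> 2 ^ T q"
  shows "computable c \<Gamma> (vars \<Gamma> ! l)"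
proof (rule computableI)
  fix X :: "string set" and ns :: "string list"
  assume X: "finite X" "length ns = length (vars \<Gamma>)"
  obtain r where r: "r \<notin> X" using fresh_name[OF X(1)] .
  let ?P = "Write r (Const 0) (Read (ns ! l) (Const 0))"
  let ?T = "\<lambda>q. T q + 5"
  have "realizes c \<Gamma> X ns ?P r ?T (vars \<Gamma> ! l)"
  proof (rule realizesI)
    fix q assume q: "q \<in> pts \<Gamma>"
    show "\<bar>(vars \<Gamma> ! l) q\<bar> \<le> 2 ^ (T q + 5)"
      using assms(3)[OF q] power_increasing[of "T q" "T q + 5" "2::int"] by linarith
    fix s assume s: "matches \<Gamma> ns q s"
    then have v: "s (ns ! l) 0 = (vars \<Gamma> ! l) q"
      using assms(1) X(2) by (auto simp: matches_def list_all2_conv_all_nth)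
    let ?s' = "s(r := (s r)(0 := (vars \<Gamma> ! l) q))"
    have "exec c ?P s (3 + bits ((vars \<Gamma> ! l) q)) ?s'"
      using exec.Write[of c r "Const 0" "Read (ns ! l) (Const 0)" s] v by (simp add: eval_nat_numeral)
    moreover have "bits ((vars \<Gamma> ! l) q) \<le> T q + 2" using bits_le[OF assms(3)[OF q]] .
    ultimately show "\<exists>t s'. exec c ?P s t s' \<and> t \<le> T q + 5 \<and>
        s' r 0 = (vars \<Gamma> ! l) q \<and> (\<forall>x\<in>X. s' x = s x)"
      using r by (intro exI[of _ "3 + bits ((vars \<Gamma> ! l) q)"] exI[of _ ?s']) auto
  qed
  moreover have "pb \<Gamma> ?T" by (intro pb_intros assms)
  ultimately show "\<exists>P r T. r \<notin> X \<and> pb \<Gamma> T \<and> realizes c \<Gamma> X ns P r T (vars \<Gamma> ! l)"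
    using r by blast
qed

lemma computable_input:
  assumes "computable c \<Gamma> h"
  shows "computable c \<Gamma> (\<lambda>q. arr (inp \<Gamma> q) (h q))"
proof (rule computableI)
  fix X :: "string set" and ns :: "string list"
  assume X: "finite X" "''in'' \<in> X" "set ns \<subseteq> X" "length ns = length (vars \<Gamma>)"
  obtain P r T where P: "r \<notin> X" "pb \<Gamma> T" "realizes c \<Gamma> X ns P r T h"
    using computableE[OF assms X] .
  let ?P = "Seq P (Write r (Const 0) (Read ''in'' (Read r (Const 0))))"
  let ?T = "\<lambda>q. T q + T q + sz \<Gamma> q + 5"
  have "realizes c \<Gamma> X ns ?P r ?T (\<lambda>q. arr (inp \<Gamma> q) (h q))"
  proof (rule realizesI)
    fix q assume q: "q \<in> pts \<Gamma>"
    let ?v = "arr (inp \<Gamma> q) (h q)"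
    have b: "bits ?v \<le> sz \<Gamma> q"
      using bits_arr_le[of "inp \<Gamma> q" "h q"] by (simp add: sz_def)
    show "\<bar>?v\<bar> \<le> 2 ^ ?T q"
      using abs_le_bits[of ?v] power_increasing[of "bits ?v" "?T q" "2::int"] b by linarith
    fix s assume s: "matches \<Gamma> ns q s"
    obtain t s1 where e: "exec c P s t s1" "t \<le> T q" "s1 r 0 = h q" "\<And>x. x \<in> X \<Longrightarrow> s1 x = s x"
      using realizes_exec[OF P(3) q s] by blast
    have i: "s1 ''in'' = arr (inp \<Gamma> q)" using s e(4)[OF X(2)] by (simp add: matches_def)
    let ?s' = "s1(r := (s1 r)(0 := ?v))"
    have "exec c ?P s (t + (3 + bits (h q) + bits ?v)) ?s'"
      using exec.Seq[OF e(1) exec.Write[of c r "Const 0" "Read ''in'' (Read r (Const 0))" s1]] i e(3)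
      by (simp add: eval_nat_numeral)
    moreover have "bits (h q) \<le> T q + 2" using bits_le[OF realizes_bound[OF P(3) q]] .
    ultimately show "\<exists>t s'. exec c ?P s t s' \<and> t \<le> ?T q \<and>
        s' r 0 = ?v \<and> (\<forall>x\<in>X. s' x = s x)"
      using P(1) e b by (intro exI[of _ "t + (3 + bits (h q) + bits ?v)"] exI[of _ ?s']) auto
  qed
  moreover have "pb \<Gamma> ?T" by (intro pb_intros P)
  ultimately show "\<exists>P r T. r \<notin> X \<and> pb \<Gamma> T \<and> realizes c \<Gamma> X ns P r T (\<lambda>q. arr (inp \<Gamma> q) (h q))"
    using P(1) by blast
qed

text \<open>\<open>Approx\<close> charges the precision itself, so the value of \<open>n\<close>,
  and not only its bit length, has to be polynomial.\<close>

lemma computable_approx: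
  assumes "computable c \<Gamma> (\<lambda>q. int (n q))" "pb \<Gamma> n"
  shows "computable c \<Gamma> (\<lambda>q. \<lfloor>c j * 2 ^ n q\<rfloor>)"
proof (rule computableI)
  fix X :: "string set" and ns :: "string list"
  assume X: "finite X" "''in'' \<in> X" "set ns \<subseteq> X" "length ns = length (vars \<Gamma>)"
  obtain P r T where P: "r \<notin> X" "pb \<Gamma> T" "realizes c \<Gamma> X ns P r T (\<lambda>q. int (n q))"
    using computableE[OF assms(1) X] .
  let ?P = "Seq P (Write r (Const 0) (Approx j (Read r (Const 0))))"
  \<comment> \<open>A constant, as \<open>c\<close> and \<open>j\<close> are fixed; it pays for the
    magnitude of \<open>c j\<close> and for the rounding.\<close>
  define C where "C = nat \<lceil>\<bar>c j\<bar>\<rceil> + 1"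
  let ?T = "\<lambda>q. T q + T q + n q + (C + n q) + 7"
  have "realizes c \<Gamma> X ns ?P r ?T (\<lambda>q. \<lfloor>c j * 2 ^ n q\<rfloor>)"
  proof (rule realizesI)
    fix q assume q: "q \<in> pts \<Gamma>"
    let ?v = "\<lfloor>c j * 2 ^ n q\<rfloor>"
    have cC: "\<bar>c j\<bar> + 1 \<le> C" unfolding C_def by linarith
    also have "C \<le> 2 ^ C" by (rule less_imp_le) (rule less_exp)
    then have "real C \<le> 2 ^ C" by (metis of_nat_le_iff of_nat_numeral of_nat_power)
    finally have cC: "\<bar>c j\<bar> + 1 \<le> 2 ^ C" .
    have "\<bar>real_of_int ?v\<bar> \<le> \<bar>c j * 2 ^ n q\<bar> + 1" by linarith
    also have "\<dots> \<le> (\<bar>c j\<bar> + 1) * 2 ^ n q" by (simp add: abs_mult algebra_simps)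
    also have "\<dots> \<le> 2 ^ C * 2 ^ n q" using cC by (intro mult_right_mono) auto
    finally have "\<bar>real_of_int ?v\<bar> \<le> of_int (2 ^ (C + n q))" by (simp add: power_add)
    then have v: "\<bar>?v\<bar> \<le> 2 ^ (C + n q)" by linarith
    then show "\<bar>?v\<bar> \<le> 2 ^ ?T q"
      using power_increasing[of "C + n q" "?T q" "2::int"] by linarith
    have b: "bits ?v \<le> C + n q + 2" using bits_le[OF v] .
    fix s assume s: "matches \<Gamma> ns q s"
    obtain t s1 where e: "exec c P s t s1" "t \<le> T q" "s1 r 0 = int (n q)" "\<And>x. x \<in> X \<Longrightarrow> s1 x = s x"
      using realizes_exec[OF P(3) q s] by blast
    let ?s' = "s1(r := (s1 r)(0 := ?v))"
    have "exec c ?P s (t + (3 + bits (int (n q)) + n q + bits ?v)) ?s'"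
      using exec.Seq[OF e(1) exec.Write[of c r "Const 0" "Approx j (Read r (Const 0))" s1]] e(3)
      by (simp add: add_ac eval_nat_numeral)
    moreover have "bits (int (n q)) \<le> T q + 2" using bits_le[OF realizes_bound[OF P(3) q]] .
    ultimately show "\<exists>t s'. exec c ?P s t s' \<and> t \<le> ?T q \<and>
        s' r 0 = ?v \<and> (\<forall>x\<in>X. s' x = s x)"
      using P(1) e b
      by (intro exI[of _ "t + (3 + bits (int (n q)) + n q + bits ?v)"] exI[of _ ?s']) auto
  qed
  moreover have "pb \<Gamma> ?T" by (intro pb_intros P assms)
  ultimately show "\<exists>P r T. r \<notin> X \<and> pb \<Gamma> T \<and> realizes c \<Gamma> X ns P r T (\<lambda>q. \<lfloor>c j * 2 ^ n q\<rfloor>)"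
    using P(1) by blast
qed

text \<open>One program pattern for all binary operators: \<open>con\<close> is the syntax,
  \<open>op\<close> the meaning, and \<open>bound\<close> says that bit lengths grow additively,
  which keeps them polynomial.\<close>

lemma computable_op:
  assumes "computable c \<Gamma> a" "computable c \<Gamma> b"
    and aval: "\<And>x y s. aval c (con x y) s = op (aval c x s) (aval c y s)"
    and acost: "\<And>x y s. acost c (con x y) s = acost c x s + acost c y s + bits (op (aval c x s) (aval c y s))"
    and bound: "\<And>x y m n. \<bar>x\<bar> \<le> 2 ^ m \<Longrightarrow> \<bar>y\<bar> \<le> 2 ^ n \<Longrightarrow> \<bar>op x y\<bar> \<le> 2 ^ (m + n + 1)"
  shows "computable c \<Gamma> (\<lambda>q. op (a q) (b q))"
proof (rule computableI)
  fix X :: "string set" and ns :: "string list"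
  assume X: "finite X" "''in'' \<in> X" "set ns \<subseteq> X" "length ns = length (vars \<Gamma>)"
  obtain P r T where P: "r \<notin> X" "pb \<Gamma> T" "realizes c \<Gamma> X ns P r T a"
    using computableE[OF assms(1) X] .
  \<comment> \<open>The first result \<open>r\<close> is protected while the second program
    runs.\<close>
  obtain P' r' T' where P': "r' \<notin> insert r X" "pb \<Gamma> T'" "realizes c \<Gamma> (insert r X) ns P' r' T' b"
    by (rule computableE[OF assms(2), of "insert r X" ns]) (use X in auto)
  let ?Q = "con (Read r (Const 0)) (Read r' (Const 0))"
  let ?P = "Seq P (Seq P' (Write r' (Const 0) ?Q))"
  let ?T = "\<lambda>q. T q + T q + T' q + T' q + T q + T' q + 11"
  have "realizes c \<Gamma> X ns ?P r' ?T (\<lambda>q. op (a q) (b q))"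
  proof (rule realizesI)
    fix q assume q: "q \<in> pts \<Gamma>"
    let ?v = "op (a q) (b q)"
    have v: "\<bar>?v\<bar> \<le> 2 ^ (T q + T' q + 1)"
      using bound realizes_bound[OF P(3) q] realizes_bound[OF P'(3) q] .
    then show "\<bar>?v\<bar> \<le> 2 ^ ?T q"
      using power_increasing[of "T q + T' q + 1" "?T q" "2::int"] by linarith
    have b: "bits ?v \<le> T q + T' q + 3" "bits (a q) \<le> T q + 2" "bits (b q) \<le> T' q + 2"
      using bits_le[OF v] bits_le[OF realizes_bound[OF P(3) q]]
        bits_le[OF realizes_bound[OF P'(3) q]] by simp_all
    fix s assume s: "matches \<Gamma> ns q s"
    obtain t s1 where e: "exec c P s t s1" "t \<le> T q" "s1 r 0 = a q" "\<And>x. x \<in> X \<Longrightarrow> s1 x = s x"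
      using realizes_exec[OF P(3) q s] by blast
    obtain t' s2 where e': "exec c P' s1 t' s2" "t' \<le> T' q" "s2 r' 0 = b q"
        "\<And>x. x \<in> insert r X \<Longrightarrow> s2 x = s1 x"
      using realizes_exec[OF P'(3) q matches_frame[OF s e(4) X(2,3)]] by blast
    have r: "s2 r 0 = a q" using e(3) e'(4)[of r] by simp
    let ?s' = "s2(r' := (s2 r')(0 := ?v))"
    let ?t = "t + (t' + (4 + bits (a q) + bits (b q) + bits ?v))"
    have "exec c ?P s (t + (t' + (1 + acost c (Const 0) s2 + acost c ?Q s2))) ?s'"
      using exec.Seq[OF e(1) exec.Seq[OF e'(1) exec.Write[of c r' "Const 0" ?Q s2]]] r e'(3)
      by (simp add: aval)
    moreover have "acost c ?Q s2 = 2 + bits (a q) + bits (b q) + bits ?v"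
      using r e'(3) by (simp add: acost)
    ultimately have "exec c ?P s ?t ?s'" by (simp add: add_ac eval_nat_numeral)
    moreover have "?t \<le> ?T q" using e(2) e'(2) b by linarith
    ultimately show "\<exists>t s'. exec c ?P s t s' \<and> t \<le> ?T q \<and>
        s' r' 0 = ?v \<and> (\<forall>x\<in>X. s' x = s x)"
      using P'(1) e(4) e'(4) by (intro exI[of _ ?t] exI[of _ ?s']) auto
  qed
  moreover have "pb \<Gamma> ?T" by (intro pb_intros P P')
  ultimately show "\<exists>P r T. r \<notin> X \<and> pb \<Gamma> T \<and> realizes c \<Gamma> X ns P r T (\<lambda>q. op (a q) (b q))"
    using P'(1) by blast
qed

lemma abs_add_le_power:
  fixes x y :: int
  assumes "\<bar>x\<bar> \<le> 2 ^ m" "\<bar>y\<bar> \<le> 2 ^ n"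
  shows "\<bar>x\<bar> + \<bar>y\<bar> \<le> 2 ^ (m + n + 1)"
proof -
  have "(2::int) ^ m \<le> 2 ^ (m + n)" "(2::int) ^ n \<le> 2 ^ (m + n)" by (auto intro!: power_increasing)
  moreover have "(2::int) ^ (m + n + 1) = 2 * 2 ^ (m + n)" by simp
  ultimately show ?thesis using assms by linarith
qed

text \<open>A negative divisor is reduced to a positive one by changing both signs; division by 0
  yields 0, so that \<open>computable_div\<close> covers all divisors.\<close>

lemma abs_div_le: "\<bar>x div y\<bar> \<le> \<bar>x :: int\<bar>"
proof (cases "y = 0")
  case False
  have *: "\<bar>a div b\<bar> \<le> \<bar>a\<bar>" if "b > 0" for a b :: int
  proof (cases "a \<ge> 0")
    case True
    then show ?thesis using that zdiv_mono2[of a 1 b] by (simp add: pos_imp_zdiv_nonneg_iff)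
  next
    case neg: False
    have "a \<le> a div b" using that neg zdiv_mono2_neg[of a 1 b] by simp
    moreover have "a div b \<le> 0" using that neg by (simp add: div_nonpos_pos_le0)
    ultimately show ?thesis by simp
  qed
  show ?thesis
    using *[of y x] *[of "- y" "- x"] False by (cases "y > 0") auto
qed simp

lemma computable_add:
  assumes "computable c \<Gamma> a" "computable c \<Gamma> b"
  shows "computable c \<Gamma> (\<lambda>q. a q + b q)"
proof (rule computable_op[where con = Plus, OF assms])
  fix x y :: int and m n assume "\<bar>x\<bar> \<le> 2 ^ m" "\<bar>y\<bar> \<le> 2 ^ n"
  then show "\<bar>x + y\<bar> \<le> 2 ^ (m + n + 1)"
    using abs_add_le_power[of x m y n] by linarith
qed simp_all

lemma computable_diff:
  assumes "computable c \<Gamma> a" "computable c \<Gamma> b"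
  shows "computable c \<Gamma> (\<lambda>q. a q - b q)"
proof (rule computable_op[where con = Minus, OF assms])
  fix x y :: int and m n assume "\<bar>x\<bar> \<le> 2 ^ m" "\<bar>y\<bar> \<le> 2 ^ n"
  then show "\<bar>x - y\<bar> \<le> 2 ^ (m + n + 1)"
    using abs_add_le_power[of x m y n] by linarith
qed simp_all

lemma computable_mult:
  assumes "computable c \<Gamma> a" "computable c \<Gamma> b"
  shows "computable c \<Gamma> (\<lambda>q. a q * b q)"
proof (rule computable_op[where con = Times, OF assms])
  fix x y :: int and m n assume "\<bar>x\<bar> \<le> 2 ^ m" "\<bar>y\<bar> \<le> 2 ^ n"
  then have "\<bar>x * y\<bar> \<le> 2 ^ (m + n)" by (simp add: abs_mult power_add mult_mono)
  then show "\<bar>x * y\<bar> \<le> 2 ^ (m + n + 1)"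
    using power_increasing[of "m + n" "m + n + 1" "2::int"] by linarith
qed simp_all

lemma computable_div:
  assumes "computable c \<Gamma> a" "computable c \<Gamma> b"
  shows "computable c \<Gamma> (\<lambda>q. a q div b q)"
proof (rule computable_op[where con = Div, OF assms])
  fix x y :: int and m n assume "\<bar>x\<bar> \<le> 2 ^ m"
  then show "\<bar>x div y\<bar> \<le> 2 ^ (m + n + 1)"
    using abs_div_le[of x y] power_increasing[of "m" "m + n + 1" "2::int"] by linarith
qed simp_all

lemma computable_mod:
  assumes "computable c \<Gamma> a" "computable c \<Gamma> b"
  shows "computable c \<Gamma> (\<lambda>q. a q mod b q)"
  unfolding minus_mult_div_eq_mod[symmetric]
  by (intro computable_diff computable_mult computable_div assms)

definition computable_pred :: "(nat \<Rightarrow> real) \<Rightarrow> 'q ctx \<Rightarrow> ('q \<Rightarrow> bool) \<Rightarrow> bool" where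
  "computable_pred c \<Gamma> P \<longleftrightarrow> computable c \<Gamma> (\<lambda>q. of_bool (P q))"

lemma computable_of_bool: "computable_pred c \<Gamma> P \<Longrightarrow> computable c \<Gamma> (\<lambda>q. of_bool (P q))"
  unfolding computable_pred_def .

text \<open>The division yields \<open>-1\<close> for negative and \<open>0\<close> for nonnegative differences.\<close>

lemma computable_less:
  assumes "computable c \<Gamma> a" "computable c \<Gamma> b"
  shows "computable_pred c \<Gamma> (\<lambda>q. a q < b q)"
proof -
  have sgn: "0 - z div (z * z + 1) = of_bool (z < 0)" for z :: int
  proof (cases "z < 0")
    case True
    have "z div (z * z + 1) = - 1"
    proof (rule int_div_pos_eq[where r = "z * z + 1 + z"])
      have "0 \<le> (z + 1) * z" using True by (intro mult_nonpos_nonpos) auto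
      then show "0 \<le> z * z + 1 + z" by (simp add: algebra_simps)
    qed (use True in auto)
    then show ?thesis using True by simp
  next
    case False
    then have "0 \<le> z * (z - 1)" by (cases "z = 0") auto
    then have "z < z * z + 1" by (simp add: algebra_simps)
    then show ?thesis using False by simp
  qed
  have "computable c \<Gamma> (\<lambda>q. 0 - (a q - b q) div ((a q - b q) * (a q - b q) + 1))"
    by (intro computable_diff computable_div computable_add computable_mult computable_const assms)
  then show ?thesis unfolding sgn computable_pred_def by simp
qed

lemma computable_not:
  assumes "computable_pred c \<Gamma> P"
  shows "computable_pred c \<Gamma> (\<lambda>q. \<not> P q)"
proof -
  have "computable c \<Gamma> (\<lambda>q. 1 - of_bool (P q))"
    by (intro computable_diff computable_const computable_of_bool assms)
  then show ?thesis unfolding computable_pred_def by (rule computable_cong) simp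
qed

lemma computable_and:
  assumes "computable_pred c \<Gamma> P" "computable_pred c \<Gamma> Q"
  shows "computable_pred c \<Gamma> (\<lambda>q. P q \<and> Q q)"
proof -
  have "computable c \<Gamma> (\<lambda>q. of_bool (P q) * of_bool (Q q))"
    by (intro computable_mult computable_of_bool assms)
  then show ?thesis unfolding computable_pred_def by (rule computable_cong) simp
qed

lemma computable_le:
  assumes "computable c \<Gamma> a" "computable c \<Gamma> b"
  shows "computable_pred c \<Gamma> (\<lambda>q. a q \<le> b q)"
  unfolding not_less[symmetric] by (intro computable_not computable_less assms)

lemma computable_eq:
  assumes "computable c \<Gamma> a" "computable c \<Gamma> b"
  shows "computable_pred c \<Gamma> (\<lambda>q. a q = b q)"
  unfolding eq_iff by (intro computable_and computable_le assms)

text \<open>Both branches are evaluated and then selected arithmetically, so they have to be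
  computable on all points, including those where the other branch is taken.\<close>

lemma computable_if:
  assumes "computable_pred c \<Gamma> P" "computable c \<Gamma> a" "computable c \<Gamma> b"
  shows "computable c \<Gamma> (\<lambda>q. if P q then a q else b q)"
proof -
  have "computable c \<Gamma> (\<lambda>q. of_bool (P q) * a q + (1 - of_bool (P q)) * b q)"
    by (intro computable_add computable_diff computable_mult computable_const computable_of_bool assms)
  then show ?thesis by (rule computable_cong) simp
qed

subsection \<open>Loops\<close>

text \<open>The new component is held in a program variable and leaves \<open>sz\<close> unchanged,
  so bounds inside a loop remain polynomial in the size of the point outside.\<close>

definition ext :: "'q ctx \<Rightarrow> ('v \<Rightarrow> int) \<Rightarrow> ('q \<Rightarrow> 'v set) \<Rightarrow> ('q \<times> 'v) ctx" where
  "ext \<Gamma> v S = \<lparr>pts = {z. fst z \<in> pts \<Gamma> \<and> snd z \<in> S (fst z)}, inp = inp \<Gamma> \<circ> fst,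
     extra = extra \<Gamma> \<circ> fst, vars = (v \<circ> snd) # map (\<lambda>h. h \<circ> fst) (vars \<Gamma>)\<rparr>"

definition loop :: "'q ctx \<Rightarrow> ('q \<Rightarrow> nat) \<Rightarrow> ('q \<times> nat) ctx" where
  "loop \<Gamma> n = ext \<Gamma> int (\<lambda>q. {..<n q})"

text \<open>The accumulator ranges over the single value it has in round \<open>k\<close>. The body
  thus has to be computable only along the actual run, where its argument can be bounded in
  advance.\<close>

definition iter :: "'q ctx \<Rightarrow> ('q \<Rightarrow> nat) \<Rightarrow> ('q \<Rightarrow> nat \<Rightarrow> int) \<Rightarrow> (('q \<times> nat) \<times> int) ctx" where
  "iter \<Gamma> n A = ext (loop \<Gamma> n) (\<lambda>a. a) (\<lambda>z. {A (fst z) (snd z)})"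

lemma ext_simps [simp]:
  "z \<in> pts (ext \<Gamma> v S) \<longleftrightarrow> fst z \<in> pts \<Gamma> \<and> snd z \<in> S (fst z)"
  "inp (ext \<Gamma> v S) z = inp \<Gamma> (fst z)"
  "sz (ext \<Gamma> v S) z = sz \<Gamma> (fst z)"
  "vars (ext \<Gamma> v S) = (v \<circ> snd) # map (\<lambda>h. h \<circ> fst) (vars \<Gamma>)"
  by (auto simp: ext_def sz_def)

lemma matches_ext [simp]:
  "matches (ext \<Gamma> v S) (x # ns) z s \<longleftrightarrow> s x 0 = v (snd z) \<and> matches \<Gamma> ns (fst z) s"
  by (auto simp: matches_def list.rel_map(2))

lemma pb_ext: "pb \<Gamma> n \<Longrightarrow> pb (ext \<Gamma> v S) (\<lambda>z. n (fst z))"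
  unfolding pb_def by fastforce

lemma computable_ext:
  assumes "computable c \<Gamma> h"
  shows "computable c (ext \<Gamma> v S) (\<lambda>z. h (fst z))"
proof (rule computableI)
  fix X :: "string set" and ns' :: "string list"
  assume X: "finite X" "''in'' \<in> X" "set ns' \<subseteq> X" "length ns' = length (vars (ext \<Gamma> v S))"
  then obtain x ns where ns': "ns' = x # ns" by (cases ns') auto
  obtain P r T where P: "r \<notin> X" "pb \<Gamma> T" "realizes c \<Gamma> X ns P r T h"
    by (rule computableE[OF assms, of X ns]) (use X ns' in auto)
  have "realizes c (ext \<Gamma> v S) X ns' P r (\<lambda>z. T (fst z)) (\<lambda>z. h (fst z))"
    using P(3) unfolding realizes_def ns' by auto
  with P(1) pb_ext[OF P(2)]
  show "\<exists>P r T. r \<notin> X \<and> pb (ext \<Gamma> v S) T \<and> realizes c (ext \<Gamma> v S) X ns' P r T (\<lambda>z. h (fst z))"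
    by blast
qed

lemma computable_last:
  assumes "pb (ext \<Gamma> v S) T" "\<And>q a. q \<in> pts \<Gamma> \<Longrightarrow> a \<in> S q \<Longrightarrow> \<bar>v a\<bar> \<le> 2 ^ T (q, a)"
  shows "computable c (ext \<Gamma> v S) (\<lambda>z. v (snd z))"
proof -
  have "computable c (ext \<Gamma> v S) (vars (ext \<Gamma> v S) ! 0)"
    by (rule computable_var[OF _ assms(1)]) (use assms(2) in auto)
  then show ?thesis by (simp add: comp_def)
qed

text \<open>Polynomial in value, not merely in bit length: such numbers may serve as loop lengths,
  exponents and precisions.\<close>

definition computable_nat :: "(nat \<Rightarrow> real) \<Rightarrow> 'q ctx \<Rightarrow> ('q \<Rightarrow> nat) \<Rightarrow> bool" where
  "computable_nat c \<Gamma> n \<longleftrightarrow> computable c \<Gamma> (\<lambda>q. int (n q)) \<and> pb \<Gamma> n"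

lemma computable_int: "computable_nat c \<Gamma> n \<Longrightarrow> computable c \<Gamma> (\<lambda>q. int (n q))"
  unfolding computable_nat_def by blast

lemma computable_nat_pb: "computable_nat c \<Gamma> n \<Longrightarrow> pb \<Gamma> n"
  unfolding computable_nat_def by blast

lemma computable_nat_ext: "computable_nat c \<Gamma> n \<Longrightarrow> computable_nat c (ext \<Gamma> v S) (\<lambda>z. n (fst z))"
  unfolding computable_nat_def
  using computable_ext[of c \<Gamma> "\<lambda>q. int (n q)"] pb_ext by blast

lemma int_le_power: "\<bar>int k\<bar> \<le> 2 ^ k"
  by (metis abs_of_nat less_exp less_imp_le of_nat_le_iff of_nat_numeral of_nat_power)

lemma computable_nat_last:
  assumes "computable_nat c \<Gamma> n"
  shows "computable_nat c (loop \<Gamma> n) snd"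
proof -
  have "pb (ext \<Gamma> int (\<lambda>q. {..<n q})) (\<lambda>z. n (fst z))"
    by (rule pb_ext[OF computable_nat_pb[OF assms]])
  then have pb: "pb (loop \<Gamma> n) snd"
    unfolding loop_def by (rule pb_mono) auto
  moreover have "computable c (loop \<Gamma> n) (\<lambda>z. int (snd z))"
    unfolding loop_def
    by (rule computable_last[where T = snd]) (use pb int_le_power in \<open>auto simp: loop_def\<close>)
  ultimately show ?thesis unfolding computable_nat_def by blast
qed

text \<open>The invariant carries the round number, which fixes the number of rounds. One
  \<open>T\<close> pays for a test together with a body, and one further \<open>T\<close> for the
  last, failing test.\<close>

lemma while_exec:
  assumes step: "\<And>k s. k < n \<Longrightarrow> I k s \<Longrightarrow> bval c b s \<and>
      (\<exists>t s'. exec c P s t s' \<and> I (Suc k) s' \<and> 1 + bcost c b s + t \<le> T)"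
    and stop: "\<And>s. I n s \<Longrightarrow> \<not> bval c b s \<and> 1 + bcost c b s \<le> T"
    and "I k s" "k \<le> n"
  shows "\<exists>t s'. exec c (While b P) s t s' \<and> I n s' \<and> t \<le> (n - k + 1) * T"
  using \<open>I k s\<close> \<open>k \<le> n\<close>
proof (induction "n - k" arbitrary: k s)
  case 0
  then have s: "I n s" by simp
  with stop show ?case
    using 0 exec.WhileFalse[of c b s P] by (intro exI[of _ "1 + bcost c b s"] exI[of _ s]) auto
next
  case (Suc m)
  then have k: "k < n" by simp
  from step[OF k Suc.prems(1)] obtain t s' where
    t: "bval c b s" "exec c P s t s'" "I (Suc k) s'" "1 + bcost c b s + t \<le> T" by blast
  have "m = n - Suc k" "Suc k \<le> n" using Suc.hyps(2) k by auto
  from Suc.hyps(1)[OF this(1) t(3) this(2)] obtain t' s'' where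
    t': "exec c (While b P) s' t' s''" "I n s''" "t' \<le> (n - Suc k + 1) * T" by blast
  have "n - k + 1 = Suc (n - Suc k + 1)" using k by simp
  then have "1 + bcost c b s + t + t' \<le> (n - k + 1) * T" using t(4) t'(3) by simp
  with exec.WhileTrue[OF t(1,2) t'(1)] t'(2) show ?case by blast
qed

lemma write_exec:
  "exec c (Write x (Const 0) e) s (2 + acost c e s) (s(x := (s x)(0 := aval c e s)))"
  using exec.Write[of c x "Const 0" e s] by simp

text \<open>The danger of iteration is growth of the accumulator: repeated squaring yields
  exponentially many bits. It is excluded because \<open>h\<close> has to be computable on
  \<open>iter \<Gamma> n A\<close>, whose size ignores the accumulator; a body that reads the
  accumulator must supply an a priori bound, through \<open>computable_acc\<close>.\<close>

lemma computable_iter: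
  assumes n: "computable_nat c \<Gamma> n" and init: "computable c \<Gamma> (\<lambda>q. A q 0)"
    and step: "computable c (iter \<Gamma> n A) h"
    and A: "\<And>q k. q \<in> pts \<Gamma> \<Longrightarrow> k < n q \<Longrightarrow> A q (Suc k) = h ((q, k), A q k)"
  shows "computable c \<Gamma> (\<lambda>q. A q (n q))"
proof (rule computableI)
  fix X :: "string set" and ns :: "string list"
  assume X: "finite X" "''in'' \<in> X" "set ns \<subseteq> X" "length ns = length (vars \<Gamma>)"
  obtain P0 r0 T0 where P0: "r0 \<notin> X" "pb \<Gamma> T0" "realizes c \<Gamma> X ns P0 r0 T0 (\<lambda>q. A q 0)"
    using computableE[OF init X] .
  obtain Pn rn Tn where Pn: "rn \<notin> insert r0 X" "pb \<Gamma> Tn"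
      "realizes c \<Gamma> (insert r0 X) ns Pn rn Tn (\<lambda>q. int (n q))"
    by (rule computableE[OF computable_int[OF n], of "insert r0 X" ns]) (use X in auto)
  obtain i where i: "i \<notin> insert rn (insert r0 X)" by (rule fresh_name[of "insert rn (insert r0 X)"]) (use X in auto)
  obtain a where a: "a \<notin> insert i (insert rn (insert r0 X))"
    by (rule fresh_name[of "insert i (insert rn (insert r0 X))"]) (use X in auto)
  define X' where "X' = insert a (insert i (insert rn X))"
  obtain P r T where P: "r \<notin> X'" "pb (iter \<Gamma> n A) T" "realizes c (iter \<Gamma> n A) X' (a # i # ns) P r T h"
    by (rule computableE[OF step, of X' "a # i # ns"]) (use X in \<open>auto simp: X'_def iter_def loop_def\<close>)
  \<comment> \<open>All rounds share one exponent, and the extended points have the size of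
    \<open>q\<close>; hence \<open>B q\<close> bounds every round.\<close>
  obtain K where K: "\<forall>z\<in>pts (iter \<Gamma> n A). T z \<le> sz (iter \<Gamma> n A) z ^ K" using P(2) unfolding pb_def by blast
  define B where "B q = sz \<Gamma> q ^ K" for q
  have B: "pb \<Gamma> B" unfolding B_def pb_def by auto
  have TB: "T ((q, k), A q k) \<le> B q" if "q \<in> pts \<Gamma>" "k < n q" for q k
    using K[rule_format, of "((q, k), A q k)"] that by (simp add: iter_def loop_def B_def)
  have A0: "\<bar>A q 0\<bar> \<le> 2 ^ T0 q" if "q \<in> pts \<Gamma>" for q
    using realizes_bound[OF P0(3) that] .
  \<comment> \<open>No induction on the rounds: each later accumulator is a value of
    \<open>h\<close>, and these are bounded by \<open>B\<close>.\<close>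
  have ASuc: "\<bar>A q (Suc k)\<bar> \<le> 2 ^ B q" if "q \<in> pts \<Gamma>" "k < n q" for q k
  proof -
    have "\<bar>h ((q, k), A q k)\<bar> \<le> 2 ^ T ((q, k), A q k)"
      by (rule realizes_bound[OF P(3)]) (use that in \<open>simp add: iter_def loop_def\<close>)
    also have "\<dots> \<le> 2 ^ B q" by (rule power_increasing[OF TB[OF that]]) simp
    finally show ?thesis using A[OF that] by simp
  qed
  let ?body = "Seq P (Seq (Write a (Const 0) (Read r (Const 0)))
      (Write i (Const 0) (Plus (Read i (Const 0)) (Const 1))))"
  let ?while = "While (Less (Read i (Const 0)) (Read rn (Const 0))) ?body"
  let ?P = "Seq P0 (Seq Pn (Seq (Write i (Const 0) (Const 0))
      (Seq (Write a (Const 0) (Read r0 (Const 0))) ?while)))"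
  \<comment> \<open>One \<open>B\<close> pays for the body, the other for copying the new value; the
    rest pays for the counters.\<close>
  define U where "U q = 2 * B q + 5 * n q + 40" for q
  define V where "V q = T0 q + (Tn q + (3 + ((T0 q + 6) + (n q + 1) * U q))) + B q" for q
  have U: "pb \<Gamma> U" unfolding U_def by (intro pb_intros B computable_nat_pb[OF n])
  have V: "pb \<Gamma> V" unfolding V_def by (intro pb_intros B U P0 Pn computable_nat_pb[OF n])
  have "realizes c \<Gamma> X ns ?P a V (\<lambda>q. A q (n q))"
  proof (rule realizesI)
    fix q assume q: "q \<in> pts \<Gamma>"
    have le: "T0 q \<le> V q" "B q \<le> V q" unfolding V_def by simp_all
    show "\<bar>A q (n q)\<bar> \<le> 2 ^ V q"
      using abs_le_power_mono[OF A0[OF q] le(1)] abs_le_power_mono[OF ASuc[OF q, of "n q - 1"] le(2)]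
      by (cases "n q") auto
    fix s assume s: "matches \<Gamma> ns q s"
    obtain t0 s0 where e0: "exec c P0 s t0 s0" "t0 \<le> T0 q" "s0 r0 0 = A q 0" "\<And>x. x \<in> X \<Longrightarrow> s0 x = s x"
      using realizes_exec[OF P0(3) q s] by blast
    obtain t1 s1 where e1: "exec c Pn s0 t1 s1" "t1 \<le> Tn q" "s1 rn 0 = int (n q)"
        "\<And>x. x \<in> insert r0 X \<Longrightarrow> s1 x = s0 x"
      using realizes_exec[OF Pn(3) q matches_frame[OF s e0(4) X(2,3)]] by blast
    have r0: "s1 r0 0 = A q 0" using e0(3) e1(4)[of r0] by simp
    define I where "I k s' \<longleftrightarrow> s' i 0 = int k \<and> s' a 0 = A q k \<and> s' rn 0 = int (n q) \<and>
      (\<forall>x\<in>X. s' x = s x)" for k and s' :: state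
    define s2 where "s2 = s1(i := (s1 i)(0 := 0))"
    define s3 where "s3 = s2(a := (s2 a)(0 := A q 0))"
    have e2: "exec c (Write i (Const 0) (Const 0)) s1 3 s2"
      using write_exec[of c i "Const 0" s1] by (simp add: s2_def)
    have "s2 r0 0 = A q 0" using r0 i by (auto simp: s2_def)
    then have e3: "exec c (Write a (Const 0) (Read r0 (Const 0))) s2 (3 + bits (A q 0)) s3"
      using write_exec[of c a "Read r0 (Const 0)" s2] by (simp add: s3_def eval_nat_numeral)
    have "3 + bits (A q 0) \<le> T0 q + 6" using bits_le[OF A0[OF q]] by simp
    note e3 = e3 this
    have I0: "I 0 s3"
      unfolding I_def s3_def s2_def using i a e1(3) e1(4) e0(4) Pn(1) by auto
    have bn: "bits (int k) \<le> k + 2" for k using bits_le[OF int_le_power] .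
    have b1: "bits 1 \<le> 3" using bn[of 1] by simp
    have "\<exists>t s'. exec c ?while s3 t s' \<and> I (n q) s' \<and> t \<le> (n q - 0 + 1) * U q"
    proof (rule while_exec[where I = I])
      fix k s' assume k: "k < n q" and I: "I k s'"
      let ?z = "((q, k), A q k)"
      have z: "?z \<in> pts (iter \<Gamma> n A)" using q k by (simp add: iter_def loop_def)
      have m: "matches (iter \<Gamma> n A) (a # i # ns) ?z s'"
        using I matches_frame[OF s, of X s'] X(2,3) by (auto simp: iter_def loop_def I_def)
      obtain t4 s4 where e4: "exec c P s' t4 s4" "t4 \<le> T ?z" "s4 r 0 = h ?z" "\<And>x. x \<in> X' \<Longrightarrow> s4 x = s' x"
        using realizes_exec[OF P(3) z m] by blast
      define s5 where "s5 = s4(a := (s4 a)(0 := A q (Suc k)))"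
      define s6 where "s6 = s5(i := (s5 i)(0 := int (Suc k)))"
      have e5: "exec c (Write a (Const 0) (Read r (Const 0))) s4 (3 + bits (A q (Suc k))) s5"
        using write_exec[of c a "Read r (Const 0)" s4] e4(3) A[OF q k] by (simp add: s5_def eval_nat_numeral)
      have "s5 i 0 = int k"
        using e4(4)[of i] I a by (auto simp: s5_def X'_def I_def)
      then have e6: "exec c (Write i (Const 0) (Plus (Read i (Const 0)) (Const 1))) s5
          (3 + bits (int k) + bits 1 + bits (int (Suc k))) s6"
        using write_exec[of c i "Plus (Read i (Const 0)) (Const 1)" s5]
        by (simp add: s6_def eval_nat_numeral add_ac)
      let ?t = "t4 + ((3 + bits (A q (Suc k))) + (3 + bits (int k) + bits 1 + bits (int (Suc k))))"
      have e: "exec c ?body s' ?t s6" by (rule exec.Seq[OF e4(1) exec.Seq[OF e5 e6]])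
      have I': "I (Suc k) s6"
        unfolding I_def s6_def s5_def using e4(4) I a i by (auto simp: X'_def I_def)
      have b: "bval c (Less (Read i (Const 0)) (Read rn (Const 0))) s'"
        using I k by (simp add: I_def)
      have bc: "bcost c (Less (Read i (Const 0)) (Read rn (Const 0))) s' = 3 + bits (int k) + bits (int (n q))"
        using I by (simp add: I_def)
      have "1 + bcost c (Less (Read i (Const 0)) (Read rn (Const 0))) s' + ?t \<le> U q"
        unfolding bc U_def
        using TB[OF q k] e4(2) bits_le[OF ASuc[OF q k]] bn[of k] bn[of "Suc k"] bn[of "n q"] b1 k
        by linarith
      with b e I' show "bval c (Less (Read i (Const 0)) (Read rn (Const 0))) s' \<and>
        (\<exists>t s''. exec c ?body s' t s'' \<and> I (Suc k) s'' \<and>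
          1 + bcost c (Less (Read i (Const 0)) (Read rn (Const 0))) s' + t \<le> U q)" by blast
    next
      fix s' assume "I (n q) s'"
      then show "\<not> bval c (Less (Read i (Const 0)) (Read rn (Const 0))) s' \<and>
          1 + bcost c (Less (Read i (Const 0)) (Read rn (Const 0))) s' \<le> U q"
        using bn[of "n q"] by (auto simp: I_def U_def)
    qed (use I0 in auto)
    then obtain t s' where e: "exec c ?while s3 t s'" "I (n q) s'" "t \<le> (n q + 1) * U q" by auto
    let ?t = "t0 + (t1 + (3 + ((3 + bits (A q 0)) + t)))"
    have "exec c ?P s ?t s'" by (rule exec.Seq[OF e0(1) exec.Seq[OF e1(1) exec.Seq[OF e2 exec.Seq[OF e3(1) e(1)]]]])
    moreover have "?t \<le> V q" unfolding V_def using e0(2) e1(2) e3(2) e(3) by linarith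
    ultimately show "\<exists>t s'. exec c ?P s t s' \<and> t \<le> V q \<and> s' a 0 = A q (n q) \<and> (\<forall>x\<in>X. s' x = s x)"
      using e(2) unfolding I_def by blast
  qed
  with V a show "\<exists>P r T. r \<notin> X \<and> pb \<Gamma> T \<and> realizes c \<Gamma> X ns P r T (\<lambda>q. A q (n q))" by blast
qed

text \<open>Here the number of rounds is the result itself, so the loop is programmed directly: 1 is
  doubled until it exceeds \<open>h q\<close>. For \<open>h q \<le> 0\<close> it stops at once, in
  accordance with \<open>bitlen\<close>. This is the source of logarithms as numbers of polynomial
  value.\<close>

lemma computable_bitlen:
  assumes "computable c \<Gamma> h"
  shows "computable_nat c \<Gamma> (\<lambda>q. nat (bitlen (h q)))"
proof -
  let ?n = "\<lambda>q. nat (bitlen (h q))"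
  have n_le: "?n q \<le> m + 1" if "\<bar>h q\<bar> \<le> 2 ^ m" for q m
  proof -
    have "h q < 2 ^ (m + 1)" using that zero_less_power[of "2::int" m] by (simp del: zero_less_power)
    then have "bitlen (h q) \<le> int (m + 1)" by (simp only: bitlen_le_iff_power nat_int) simp
    then show ?thesis by simp
  qed
  have lt: "2 ^ k \<le> h q" if "k < ?n q" for k q
  proof -
    have "int (k + 1) \<le> bitlen (h q)" using that by linarith
    then show ?thesis by (simp add: bitlen_ge_iff_power nat_add_distrib)
  qed
  have gt: "h q < 2 ^ ?n q" for q
    using bitlen_bounds[of "h q"] order.strict_trans1[of "h q" 0 "2 ^ ?n q"]
    by (cases "h q > 0") simp_all
  obtain T where T: "pb \<Gamma> T" "\<And>q. q \<in> pts \<Gamma> \<Longrightarrow> \<bar>h q\<bar> \<le> 2 ^ T q" using computable_bound[OF assms] by blast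
  have "pb \<Gamma> (\<lambda>q. T q + 1)" by (intro pb_intros T)
  then have "pb \<Gamma> ?n" by (rule pb_mono) (use n_le T in auto)
  moreover have "computable c \<Gamma> (\<lambda>q. int (?n q))"
  proof (rule computableI)
    fix X :: "string set" and ns :: "string list"
    assume X: "finite X" "''in'' \<in> X" "set ns \<subseteq> X" "length ns = length (vars \<Gamma>)"
    obtain P r T where P: "r \<notin> X" "pb \<Gamma> T" "realizes c \<Gamma> X ns P r T h"
      using computableE[OF assms X] .
    obtain y where y: "y \<notin> insert r X" by (rule fresh_name[of "insert r X"]) (use X in auto)
    obtain e where e: "e \<notin> insert y (insert r X)" by (rule fresh_name[of "insert y (insert r X)"]) (use X in auto)
    let ?body = "Seq (Write y (Const 0) (Plus (Read y (Const 0)) (Read y (Const 0))))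
      (Write e (Const 0) (Plus (Read e (Const 0)) (Const 1)))"
    let ?b = "Not (Less (Read r (Const 0)) (Read y (Const 0)))"
    let ?P = "Seq P (Seq (Write y (Const 0) (Const 1)) (Seq (Write e (Const 0) (Const 0)) (While ?b ?body)))"
    define U where "U q = 10 * T q + 60" for q
    define V where "V q = T q + (5 + (3 + (T q + 2) * U q))" for q
    have V: "pb \<Gamma> V" unfolding V_def U_def by (intro pb_intros P)
    have "realizes c \<Gamma> X ns ?P e V (\<lambda>q. int (?n q))"
    proof (rule realizesI)
      fix q assume q: "q \<in> pts \<Gamma>"
      note hT = realizes_bound[OF P(3) q]
      note nT = n_le[OF hT]
      have "?n q \<le> V q" using nT unfolding V_def by simp
      then show "\<bar>int (?n q)\<bar> \<le> 2 ^ V q"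
        using int_le_power[of "?n q"] power_increasing[of "?n q" "V q" "2::int"] by linarith
      fix s assume s: "matches \<Gamma> ns q s"
      obtain t0 s0 where e0: "exec c P s t0 s0" "t0 \<le> T q" "s0 r 0 = h q" "\<And>x. x \<in> X \<Longrightarrow> s0 x = s x"
        using realizes_exec[OF P(3) q s] by blast
      define I where "I k s' \<longleftrightarrow> s' e 0 = int k \<and> s' y 0 = 2 ^ k \<and> s' r 0 = h q \<and>
        (\<forall>x\<in>X. s' x = s x)" for k and s' :: state
      define s1 where "s1 = s0(y := (s0 y)(0 := 1))"
      define s2 where "s2 = s1(e := (s1 e)(0 := 0))"
      have bn: "bits (int k) \<le> k + 2" for k using bits_le[OF int_le_power] .
      have b1: "bits 1 \<le> 3" using bn[of 1] by simp
      have bp: "bits (2 ^ k) \<le> k + 2" for k using bits_le[of "2 ^ k" k] by simp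
      have bh: "bits (h q) \<le> T q + 2" using bits_le[OF hT] .
      have e1: "exec c (Write y (Const 0) (Const 1)) s0 (2 + bits 1) s1"
        using write_exec[of c y "Const 1" s0] by (simp add: s1_def)
      have e2: "exec c (Write e (Const 0) (Const 0)) s1 3 s2"
        using write_exec[of c e "Const 0" s1] by (simp add: s2_def)
      have I0: "I 0 s2" unfolding I_def s2_def s1_def using e0(3,4) P(1) y e by auto
      have "\<exists>t s'. exec c (While ?b ?body) s2 t s' \<and> I (?n q) s' \<and> t \<le> (?n q - 0 + 1) * U q"
      proof (rule while_exec[where I = I])
        fix k s' assume k: "k < ?n q" and I: "I k s'"
        define s5 where "s5 = s'(y := (s' y)(0 := 2 ^ Suc k))"
        define s6 where "s6 = s5(e := (s5 e)(0 := int (Suc k)))"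
        have e5: "exec c (Write y (Const 0) (Plus (Read y (Const 0)) (Read y (Const 0)))) s'
            (4 + bits (2 ^ k) + bits (2 ^ k) + bits (2 ^ Suc k)) s5"
          using write_exec[of c y "Plus (Read y (Const 0)) (Read y (Const 0))" s'] I
          by (simp add: s5_def I_def eval_nat_numeral)
        have "s5 e 0 = int k" using I e by (simp add: s5_def I_def)
        then have e6: "exec c (Write e (Const 0) (Plus (Read e (Const 0)) (Const 1))) s5
            (3 + bits (int k) + bits 1 + bits (int (Suc k))) s6"
          using write_exec[of c e "Plus (Read e (Const 0)) (Const 1)" s5]
          by (simp add: s6_def eval_nat_numeral add_ac)
        note ex = exec.Seq[OF e5 e6]
        have I': "I (Suc k) s6" unfolding I_def s6_def s5_def using I y e by (auto simp: I_def)
        have b: "bval c ?b s'" using I lt[OF k] by (simp add: I_def)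
        have bc: "bcost c ?b s' = 4 + bits (h q) + bits (2 ^ k)" using I by (simp add: I_def)
        have "1 + bcost c ?b s' + (4 + bits (2 ^ k) + bits (2 ^ k) + bits (2 ^ Suc k) +
           (3 + bits (int k) + bits 1 + bits (int (Suc k)))) \<le> U q"
          unfolding bc U_def
          using bn[of k] bn[of "Suc k"] bp[of k] bp[of "Suc k"] b1 k nT bh by linarith
        with b ex I' show "bval c ?b s' \<and> (\<exists>t s''. exec c ?body s' t s'' \<and> I (Suc k) s'' \<and>
            1 + bcost c ?b s' + t \<le> U q)" by blast
      next
        fix s' assume I: "I (?n q) s'"
        have "bcost c ?b s' = 4 + bits (h q) + bits (2 ^ ?n q)" using I by (simp add: I_def)
        then have "1 + bcost c ?b s' \<le> U q" using bp[of "?n q"] nT bh by (simp add: U_def)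
        moreover have "\<not> bval c ?b s'" using I gt[of q] by (simp add: I_def)
        ultimately show "\<not> bval c ?b s' \<and> 1 + bcost c ?b s' \<le> U q" by blast
      qed (use I0 in auto)
      then obtain t s' where w: "exec c (While ?b ?body) s2 t s'" "I (?n q) s'" "t \<le> (?n q + 1) * U q" by auto
      have "(?n q + 1) * U q \<le> (T q + 2) * U q" using nT by (intro mult_right_mono) auto
      moreover have "exec c ?P s (t0 + ((2 + bits 1) + (3 + t))) s'" by (rule exec.Seq[OF e0(1) exec.Seq[OF e1 exec.Seq[OF e2 w(1)]]])
      moreover have "t0 + ((2 + bits 1) + (3 + t)) \<le> V q"
        unfolding V_def using e0(2) w(3) calculation(1) b1 by linarith
      ultimately show "\<exists>t s'. exec c ?P s t s' \<and> t \<le> V q \<and> s' e 0 = int (?n q) \<and> (\<forall>x\<in>X. s' x = s x)"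
        using w(2) unfolding I_def by blast
    qed
    with V e show "\<exists>P r T. r \<notin> X \<and> pb \<Gamma> T \<and> realizes c \<Gamma> X ns P r T (\<lambda>q. int (?n q))" by blast
  qed
  ultimately show ?thesis unfolding computable_nat_def by blast
qed

section \<open>Bounded sums, products, powers and extrema\<close>

lemma computable_acc:
  assumes "pb \<Gamma> T" "\<And>q k. q \<in> pts \<Gamma> \<Longrightarrow> k < n q \<Longrightarrow> \<bar>A q k\<bar> \<le> 2 ^ T q"
  shows "computable c (iter \<Gamma> n A) snd"
proof -
  have "computable c (iter \<Gamma> n A) (\<lambda>z. snd z)"
    unfolding iter_def
    by (rule computable_last[where T = "\<lambda>z. T (fst (fst z))"])
      (use assms(2) in \<open>auto simp: loop_def intro!: pb_ext[where n = "\<lambda>z. T (fst z)"] pb_ext assms(1)\<close>)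
  then show ?thesis by simp
qed

text \<open>Points of the loop have the size of the outer point, so one bound serves for all values
  of the counter.\<close>

lemma loop_bound:
  assumes "computable c (loop \<Gamma> n) (\<lambda>z. h (fst z) (snd z))"
  obtains B where "pb \<Gamma> B" "\<And>q k. q \<in> pts \<Gamma> \<Longrightarrow> k < n q \<Longrightarrow> \<bar>h q k\<bar> \<le> 2 ^ B q"
proof -
  obtain T where T: "pb (loop \<Gamma> n) T" "\<And>z. z \<in> pts (loop \<Gamma> n) \<Longrightarrow> \<bar>h (fst z) (snd z)\<bar> \<le> 2 ^ T z"
    using computable_bound[OF assms] by blast
  from T(1) obtain j where j: "\<forall>z\<in>pts (loop \<Gamma> n). T z \<le> sz (loop \<Gamma> n) z ^ j" unfolding pb_def by blast
  have "pb \<Gamma> (\<lambda>q. sz \<Gamma> q ^ j)" unfolding pb_def by auto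
  moreover have "\<bar>h q k\<bar> \<le> 2 ^ (sz \<Gamma> q ^ j)" if "q \<in> pts \<Gamma>" "k < n q" for q k
    using T(2)[of "(q, k)"] j[rule_format, of "(q, k)"] that
    by (auto simp: loop_def intro: abs_le_power_mono)
  ultimately show ?thesis using that by blast
qed

lemma computable_loop_iter:
  assumes "computable c (loop \<Gamma> n) h"
  shows "computable c (iter \<Gamma> n A) (\<lambda>z. h (fst z))"
  unfolding iter_def by (rule computable_ext[OF assms])

lemma computable_sum:
  assumes n: "computable_nat c \<Gamma> n" and h: "computable c (loop \<Gamma> n) (\<lambda>z. h (fst z) (snd z))"
  shows "computable c \<Gamma> (\<lambda>q. \<Sum>k<n q. h q k)"
proof -
  obtain B where B: "pb \<Gamma> B" "\<And>q k. q \<in> pts \<Gamma> \<Longrightarrow> k < n q \<Longrightarrow> \<bar>h q k\<bar> \<le> 2 ^ B q"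
    using loop_bound[OF h] by blast
  let ?A = "\<lambda>q k. \<Sum>i<k. h q i"
  show ?thesis
  proof (rule computable_iter[where A = ?A and h = "\<lambda>z. snd z + h (fst (fst z)) (snd (fst z))"])
    show "computable c (iter \<Gamma> n ?A) (\<lambda>z. snd z + h (fst (fst z)) (snd (fst z)))"
    proof (intro computable_add computable_loop_iter h computable_acc)
      show "pb \<Gamma> (\<lambda>q. n q + B q)" by (intro pb_intros B computable_nat_pb[OF n])
      fix q k assume q: "q \<in> pts \<Gamma>" "k < n q"
      have "\<bar>?A q k\<bar> \<le> (\<Sum>i<k. \<bar>h q i\<bar>)" by (rule sum_abs)
      also have "\<dots> \<le> (\<Sum>i<k. 2 ^ B q)" by (rule sum_mono) (use B(2) q in auto)
      also have "\<dots> = int k * 2 ^ B q" by simp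
      also have "\<dots> \<le> 2 ^ n q * 2 ^ B q"
        using int_le_power[of k] abs_le_power_mono[of "int k" k "n q"] q
        by (intro mult_right_mono) auto
      finally show "\<bar>?A q k\<bar> \<le> 2 ^ (n q + B q)" by (simp add: power_add)
    qed
  qed (use n computable_const in auto)
qed

lemma computable_prod:
  assumes n: "computable_nat c \<Gamma> n" and h: "computable c (loop \<Gamma> n) (\<lambda>z. h (fst z) (snd z))"
  shows "computable c \<Gamma> (\<lambda>q. \<Prod>k<n q. h q k)"
proof -
  obtain B where B: "pb \<Gamma> B" "\<And>q k. q \<in> pts \<Gamma> \<Longrightarrow> k < n q \<Longrightarrow> \<bar>h q k\<bar> \<le> 2 ^ B q"
    using loop_bound[OF h] by blast
  let ?A = "\<lambda>q k. \<Prod>i<k. h q i"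
  show ?thesis
  proof (rule computable_iter[where A = ?A and h = "\<lambda>z. snd z * h (fst (fst z)) (snd (fst z))"])
    show "computable c (iter \<Gamma> n ?A) (\<lambda>z. snd z * h (fst (fst z)) (snd (fst z)))"
    proof (intro computable_mult computable_loop_iter h computable_acc)
      show "pb \<Gamma> (\<lambda>q. B q * n q)" by (intro pb_intros B computable_nat_pb[OF n])
      fix q k assume q: "q \<in> pts \<Gamma>" "k < n q"
      have "\<bar>?A q k\<bar> = (\<Prod>i<k. \<bar>h q i\<bar>)" by (induction k) (simp_all add: abs_mult lessThan_Suc)
      also have "\<dots> \<le> (\<Prod>i<k. 2 ^ B q)" by (rule prod_mono) (use B(2) q in auto)
      also have "\<dots> = 2 ^ (B q * k)" by (simp add: power_mult)
      also have "\<dots> \<le> 2 ^ (B q * n q)" using q by (intro power_increasing) auto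
      finally show "\<bar>?A q k\<bar> \<le> 2 ^ (B q * n q)" .
    qed
  qed (use n computable_const in \<open>auto simp: mult.commute\<close>)
qed

lemma computable_power:
  assumes "computable_nat c \<Gamma> n" "computable c \<Gamma> h"
  shows "computable c \<Gamma> (\<lambda>q. h q ^ n q)"
proof -
  have "computable c \<Gamma> (\<lambda>q. \<Prod>k<n q. h q)"
    by (rule computable_prod[OF assms(1)]) (use computable_ext[OF assms(2)] in \<open>simp add: loop_def\<close>)
  then show ?thesis by simp
qed

text \<open>The extra element \<open>b\<close> starts the loop and settles the empty range; in the
  tables it is the infinite cost.\<close>

lemma computable_Min:
  assumes n: "computable_nat c \<Gamma> n" and h: "computable c (loop \<Gamma> n) (\<lambda>z. h (fst z) (snd z))"
    and b: "computable c \<Gamma> b"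
  shows "computable c \<Gamma> (\<lambda>q. Min (insert (b q) (h q ` {..<n q})))"
proof -
  obtain B where B: "pb \<Gamma> B" "\<And>q k. q \<in> pts \<Gamma> \<Longrightarrow> k < n q \<Longrightarrow> \<bar>h q k\<bar> \<le> 2 ^ B q"
    using loop_bound[OF h] by blast
  obtain T where T: "pb \<Gamma> T" "\<And>q. q \<in> pts \<Gamma> \<Longrightarrow> \<bar>b q\<bar> \<le> 2 ^ T q" using computable_bound[OF b] by blast
  let ?A = "\<lambda>q k. Min (insert (b q) (h q ` {..<k}))"
  let ?h = "\<lambda>z. if h (fst (fst z)) (snd (fst z)) \<le> snd z then h (fst (fst z)) (snd (fst z)) else snd z"
  show ?thesis
  proof (rule computable_iter[where A = ?A and h = ?h])
    have acc: "computable c (iter \<Gamma> n ?A) snd"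
    proof (rule computable_acc)
      show "pb \<Gamma> (\<lambda>q. T q + B q)" by (intro pb_intros B T)
      fix q k assume q: "q \<in> pts \<Gamma>" "k < n q"
      have "?A q k \<in> insert (b q) (h q ` {..<k})" by (rule Min_in) auto
      then show "\<bar>?A q k\<bar> \<le> 2 ^ (T q + B q)"
        using abs_le_power_mono[OF T(2)[OF q(1)], of "T q + B q"]
          abs_le_power_mono[OF B(2)[OF q(1)], of _ "T q + B q"] q(2) by auto
    qed
    show "computable c (iter \<Gamma> n ?A) ?h"
      by (intro computable_if computable_le computable_loop_iter h acc)
  next
    fix q k
    have "insert (b q) (h q ` {..<Suc k}) = insert (h q k) (insert (b q) (h q ` {..<k}))"
      by (auto simp: lessThan_Suc)
    then have "?A q (Suc k) = Min (insert (h q k) (insert (b q) (h q ` {..<k})))" by simp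
    also have "\<dots> = min (h q k) (?A q k)" by (rule Min_insert) auto
    finally show "?A q (Suc k) = ?h ((q, k), ?A q k)" by (simp add: min_def)
  qed (use n b in auto)
qed

lemma computable_minus: "computable c \<Gamma> h \<Longrightarrow> computable c \<Gamma> (\<lambda>q. - h q)"
  using computable_diff[OF computable_const[of c \<Gamma> 0]] by simp

lemma computable_Max:
  assumes n: "computable_nat c \<Gamma> n" and h: "computable c (loop \<Gamma> n) (\<lambda>z. h (fst z) (snd z))"
    and b: "computable c \<Gamma> b"
  shows "computable c \<Gamma> (\<lambda>q. Max (insert (b q) (h q ` {..<n q})))"
proof -
  have "computable c \<Gamma> (\<lambda>q. - Min (insert (- b q) ((\<lambda>k. - h q k) ` {..<n q})))"
    by (intro computable_minus computable_Min n h b)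
  then show ?thesis
  proof (rule computable_cong)
    fix q
    have "- Min (uminus ` insert (b q) (h q ` {..<n q})) = Max (uminus ` uminus ` insert (b q) (h q ` {..<n q}))"
      by (rule minus_Min_eq_Max) auto
    then show "- Min (insert (- b q) ((\<lambda>k. - h q k) ` {..<n q})) = Max (insert (b q) (h q ` {..<n q}))"
      by (simp add: image_image)
  qed
qed

lemma computable_nat_const: "computable_nat c \<Gamma> (\<lambda>_. n)"
  unfolding computable_nat_def by (intro conjI computable_const pb_const)

lemma computable_nat_add:
  "computable_nat c \<Gamma> m \<Longrightarrow> computable_nat c \<Gamma> n \<Longrightarrow> computable_nat c \<Gamma> (\<lambda>q. m q + n q)"
  unfolding computable_nat_def by (auto intro: computable_add pb_add)

lemma computable_nat_mult:
  "computable_nat c \<Gamma> m \<Longrightarrow> computable_nat c \<Gamma> n \<Longrightarrow> computable_nat c \<Gamma> (\<lambda>q. m q * n q)"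
  unfolding computable_nat_def by (auto intro: computable_mult pb_mult)

lemma computable_nat_Suc: "computable_nat c \<Gamma> n \<Longrightarrow> computable_nat c \<Gamma> (\<lambda>q. Suc (n q))"
  using computable_nat_add[OF computable_nat_const[of c \<Gamma> 1]] by simp

lemma computable_nat_diff:
  assumes "computable_nat c \<Gamma> m" "computable_nat c \<Gamma> n"
  shows "computable_nat c \<Gamma> (\<lambda>q. m q - n q)"
  unfolding computable_nat_def
proof
  have "computable c \<Gamma> (\<lambda>q. if int (n q) \<le> int (m q) then int (m q) - int (n q) else 0)"
    by (intro computable_if computable_le computable_diff computable_const computable_int assms)
  then show "computable c \<Gamma> (\<lambda>q. int (m q - n q))" by (rule computable_cong) auto
  show "pb \<Gamma> (\<lambda>q. m q - n q)" by (rule pb_mono[OF computable_nat_pb[OF assms(1)]]) simp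
qed

subsection \<open>Rational families\<close>

text \<open>Fractions need not be reduced, so no gcd is computed. The positive denominator makes the
  sign of a fraction that of its numerator, which decides comparisons.\<close>

definition computable_rat :: "(nat \<Rightarrow> real) \<Rightarrow> 'q ctx \<Rightarrow> ('q \<Rightarrow> real) \<Rightarrow> bool" where
  "computable_rat c \<Gamma> h \<longleftrightarrow> (\<exists>a d. computable c \<Gamma> a \<and> computable c \<Gamma> d \<and>
     (\<forall>q\<in>pts \<Gamma>. 0 < d q \<and> h q = of_int (a q) / of_int (d q)))"

lemma computable_ratI:
  assumes "computable c \<Gamma> a" "computable c \<Gamma> d"
    and "\<And>q. q \<in> pts \<Gamma> \<Longrightarrow> 0 < d q" "\<And>q. q \<in> pts \<Gamma> \<Longrightarrow> h q = of_int (a q) / of_int (d q)"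
  shows "computable_rat c \<Gamma> h"
  using assms unfolding computable_rat_def by blast

lemma computable_ratE:
  assumes "computable_rat c \<Gamma> h"
  obtains a d where "computable c \<Gamma> a" "computable c \<Gamma> d"
    "\<And>q. q \<in> pts \<Gamma> \<Longrightarrow> 0 < d q" "\<And>q. q \<in> pts \<Gamma> \<Longrightarrow> h q = of_int (a q) / of_int (d q)"
  using assms unfolding computable_rat_def by blast

lemma computable_rat_cong:
  assumes "computable_rat c \<Gamma> h" "\<And>q. q \<in> pts \<Gamma> \<Longrightarrow> h q = h' q"
  shows "computable_rat c \<Gamma> h'"
  using assms unfolding computable_rat_def by (metis (no_types, lifting))

lemma computable_rat_int: "computable c \<Gamma> h \<Longrightarrow> computable_rat c \<Gamma> (\<lambda>q. of_int (h q))"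
  by (rule computable_ratI[OF _ computable_const[of c \<Gamma> 1]]) auto

lemma computable_rat_nat: "computable_nat c \<Gamma> h \<Longrightarrow> computable_rat c \<Gamma> (\<lambda>q. real (h q))"
  using computable_rat_int[OF computable_int] by auto

lemma computable_rat_const: "computable_rat c \<Gamma> (\<lambda>_. of_int z)"
  by (rule computable_rat_int[OF computable_const])

lemma computable_rat_numeral: "computable_rat c \<Gamma> (\<lambda>_. numeral n)"
  using computable_rat_const[of c \<Gamma> "numeral n"] by simp

lemma computable_rat_0: "computable_rat c \<Gamma> (\<lambda>_. 0)"
  using computable_rat_const[of c \<Gamma> "0"] by simp

lemma computable_rat_1: "computable_rat c \<Gamma> (\<lambda>_. 1)"
  using computable_rat_const[of c \<Gamma> "1"] by simp

lemma computable_rat_ext: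
  assumes "computable_rat c \<Gamma> h"
  shows "computable_rat c (ext \<Gamma> v S) (\<lambda>z. h (fst z))"
  using assms
proof (rule computable_ratE)
  fix a d
  assume "computable c \<Gamma> a" "computable c \<Gamma> d"
    "\<And>q. q \<in> pts \<Gamma> \<Longrightarrow> 0 < d q" "\<And>q. q \<in> pts \<Gamma> \<Longrightarrow> h q = of_int (a q) / of_int (d q)"
  then show ?thesis by (intro computable_ratI[OF computable_ext computable_ext]) auto
qed

lemma computable_rat_add:
  assumes "computable_rat c \<Gamma> x" "computable_rat c \<Gamma> y"
  shows "computable_rat c \<Gamma> (\<lambda>q. x q + y q)"
proof -
  from assms obtain a d a' d' where c: "computable c \<Gamma> a" "computable c \<Gamma> d" "computable c \<Gamma> a'" "computable c \<Gamma> d'"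
    and d: "\<And>q. q \<in> pts \<Gamma> \<Longrightarrow> 0 < d q" "\<And>q. q \<in> pts \<Gamma> \<Longrightarrow> x q = of_int (a q) / of_int (d q)"
      "\<And>q. q \<in> pts \<Gamma> \<Longrightarrow> 0 < d' q" "\<And>q. q \<in> pts \<Gamma> \<Longrightarrow> y q = of_int (a' q) / of_int (d' q)"
    by (elim computable_ratE) blast
  show ?thesis
    by (rule computable_ratI[where a = "\<lambda>q. a q * d' q + a' q * d q" and d = "\<lambda>q. d q * d' q"])
      (use d in \<open>force intro: c computable_add computable_mult simp: add_frac_eq\<close>)+
qed

lemma computable_rat_mult:
  assumes "computable_rat c \<Gamma> x" "computable_rat c \<Gamma> y"
  shows "computable_rat c \<Gamma> (\<lambda>q. x q * y q)"
proof -
  from assms obtain a d a' d' where c: "computable c \<Gamma> a" "computable c \<Gamma> d" "computable c \<Gamma> a'" "computable c \<Gamma> d'"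
    and d: "\<And>q. q \<in> pts \<Gamma> \<Longrightarrow> 0 < d q" "\<And>q. q \<in> pts \<Gamma> \<Longrightarrow> x q = of_int (a q) / of_int (d q)"
      "\<And>q. q \<in> pts \<Gamma> \<Longrightarrow> 0 < d' q" "\<And>q. q \<in> pts \<Gamma> \<Longrightarrow> y q = of_int (a' q) / of_int (d' q)"
    by (elim computable_ratE) blast
  show ?thesis
    by (rule computable_ratI[where a = "\<lambda>q. a q * a' q" and d = "\<lambda>q. d q * d' q"])
      (use d in \<open>force intro: c computable_mult\<close>)+
qed

lemma computable_rat_minus:
  assumes "computable_rat c \<Gamma> x"
  shows "computable_rat c \<Gamma> (\<lambda>q. - x q)"
  using computable_rat_mult[OF computable_rat_const[of c \<Gamma> "- 1"] assms] by simp

lemma computable_rat_diff: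
  assumes "computable_rat c \<Gamma> x" "computable_rat c \<Gamma> y"
  shows "computable_rat c \<Gamma> (\<lambda>q. x q - y q)"
  using computable_rat_add[OF assms(1) computable_rat_minus[OF assms(2)]] by simp

lemma computable_rat_divide:
  assumes "computable_rat c \<Gamma> x" "computable_rat c \<Gamma> y" "\<And>q. q \<in> pts \<Gamma> \<Longrightarrow> 0 < y q"
  shows "computable_rat c \<Gamma> (\<lambda>q. x q / y q)"
proof -
  from assms(2) obtain a d where c: "computable c \<Gamma> a" "computable c \<Gamma> d"
    and d: "\<And>q. q \<in> pts \<Gamma> \<Longrightarrow> 0 < d q" "\<And>q. q \<in> pts \<Gamma> \<Longrightarrow> y q = of_int (a q) / of_int (d q)"
    by (elim computable_ratE) blast
  have "computable_rat c \<Gamma> (\<lambda>q. 1 / y q)"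
    by (rule computable_ratI[OF c(2,1)]) (use d assms(3) in \<open>force simp: zero_less_divide_iff\<close>)+
  from computable_rat_mult[OF assms(1) this] show ?thesis by simp
qed

lemma computable_rat_power:
  assumes "computable_nat c \<Gamma> n" "computable_rat c \<Gamma> x"
  shows "computable_rat c \<Gamma> (\<lambda>q. x q ^ n q)"
proof -
  from assms(2) obtain a d where c: "computable c \<Gamma> a" "computable c \<Gamma> d"
    and d: "\<And>q. q \<in> pts \<Gamma> \<Longrightarrow> 0 < d q" "\<And>q. q \<in> pts \<Gamma> \<Longrightarrow> x q = of_int (a q) / of_int (d q)"
    by (elim computable_ratE) blast
  show ?thesis
    by (rule computable_ratI[OF computable_power[OF assms(1) c(1)] computable_power[OF assms(1) c(2)]])
      (use d in \<open>auto simp: power_divide\<close>)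
qed

text \<open>A fraction does not fit into the integer accumulator of a loop. Hence the product of all
  denominators serves as common denominator, and only integers are summed.\<close>

lemma computable_rat_sum:
  assumes n: "computable_nat c \<Gamma> n" and h: "computable_rat c (loop \<Gamma> n) (\<lambda>z. h (fst z) (snd z))"
  shows "computable_rat c \<Gamma> (\<lambda>q. \<Sum>k<n q. h q k)"
proof -
  from h obtain a d where c: "computable c (loop \<Gamma> n) a" "computable c (loop \<Gamma> n) d"
    and d: "\<And>z. z \<in> pts (loop \<Gamma> n) \<Longrightarrow> 0 < d z"
      "\<And>z. z \<in> pts (loop \<Gamma> n) \<Longrightarrow> h (fst z) (snd z) = of_int (a z) / of_int (d z)"
    using computable_ratE by blast
  define D where "D q = (\<Prod>k<n q. d (q, k))" for q
  have D: "computable c \<Gamma> D" unfolding D_def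
    by (rule computable_prod[OF n]) (use c(2) in simp)
  have "computable c (loop \<Gamma> n) (\<lambda>z. D (fst z))"
    unfolding loop_def by (rule computable_ext[OF D])
  then have A: "computable c \<Gamma> (\<lambda>q. \<Sum>k<n q. a (q, k) * (D q div d (q, k)))"
    by (intro computable_sum n computable_mult computable_div) (use c in simp_all)
  have pos: "0 < D q" if "q \<in> pts \<Gamma>" for q
    unfolding D_def by (rule prod_pos) (use d(1) that in \<open>auto simp: loop_def\<close>)
  show ?thesis
  proof (rule computable_ratI[OF A D])
    fix q assume q: "q \<in> pts \<Gamma>"
    show "0 < D q" using pos[OF q] .
    have "h q k = of_int (a (q, k) * (D q div d (q, k))) / of_int (D q)" if k: "k < n q" for k
    proof -
      have "d (q, k) dvd D q" unfolding D_def by (rule dvd_prodI) (use k in auto)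
      then have e: "D q = d (q, k) * (D q div d (q, k))" by simp
      have z: "0 < d (q, k)" using d(1)[of "(q, k)"] q k by (simp add: loop_def)
      have "h q k = of_int (a (q, k)) / of_int (d (q, k))"
        using d(2)[of "(q, k)"] q k by (simp add: loop_def)
      also have "\<dots> = of_int (a (q, k) * (D q div d (q, k))) / of_int (d (q, k) * (D q div d (q, k)))"
      proof -
        have "D q div d (q, k) \<noteq> 0" using pos[OF q] e by auto
        then show ?thesis using z by simp
      qed
      finally show ?thesis using e by simp
    qed
    then show "(\<Sum>k<n q. h q k) = of_int (\<Sum>k<n q. a (q, k) * (D q div d (q, k))) / of_int (D q)"
      by (simp add: sum_divide_distrib)
  qed
qed

lemma computable_rat_le:
  assumes "computable_rat c \<Gamma> x" "computable_rat c \<Gamma> y"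
  shows "computable_pred c \<Gamma> (\<lambda>q. x q \<le> y q)"
proof -
  from computable_rat_diff[OF assms(2,1)] obtain a d where c: "computable c \<Gamma> a"
    and d: "\<And>q. q \<in> pts \<Gamma> \<Longrightarrow> 0 < d q" "\<And>q. q \<in> pts \<Gamma> \<Longrightarrow> y q - x q = of_int (a q) / of_int (d q)"
    by (rule computable_ratE) blast
  have "computable_pred c \<Gamma> (\<lambda>q. 0 \<le> a q)" by (intro computable_le computable_const c)
  then show ?thesis unfolding computable_pred_def
  proof (rule computable_cong)
    fix q assume q: "q \<in> pts \<Gamma>"
    have "0 \<le> a q \<longleftrightarrow> 0 \<le> y q - x q" unfolding d(2)[OF q] using d(1)[OF q] by (simp add: zero_le_divide_iff)
    then show "of_bool (0 \<le> a q) = (of_bool (x q \<le> y q) :: int)" by simp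
  qed
qed

lemma computable_rat_less:
  assumes "computable_rat c \<Gamma> x" "computable_rat c \<Gamma> y"
  shows "computable_pred c \<Gamma> (\<lambda>q. x q < y q)"
  unfolding not_le[symmetric] by (intro computable_not computable_rat_le assms)

lemma computable_floor:
  assumes "computable_rat c \<Gamma> x"
  shows "computable c \<Gamma> (\<lambda>q. \<lfloor>x q\<rfloor>)"
proof -
  from assms obtain a d where c: "computable c \<Gamma> a" "computable c \<Gamma> d"
    and d: "\<And>q. q \<in> pts \<Gamma> \<Longrightarrow> x q = of_int (a q) / of_int (d q)"
    by (elim computable_ratE) blast
  have "computable c \<Gamma> (\<lambda>q. a q div d q)" by (intro computable_div c)
  then show ?thesis by (rule computable_cong) (simp add: d floor_divide_of_int_eq)
qed

lemma computable_rat_if: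
  assumes "computable_pred c \<Gamma> P" "computable_rat c \<Gamma> x" "computable_rat c \<Gamma> y"
  shows "computable_rat c \<Gamma> (\<lambda>q. if P q then x q else y q)"
proof -
  have "computable_rat c \<Gamma> (\<lambda>q. of_int (of_bool (P q)) * x q + (1 - of_int (of_bool (P q))) * y q)"
    by (intro computable_rat_add computable_rat_mult computable_rat_diff computable_rat_1
        computable_rat_int computable_of_bool assms)
  then show ?thesis by (rule computable_rat_cong) simp
qed

section \<open>Rounding to a geometric grid\<close>

lemma ln_ge_frac:
  fixes y :: real
  assumes "0 \<le> y"
  shows "y / (1 + y) \<le> ln (1 + y)"
proof -
  have "ln (1 / (1 + y)) \<le> 1 / (1 + y) - 1" using assms by (intro ln_le_minus_one) auto
  also have "1 / (1 + y) - 1 = - (y / (1 + y))" using assms by (simp add: field_simps)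
  finally show ?thesis using assms by (simp add: ln_div)
qed

text \<open>Concavity of the logarithm in the form used for \<open>u\<close>. The difference of the
  two sides vanishes at \<open>b = 1\<close>, and its derivative
  \<open>ln (1 + y) - y / (1 + b * y)\<close> is nonnegative by \<open>ln_ge_frac\<close>.\<close>

lemma ln_scale_le:
  fixes b y :: real
  assumes "0 \<le> y" "1 \<le> b"
  shows "ln (1 + b * y) \<le> b * ln (1 + y)"
proof -
  have "1 * ln (1 + y) - ln (1 + 1 * y) \<le> b * ln (1 + y) - ln (1 + b * y)"
  proof (rule DERIV_nonneg_imp_nondecreasing[OF assms(2)])
    fix x :: real assume x: "1 \<le> x" "x \<le> b"
    have pos: "0 < 1 + x * y" using assms(1) x by (smt (verit) mult_nonneg_nonneg)
    have "((\<lambda>x. x * ln (1 + y) - ln (1 + x * y)) has_real_derivative ln (1 + y) - y / (1 + x * y)) (at x)"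
      using pos by (auto intro!: derivative_eq_intros)
    moreover have "y / (1 + x * y) \<le> y / (1 + y)"
      using assms(1) x mult_right_mono[of 1 x y] by (intro divide_left_mono) (auto intro!: mult_pos_pos pos)
    ultimately show "\<exists>z. ((\<lambda>x. x * ln (1 + y) - ln (1 + x * y)) has_real_derivative z) (at x) \<and> 0 \<le> z"
      using ln_ge_frac[OF assms(1)] by (intro exI conjI) auto
  qed
  then show ?thesis by simp
qed

text \<open>The integer part of the logarithm of \<open>y\<close> to base \<open>b\<close>, capped
  at \<open>K\<close>. As a count of comparisons it is computable for rational \<open>b\<close> and
  \<open>y\<close> without any logarithm.\<close>

definition lev :: "real \<Rightarrow> nat \<Rightarrow> real \<Rightarrow> nat" where
  "lev b K y = (\<Sum>k<K. of_bool (b ^ Suc k \<le> y))"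

lemma lev_le: "lev b K y \<le> K"
proof -
  have "lev b K y \<le> (\<Sum>k<K. 1)" unfolding lev_def by (rule sum_mono) simp
  then show ?thesis by simp
qed

lemma lev_bounds:
  assumes "1 < b" "1 \<le> y" "y < b ^ Suc K"
  shows "b ^ lev b K y \<le> y" "y < b ^ Suc (lev b K y)"
proof -
  \<comment> \<open>Either all \<open>K\<close> thresholds were passed, and the upper bound is the
    assumption on \<open>y\<close>, or the count stopped at a failing threshold, and the later,
    larger ones fail too.\<close>
  have "b ^ lev b K y \<le> y \<and> (lev b K y = K \<or> lev b K y < K \<and> y < b ^ Suc (lev b K y))"
  proof (induction K)
    case 0
    show ?case using assms(2) by (simp add: lev_def)
  next
    case (Suc K)
    have S: "lev b (Suc K) y = lev b K y + of_bool (b ^ Suc K \<le> y)" by (simp add: lev_def)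
    show ?case
    proof (cases "lev b K y = K")
      case True
      then show ?thesis using Suc S by auto
    next
      case False
      then have l: "lev b K y < K" "y < b ^ Suc (lev b K y)" using Suc by auto
      have "b ^ Suc (lev b K y) \<le> b ^ Suc K" using l(1) assms(1) by (intro power_increasing) auto
      then have "lev b (Suc K) y = lev b K y" using S l(2) by simp
      then show ?thesis using l Suc by simp
    qed
  qed
  then show "b ^ lev b K y \<le> y" "y < b ^ Suc (lev b K y)" using assms(3) by auto
qed

text \<open>The 12 is 2 + 3 + 7: in units of \<open>1 / R\<close>, the losses by the approximate
  logarithms, by three factors \<open>1 + 1 / R\<close> and by the \<open>N + 6\<close> roundings to
  the grid, added up in \<open>x_sol_approx\<close>.\<close>

definition acc :: "feo \<Rightarrow> nat \<Rightarrow> nat" where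
  "acc I d = 12 * d * users I"

text \<open>With the square, \<open>R\<close> roundings to the grid together cost about
  \<open>1 / R\<close>, so that the chain of partial sums over all users is affordable.\<close>

definition fineness :: "feo \<Rightarrow> nat \<Rightarrow> nat" where
  "fineness I d = acc I d ^ 2"

definition base :: "feo \<Rightarrow> nat \<Rightarrow> real" where
  "base I d = 1 + 1 / fineness I d"

text \<open>Dominates everything that is located in the grid: \<open>1 + tau / x\<close> and
  \<open>1 + nu * x\<close> for the logarithms, \<open>upper / lower\<close> for the points and, by
  the last two summands, \<open>4 * approx_u\<close>.\<close>

definition size_bound :: "feo \<Rightarrow> nat \<Rightarrow> real" where
  "size_bound I i = 1 + tau I i / of_rat (lower I i) + nu I i * of_rat (upper I i) +
     of_rat (upper I i) / of_rat (lower I i) + 4 * nu I i * of_rat (upper I i) / of_rat (pri I) + 8 * tau I i"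

text \<open>As \<open>base ^ fineness \<ge> 2\<close>, taking \<open>fineness\<close> levels per bit
  reaches beyond every \<open>size_bound\<close>, so the number of levels is polynomial in
  \<open>d\<close> and the input size. Adding 1 to the floor makes the bound strict.\<close>

definition cap :: "feo \<Rightarrow> nat \<Rightarrow> nat" where
  "cap I d = fineness I d * nat (bitlen (1 + \<lfloor>\<Sum>i<users I. size_bound I (Suc i)\<rfloor>))"

text \<open>A relative error bound for the logarithm: below \<open>1 / acc\<close> the linear approximation is good
  enough, and above, the additive error \<open>1 / acc\<^sup>2\<close> of the grid is.\<close>

definition approx_ln :: "feo \<Rightarrow> nat \<Rightarrow> real \<Rightarrow> real" where
  "approx_ln I d y = (if y < 1 / acc I d then y else lev (base I d) (cap I d) (1 + y) / fineness I d)"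

definition point :: "feo \<Rightarrow> nat \<Rightarrow> nat \<Rightarrow> nat \<Rightarrow> real" where
  "point I d i j = of_rat (lower I i) * base I d ^ j"

text \<open>With natural logarithms in place of those to base 2, this estimates
  \<open>ln 2 * u\<close>; the factor is never divided out.\<close>

definition approx_u :: "feo \<Rightarrow> nat \<Rightarrow> nat \<Rightarrow> nat \<Rightarrow> real" where
  "approx_u I d i j = approx_ln I d (nu I i * point I d i j) / (2 * of_rat (pri I)) +
     point I d i j * approx_ln I d (tau I i / point I d i j)"

text \<open>The factor 4 lifts the values to at least 1, the lowest grid point:
  \<open>u \<ge> 1\<close>, \<open>ln 2 \<ge> 1 / 2\<close> and a relative error of at most
  \<open>1 / 6\<close> only guarantee \<open>5 / 12\<close>.\<close>

definition value_level :: "feo \<Rightarrow> nat \<Rightarrow> nat \<Rightarrow> nat \<Rightarrow> nat" where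
  "value_level I d i j = lev (base I d) (cap I d) (4 * approx_u I d i j)"

text \<open>Power levels are at most \<open>nat \<lceil>p\<rceil> * cap\<close>. Summing over the
  users gains a factor of at most \<open>2 ^ users\<close>, that is, at most
  \<open>fineness * users\<close> levels.\<close>

definition cap2 :: "real \<Rightarrow> feo \<Rightarrow> nat \<Rightarrow> nat" where
  "cap2 p I d = nat \<lceil>p\<rceil> * cap I d + fineness I d * users I"

text \<open>The error in the weight \<alpha> is multiplied by values up to \<open>2 ^ cap2\<close>.
  This consumes half of the bits; the other half brings the product below \<open>1 / R\<close>, see
  \<open>G_bounds\<close>.\<close>

definition prec :: "real \<Rightarrow> feo \<Rightarrow> nat \<Rightarrow> nat" where
  "prec p I d = 2 * cap2 p I d"

definition approx_p :: "real \<Rightarrow> feo \<Rightarrow> nat \<Rightarrow> int" where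
  "approx_p p I d = \<lfloor>p * 2 ^ prec p I d\<rfloor>"

definition power_level :: "real \<Rightarrow> feo \<Rightarrow> nat \<Rightarrow> nat \<Rightarrow> nat \<Rightarrow> nat" where
  "power_level p I d i j = nat (int (value_level I d i j) * approx_p p I d div 2 ^ prec p I d)"

text \<open>State 0 stands for the empty sum, state \<open>k + 1\<close> for the sum \<open>base ^ k\<close>.\<close>

definition state_val :: "feo \<Rightarrow> nat \<Rightarrow> nat \<Rightarrow> real" where
  "state_val I d k = (if k = 0 then 0 else base I d ^ (k - 1))"

definition merge :: "real \<Rightarrow> feo \<Rightarrow> nat \<Rightarrow> nat \<Rightarrow> nat \<Rightarrow> nat" where
  "merge p I d k r = Suc (lev (base I d) (cap2 p I d) (state_val I d k + base I d ^ r))"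

text \<open>The root of \<open>base ^ (k - 1)\<close> divides the exponent by \<open>p\<close>,
  where \<open>k - 1\<close> undoes the shift of the states.\<close>

definition root_level :: "real \<Rightarrow> feo \<Rightarrow> nat \<Rightarrow> nat \<Rightarrow> nat" where
  "root_level p I d k = nat (int (k - 1) * 2 ^ prec p I d div approx_p p I d)"

lemma floor_mult_power2:
  fixes x :: real
  shows "x - 1 / 2 ^ n < \<lfloor>x * 2 ^ n\<rfloor> / 2 ^ n" "\<lfloor>x * 2 ^ n\<rfloor> / 2 ^ n \<le> x"
proof -
  have "x * 2 ^ n - 1 < \<lfloor>x * 2 ^ n\<rfloor>" "\<lfloor>x * 2 ^ n\<rfloor> \<le> x * 2 ^ n" by linarith+
  then have "(x * 2 ^ n - 1) / 2 ^ n < \<lfloor>x * 2 ^ n\<rfloor> / 2 ^ n" "\<lfloor>x * 2 ^ n\<rfloor> / 2 ^ n \<le> x * 2 ^ n / 2 ^ n"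
    by (intro divide_strict_right_mono divide_right_mono; simp)+
  then show "x - 1 / 2 ^ n < \<lfloor>x * 2 ^ n\<rfloor> / 2 ^ n" "\<lfloor>x * 2 ^ n\<rfloor> / 2 ^ n \<le> x"
    by (simp_all add: diff_divide_distrib)
qed

section \<open>Accuracy of the rounded logarithms and values\<close>

locale scheme =
  fixes p \<alpha> :: real and I :: feo and d :: nat
  assumes p: "1 \<le> p" and \<alpha>: "0 \<le> \<alpha>" "\<alpha> \<le> 1" and I: "feo_instance I" and d: "1 \<le> d"
begin

abbreviation "N \<equiv> users I"
abbreviation "R \<equiv> acc I d"
abbreviation "M \<equiv> fineness I d"
abbreviation "\<beta> \<equiv> base I d"
abbreviation "K \<equiv> cap I d"
abbreviation "K2 \<equiv> cap2 p I d"
abbreviation "Pr \<equiv> prec p I d"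
abbreviation "lo i \<equiv> (of_rat (lower I i) :: real)"
abbreviation "up i \<equiv> (of_rat (upper I i) :: real)"
abbreviation "T \<equiv> (of_rat (pri I) :: real)"

lemma N: "1 \<le> N" using I by (simp add: feo_instance_def)

lemma R: "12 \<le> R" "N \<le> R" "12 * d * N = R"
  using N d by (auto simp: acc_def Suc_le_eq)

lemma M: "M = R ^ 2" "R \<le> M" "1 \<le> M"
proof -
  show M: "M = R ^ 2" by (simp add: fineness_def)
  show "R \<le> M" unfolding M power2_eq_square by simp
  then show "1 \<le> M" using R(1) by linarith
qed

lemma base: "1 < \<beta>" "\<beta> \<le> 2" "2 \<le> \<beta> ^ M"
proof -
  show "1 < \<beta>" "\<beta> \<le> 2" using M(3) by (auto simp: base_def field_simps)
  have "1 + real M * (1 / M) \<le> (1 + 1 / M) ^ M" by (rule Bernoulli_inequality) (auto simp: field_simps intro: order_trans[of _ 0])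
  then show "2 \<le> \<beta> ^ M" using M(3) by (simp add: base_def)
qed

lemma user:
  assumes "i \<in> {1..N}"
  shows "0 < tau I i" "0 < nu I i" "0 < lo i" "lo i \<le> up i" "1 \<le> u I i (lo i)" "0 < up i"
  using assms I by (auto simp: feo_instance_def of_rat_less_eq intro: less_le_trans)

lemma T: "0 < T" using I by (simp add: feo_instance_def)

lemma size_bound_nonneg:
  assumes "i \<in> {1..N}"
  shows "0 \<le> size_bound I i"
  unfolding size_bound_def
  by (intro add_nonneg_nonneg mult_nonneg_nonneg divide_nonneg_nonneg) (use user[OF assms] T in \<open>auto intro: less_imp_le\<close>)

lemma size_bound_less:
  assumes i: "i \<in> {1..N}"
  shows "size_bound I i < \<beta> ^ K"
proof -
  define E where "E = 1 + \<lfloor>\<Sum>i<N. size_bound I (Suc i)\<rfloor>"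
  have "size_bound I (Suc (i - 1)) \<le> (\<Sum>i<N. size_bound I (Suc i))"
    by (rule member_le_sum) (use i size_bound_nonneg in auto)
  then have "size_bound I i \<le> (\<Sum>i<N. size_bound I (Suc i))" using i by simp
  also have "\<dots> < E" unfolding E_def by linarith
  finally have E: "size_bound I i < E" .
  then have "0 < real_of_int E" using size_bound_nonneg[OF i] by linarith
  then have "E < 2 ^ nat (bitlen E)" using bitlen_bounds[of E] by simp
  then have "real_of_int E < 2 ^ nat (bitlen E)" by (metis of_int_less_numeral_power_cancel_iff)
  also have "\<dots> \<le> (\<beta> ^ M) ^ nat (bitlen E)" using base by (intro power_mono) auto
  also have "\<dots> = \<beta> ^ K" by (simp add: cap_def E_def power_mult)
  finally show ?thesis using E by linarith
qed

text \<open>A level is divided by \<open>M\<close> instead of being multiplied by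
  \<open>ln \<beta>\<close>, which lies between \<open>1 / (M + 1)\<close> and \<open>1 / M\<close>.
  Upwards the error is therefore relative. Downwards it is an additive \<open>1 / M\<close>,
  absorbed because \<open>ln (1 + y) \<ge> 1 / (R + 1)\<close> once \<open>y \<ge> 1 / R\<close>;
  this accounts for the \<open>2 / R\<close>.\<close>

lemma approx_ln_bounds:
  assumes "0 < y" "1 + y < \<beta> ^ Suc K"
  shows "(1 - 2 / R) * ln (1 + y) \<le> approx_ln I d y" "approx_ln I d y \<le> (1 + 1 / R) * ln (1 + y)"
proof -
  have R0: "0 < real R" using R by simp
  have ln: "0 < ln (1 + y)" using assms(1) by simp
  show "(1 - 2 / R) * ln (1 + y) \<le> approx_ln I d y" "approx_ln I d y \<le> (1 + 1 / R) * ln (1 + y)"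
  proof (atomize(full), cases "y < 1 / R")
    case True
    have "(1 - 2 / R) * ln (1 + y) \<le> 1 * ln (1 + y)" using ln R0 by (intro mult_right_mono) auto
    also have "\<dots> \<le> y" using ln_add_one_self_le_self[of y] assms(1) by simp
    finally have "(1 - 2 / R) * ln (1 + y) \<le> y" .
    moreover have "y \<le> (1 + y) * ln (1 + y)" using ln_ge_frac[of y] assms(1) by (simp add: field_simps)
    moreover have "(1 + y) * ln (1 + y) \<le> (1 + 1 / R) * ln (1 + y)" using ln True by (intro mult_right_mono) auto
    ultimately show "(1 - 2 / R) * ln (1 + y) \<le> approx_ln I d y \<and> approx_ln I d y \<le> (1 + 1 / R) * ln (1 + y)"
      using True by (simp add: approx_ln_def)
  next
    case False
    define l where "l = lev \<beta> K (1 + y)"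
    have l: "\<beta> ^ l \<le> 1 + y" "1 + y < \<beta> ^ Suc l"
      using lev_bounds[of \<beta> "1 + y" K] base assms unfolding l_def by auto
    have M0: "0 < real M" using M(3) by linarith
    have "1 / M / (1 + 1 / M) \<le> ln \<beta>" unfolding base_def by (rule ln_ge_frac) simp
    then have b1: "1 / (M + 1) \<le> ln \<beta>" using M0 by (simp add: field_simps)
    have b2: "ln \<beta> \<le> 1 / M" unfolding base_def by (rule ln_add_one_self_le_self) simp
    have "ln (\<beta> ^ l) \<le> ln (1 + y)" using l(1) base assms by (subst ln_le_cancel_iff) auto
    then have "l * ln \<beta> \<le> ln (1 + y)" using base by (simp add: ln_realpow)
    then have "l * (1 / (M + 1)) \<le> ln (1 + y)" using mult_left_mono[OF b1, of "real l"] by linarith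
    then have "l / M \<le> (1 + 1 / M) * ln (1 + y)" using M0 by (simp add: field_simps)
    also have "\<dots> \<le> (1 + 1 / R) * ln (1 + y)"
      using ln M(2) R0 by (intro mult_right_mono add_left_mono divide_left_mono) auto
    finally have upper: "l / M \<le> (1 + 1 / R) * ln (1 + y)" .
    have "ln (1 + y) \<le> ln (\<beta> ^ Suc l)" using l(2) base assms by (subst ln_le_cancel_iff) auto
    then have "ln (1 + y) \<le> Suc l * ln \<beta>" using base by (simp only: ln_realpow)
    also have "\<dots> \<le> Suc l * (1 / M)" by (intro mult_left_mono b2) simp
    finally have lower: "ln (1 + y) - 1 / M \<le> l / M" by (simp add: add_divide_distrib)
    have "1 / R \<le> y" using False by simp
    then have "ln (1 + 1 / R) \<le> ln (1 + y)" using R0 assms(1) by (subst ln_le_cancel_iff) (auto intro: add_pos_pos)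
    moreover have "1 / R / (1 + 1 / R) \<le> ln (1 + 1 / R)" by (rule ln_ge_frac) simp
    moreover have "1 / R / (1 + 1 / R) = 1 / (R + 1)" using R0 by (simp add: field_simps)
    ultimately have "1 / (R + 1) \<le> ln (1 + y)" by linarith
    then have "2 / R * (1 / (R + 1)) \<le> 2 / R * ln (1 + y)" by (intro mult_left_mono) auto
    moreover have "1 / M \<le> 2 / R * (1 / (R + 1))"
    proof -
      have "1 \<le> real R" using R by simp
      then have "real R * (real R + 1) \<le> 2 * (real R * real R)" by (simp add: algebra_simps)
      then have "2 / (2 * (real R * real R)) \<le> 2 / (real R * (real R + 1))"
        using R0 by (intro divide_left_mono) auto
      then show ?thesis by (simp add: M(1) power2_eq_square add.commute)
    qed
    ultimately have "(1 - 2 / R) * ln (1 + y) \<le> l / M" using lower by (simp add: algebra_simps)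
    with upper False show "(1 - 2 / R) * ln (1 + y) \<le> approx_ln I d y \<and> approx_ln I d y \<le> (1 + 1 / R) * ln (1 + y)"
      by (simp add: approx_ln_def l_def)
  qed
qed

lemma u_ln: "u I i x * ln 2 = ln (1 + nu I i * x) / (2 * T) + x * ln (1 + tau I i / x)"
  by (simp add: u_def f_def g_def log_def field_simps)

text \<open>The part \<open>f\<close> grows at most \<open>b\<close>-fold by
  \<open>ln_scale_le\<close>; in \<open>g\<close> the outer factor grows at most
  \<open>b\<close>-fold while the logarithm decreases. Monotonicity of \<open>g\<close> is
  \<open>ln_scale_le\<close> once more, with scale \<open>y / x\<close> at the argument
  \<open>tau / y\<close>.\<close>

lemma u_scale:
  assumes i: "i \<in> {1..N}" and x: "0 < x" "x \<le> y" "y \<le> b * x" "1 \<le> b"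
  shows "u I i y \<le> b * u I i x" and "u I i x \<le> u I i y"
proof -
  note us = user[OF i]
  have y: "0 < y" using x by linarith
  have "ln (1 + nu I i * y) \<le> ln (1 + b * (nu I i * x))"
    using us x y mult_left_mono[OF x(3), of "nu I i"] by (subst ln_le_cancel_iff) (auto intro!: add_pos_pos mult_pos_pos simp: mult_ac)
  also have "\<dots> \<le> b * ln (1 + nu I i * x)" using us x by (intro ln_scale_le) auto
  finally have "ln (1 + nu I i * y) / (2 * T) \<le> b * (ln (1 + nu I i * x) / (2 * T))"
    using T by (simp add: field_simps)
  moreover have "y * ln (1 + tau I i / y) \<le> (b * x) * ln (1 + tau I i / x)"
  proof (rule mult_mono)
    show "ln (1 + tau I i / y) \<le> ln (1 + tau I i / x)"
      using us x y by (subst ln_le_cancel_iff) (auto intro!: add_pos_pos divide_left_mono divide_pos_pos mult_pos_pos)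
  qed (use us x y in \<open>auto intro!: ln_ge_zero divide_nonneg_nonneg\<close>)
  ultimately have "u I i y * ln 2 \<le> (b * u I i x) * ln 2"
    unfolding u_ln mult.assoc by (simp add: distrib_left mult.assoc)
  then show "u I i y \<le> b * u I i x" by simp
  have "ln (1 + nu I i * x) \<le> ln (1 + nu I i * y)"
    using us x y by (subst ln_le_cancel_iff) (auto intro!: add_pos_pos mult_pos_pos)
  then have "ln (1 + nu I i * x) / (2 * T) \<le> ln (1 + nu I i * y) / (2 * T)"
    using T by (intro divide_right_mono) auto
  moreover have "x * ln (1 + tau I i / x) \<le> y * ln (1 + tau I i / y)"
  proof -
    have "ln (1 + (y / x) * (tau I i / y)) \<le> (y / x) * ln (1 + tau I i / y)"
      by (rule ln_scale_le) (use us x y in auto)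
    moreover have "(y / x) * (tau I i / y) = tau I i / x" using y by simp
    ultimately have "ln (1 + tau I i / x) \<le> (y / x) * ln (1 + tau I i / y)" by simp
    then show ?thesis using x by (simp add: field_simps)
  qed
  ultimately have "u I i x * ln 2 \<le> u I i y * ln 2" unfolding u_ln by linarith
  then show "u I i x \<le> u I i y" by simp
qed

lemma point_ge: "i \<in> {1..N} \<Longrightarrow> lo i \<le> point I d i j"
  unfolding point_def using user base by (simp add: one_le_power)

lemma approx_u_bounds:
  assumes i: "i \<in> {1..N}" and j: "point I d i j \<le> up i"
  shows "(1 - 2 / R) * (ln 2 * u I i (point I d i j)) \<le> approx_u I d i j"
    and "approx_u I d i j \<le> (1 + 1 / R) * (ln 2 * u I i (point I d i j))"
    and "4 * approx_u I d i j < \<beta> ^ Suc K" and "1 \<le> 4 * approx_u I d i j"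
proof -
  define x where "x = point I d i j"
  note us = user[OF i]
  have R0: "12 \<le> real R" using R by simp
  have x: "lo i \<le> x" "x \<le> up i" "0 < x" using point_ge[OF i, of j] less_le_trans[OF us(3)] j by (simp_all add: x_def)
  have K: "\<beta> ^ K \<le> \<beta> ^ Suc K" using base by (intro power_increasing) auto
  have pos: "0 \<le> tau I i / lo i" "0 \<le> nu I i * up i" "0 \<le> up i / lo i" "0 \<le> 4 * nu I i * up i / T"
    using us T by auto
  have y1: "nu I i * x \<le> nu I i * up i" "0 < nu I i * x" using us x by auto
  have y2: "tau I i / x \<le> tau I i / lo i" "0 < tau I i / x"
    using us x by (auto intro!: divide_left_mono)
  have "1 + nu I i * x < \<beta> ^ Suc K" "1 + tau I i / x < \<beta> ^ Suc K"
    using size_bound_less[OF i] K pos y1 y2 us unfolding size_bound_def by linarith+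
  note a1 = approx_ln_bounds[OF y1(2) this(1)] and a2 = approx_ln_bounds[OF y2(2) this(2)]
  have e: "approx_u I d i j = approx_ln I d (nu I i * x) / (2 * T) + x * approx_ln I d (tau I i / x)"
    by (simp add: approx_u_def x_def)
  have w: "r * (ln 2 * u I i x) = r * ln (1 + nu I i * x) / (2 * T) + x * (r * ln (1 + tau I i / x))" for r
    using u_ln[of i x] by (simp add: algebra_simps)
  show lower: "(1 - 2 / R) * (ln 2 * u I i (point I d i j)) \<le> approx_u I d i j"
    unfolding x_def[symmetric] w e
    by (intro add_mono divide_right_mono mult_left_mono a1 a2) (use T x in auto)
  show upper: "approx_u I d i j \<le> (1 + 1 / R) * (ln 2 * u I i (point I d i j))"
    unfolding x_def[symmetric] w e
    by (intro add_mono divide_right_mono mult_left_mono a1 a2) (use T x in auto)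
  \<comment> \<open>A crude bound free of logarithms, which lets \<open>size_bound\<close> be a
    rational expression in the data.\<close>
  have l1: "approx_ln I d y \<le> 2 * y" if "approx_ln I d y \<le> (1 + 1 / R) * ln (1 + y)" "0 < y" for y
  proof -
    have "(1 + 1 / R) * ln (1 + y) \<le> 2 * y"
      using ln_add_one_self_le_self[of y] that R0 by (intro mult_mono) auto
    then show ?thesis using that by linarith
  qed
  have "approx_ln I d (nu I i * x) / (2 * T) \<le> 2 * (nu I i * up i) / (2 * T)"
    using l1[OF a1(2) y1(2)] y1 T by (intro divide_right_mono) auto
  moreover have "x * approx_ln I d (tau I i / x) \<le> 2 * tau I i"
    using mult_left_mono[OF l1[OF a2(2) y2(2)], of x] x by simp
  ultimately have "4 * approx_u I d i j \<le> 4 * nu I i * up i / T + 8 * tau I i" unfolding e by simp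
  then show "4 * approx_u I d i j < \<beta> ^ Suc K"
    using size_bound_less[OF i] K pos unfolding size_bound_def by linarith
  have "1 \<le> u I i x"
  proof -
    have "u I i (lo i) \<le> u I i x"
      by (rule u_scale(2)[OF i, where b = "x / lo i"]) (use x us in auto)
    then show ?thesis using us(5) by linarith
  qed
  moreover have "1 / 2 \<le> ln (2::real)" using ln_ge_frac[of 1] by simp
  ultimately have "1 / 2 * 1 \<le> ln 2 * u I i x" by (intro mult_mono) auto
  moreover have "5 / 6 \<le> 1 - 2 / real R" using R0 by (simp add: field_simps)
  ultimately have "5 / 6 * (1 / 2) \<le> (1 - 2 / R) * (ln 2 * u I i x)" by (intro mult_mono) auto
  then show "1 \<le> 4 * approx_u I d i j" using lower unfolding x_def by linarith
qed

lemma value_level_bounds: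
  assumes i: "i \<in> {1..N}" and j: "point I d i j \<le> up i"
  shows "\<beta> ^ value_level I d i j \<le> (1 + 1 / R) * (4 * ln 2 * u I i (point I d i j))"
    and "(1 - 2 / R) * (4 * ln 2 * u I i (point I d i j)) \<le> \<beta> ^ Suc (value_level I d i j)"
proof -
  note a = approx_u_bounds[OF assms]
  note l = lev_bounds[OF base(1) a(4) a(3), folded value_level_def]
  show "\<beta> ^ value_level I d i j \<le> (1 + 1 / R) * (4 * ln 2 * u I i (point I d i j))"
    using l(1) a(2) by (simp only: mult.assoc mult.left_commute[of _ 4])
  show "(1 - 2 / R) * (4 * ln 2 * u I i (point I d i j)) \<le> \<beta> ^ Suc (value_level I d i j)"
    using l(2) a(1) by (simp only: mult.assoc mult.left_commute[of _ 4])
qed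

end

section \<open>Dynamic programming\<close>

text \<open>\<open>L\<close> bounds all costs from above and thus plays the role of infinity.\<close>

primrec tab :: "(nat \<Rightarrow> nat \<Rightarrow> bool) \<Rightarrow> (nat \<Rightarrow> nat \<Rightarrow> nat \<Rightarrow> nat) \<Rightarrow> (nat \<Rightarrow> nat \<Rightarrow> int) \<Rightarrow>
    int \<Rightarrow> nat \<Rightarrow> nat \<Rightarrow> nat \<Rightarrow> nat \<Rightarrow> int" where
  "tab ok step w L T J 0 = (\<lambda>k. if k = 0 then 0 else L)"
| "tab ok step w L T J (Suc i) = (\<lambda>k'. Min (insert L ((\<lambda>k. Min (insert L ((\<lambda>j.
      if ok i j \<and> step i j k = k' then tab ok step w L T J i k + w i j else L) ` {..<J})))
      ` {..<T})))"

primrec run :: "(nat \<Rightarrow> nat \<Rightarrow> nat \<Rightarrow> nat) \<Rightarrow> (nat \<Rightarrow> nat) \<Rightarrow> nat \<Rightarrow> nat" where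
  "run step js 0 = 0"
| "run step js (Suc i) = step i (js i) (run step js i)"

lemma run_cong: "(\<And>i. i < n \<Longrightarrow> js i = js' i) \<Longrightarrow> run step js n = run step js' n"
  by (induction n) auto

lemma tab_range:
  assumes "0 \<le> L" "\<And>i j. i < n \<Longrightarrow> j < J \<Longrightarrow> 0 \<le> w i j"
  shows "i \<le> n \<Longrightarrow> 0 \<le> tab ok step w L T J i k \<and> tab ok step w L T J i k \<le> L"
proof (induction i arbitrary: k)
  case 0
  show ?case using assms by simp
next
  case (Suc i)
  then have IH: "0 \<le> tab ok step w L T J i k" for k by simp
  show ?case
    using assms Suc.prems by (auto simp: Min_ge_iff intro!: add_nonneg_nonneg IH)
qed

lemma tab_le:
  assumes "\<And>i. i < n \<Longrightarrow> js i < J \<and> ok i (js i) \<and> run step js i < T"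
  shows "i \<le> n \<Longrightarrow> tab ok step w L T J i (run step js i) \<le> (\<Sum>i'<i. w i' (js i'))"
proof (induction i)
  case 0
  show ?case by simp
next
  case (Suc i)
  let ?g = "\<lambda>k j. if ok i j \<and> step i j k = run step js (Suc i)
      then tab ok step w L T J i k + w i j else L"
  have "tab ok step w L T J (Suc i) (run step js (Suc i)) =
      Min (insert L ((\<lambda>k. Min (insert L (?g k ` {..<J}))) ` {..<T}))" by simp
  also have "\<dots> \<le> Min (insert L (?g (run step js i) ` {..<J}))"
    by (rule Min_le) (use assms[of i] Suc.prems in auto)
  also have "\<dots> \<le> ?g (run step js i) (js i)"
    by (rule Min_le) (use assms[of i] Suc.prems in auto)
  also have "\<dots> = tab ok step w L T J i (run step js i) + w i (js i)"
    using assms[of i] Suc.prems by simp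
  finally show ?case using Suc by simp
qed

text \<open>An entry below \<open>L\<close> is none of the inserted defaults, so both minima are
  attained at genuine indices and a run can be rebuilt from them.\<close>

lemma tab_attained:
  assumes "\<And>i j. i < n \<Longrightarrow> j < J \<Longrightarrow> 0 \<le> w i j"
  shows "i \<le> n \<Longrightarrow> tab ok step w L T J i k < L \<Longrightarrow> \<exists>js. (\<forall>i'<i. js i' < J \<and> ok i' (js i')) \<and>
    run step js i = k \<and> tab ok step w L T J i k = (\<Sum>i'<i. w i' (js i'))"
proof (induction i arbitrary: k)
  case 0
  then show ?case by (auto split: if_splits)
next
  case (Suc i)
  let ?g = "\<lambda>k' j. if ok i j \<and> step i j k' = k then tab ok step w L T J i k' + w i j else L"
  let ?t = "tab ok step w L T J (Suc i) k"
  have "?t = Min (insert L ((\<lambda>k. Min (insert L (?g k ` {..<J}))) ` {..<T}))" by simp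
  also have "\<dots> \<in> insert L ((\<lambda>k. Min (insert L (?g k ` {..<J}))) ` {..<T})" by (rule Min_in) auto
  finally obtain k' where k': "?t = Min (insert L (?g k' ` {..<J}))" using Suc.prems(2) by auto
  also have "\<dots> \<in> insert L (?g k' ` {..<J})" by (rule Min_in) auto
  finally obtain j where j: "j < J" "?t = ?g k' j" using Suc.prems(2) by auto
  then have st: "ok i j" "step i j k' = k" "?t = tab ok step w L T J i k' + w i j"
    using Suc.prems(2) by (auto split: if_splits simp del: tab.simps)
  have "tab ok step w L T J i k' < L"
    using st(3) Suc.prems assms[of i j] j(1) by linarith
  then obtain js where js: "\<forall>i'<i. js i' < J \<and> ok i' (js i')" "run step js i = k'"
      "tab ok step w L T J i k' = (\<Sum>i'<i. w i' (js i'))"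
    using Suc.IH Suc.prems by (auto simp del: tab.simps)
  \<comment> \<open>The states up to \<open>i\<close> do not depend on the choice at
    \<open>i\<close> (\<open>run_cong\<close>), so the sequence may be changed there.\<close>
  define js' where "js' = js(i := j)"
  have js': "js' i = j" "i' < i \<Longrightarrow> js' i' = js i'" for i' by (auto simp: js'_def)
  have "run step js' i = k'" using js(2) run_cong[of i js' js step] js'(2) by simp
  then have "run step js' (Suc i) = k" using st(2) js'(1) by simp
  moreover have "\<forall>i'<Suc i. js' i' < J \<and> ok i' (js' i')" using js(1) js' st(1) j(1) by (auto simp: less_Suc_eq)
  moreover have "(\<Sum>i'<i. w i' (js' i')) = (\<Sum>i'<i. w i' (js i'))" by (rule sum.cong) (use js' in auto)
  ultimately show ?case using st(3) js(3) js'(1) by (intro exI[of _ js']) (simp del: tab.simps run.simps)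
qed

section \<open>Integers as sequences of digits\<close>

lemma digits_less:
  fixes a :: "nat \<Rightarrow> int"
  assumes "\<And>i. i < n \<Longrightarrow> 0 \<le> a i \<and> a i < Z" "0 < Z"
  shows "0 \<le> (\<Sum>i<n. a i * Z ^ i) \<and> (\<Sum>i<n. a i * Z ^ i) < Z ^ n"
  using assms(1)
proof (induction n)
  case (Suc n)
  have "(a n + 1) * Z ^ n \<le> Z * Z ^ n" using Suc.prems[of n] assms(2) by (intro mult_right_mono) auto
  then show ?case using Suc assms(2) by (auto simp: algebra_simps)
qed simp

text \<open>Rows of the table and grid indices of a solution are both read off in this way. The
  induction strips the lowest digit, since division by \<open>Z\<close> shifts all others.\<close>

lemma digit:
  fixes a :: "nat \<Rightarrow> int"
  assumes "\<And>i. i < n \<Longrightarrow> 0 \<le> a i \<and> a i < Z" "k < n"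
  shows "(\<Sum>i<n. a i * Z ^ i) div Z ^ k mod Z = a k"
  using assms
proof (induction n arbitrary: k a)
  case (Suc n)
  have Z: "0 < Z" using Suc.prems(1)[of 0] by auto
  let ?S = "\<Sum>i<n. a (Suc i) * Z ^ i"
  have S: "(\<Sum>i<Suc n. a i * Z ^ i) = a 0 + Z * ?S"
    by (subst sum.lessThan_Suc_shift) (simp add: sum_distrib_left mult_ac)
  show ?case
  proof (cases k)
    case 0
    then show ?thesis using S Suc.prems(1)[of 0] by simp
  next
    case (Suc k')
    have "(a 0 + Z * ?S) div Z = ?S" using Suc.prems(1)[of 0] Z by simp
    then have "(\<Sum>i<Suc n. a i * Z ^ i) div Z ^ k = ?S div Z ^ k'"
      unfolding S Suc using Z by (simp add: zdiv_zmult2_eq)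
    then show ?thesis using Suc.IH[of "\<lambda>i. a (Suc i)" k'] Suc.prems Suc by simp
  qed
qed simp

section \<open>The approximation scheme\<close>

text \<open>A common denominator of all grid points: the product clears the lower bounds, and the
  power of \<open>fineness\<close> clears \<open>base ^ j\<close> for \<open>j \<le> cap\<close>.
  Weights are thus exact integers, and the floor in \<open>weight\<close> only changes the
  type.\<close>

definition scale :: "feo \<Rightarrow> nat \<Rightarrow> int" where
  "scale I d = (\<Prod>i<users I. snd (quotient_of (lower I (Suc i)))) * int (fineness I d) ^ cap I d"

definition weight :: "feo \<Rightarrow> nat \<Rightarrow> nat \<Rightarrow> nat \<Rightarrow> int" where
  "weight I d i j = \<lfloor>point I d (Suc i) j * scale I d\<rfloor>"

text \<open>A partial solution is stored together with its total weight in a single integer.\<close>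

definition cost :: "feo \<Rightarrow> nat \<Rightarrow> nat \<Rightarrow> nat \<Rightarrow> int" where
  "cost I d i j = weight I d i j * int (Suc (cap I d)) ^ users I + int j * int (Suc (cap I d)) ^ i"

text \<open>The sum runs over all levels of all users, so it dominates the cost of any choice of one
  level per user.\<close>

definition inf_cost :: "feo \<Rightarrow> nat \<Rightarrow> int" where
  "inf_cost I d = 1 + (\<Sum>i<users I. \<Sum>j<Suc (cap I d). cost I d i j)"

text \<open>\<open>m\<close> is the guessed level of the minimum. Imposing it on each user
  separately saves the dynamic program a second state component. Users are shifted by one, as loops
  count from 0.\<close>

definition admissible :: "feo \<Rightarrow> nat \<Rightarrow> nat \<Rightarrow> nat \<Rightarrow> nat \<Rightarrow> bool" where
  "admissible I d m i j \<longleftrightarrow> m \<le> value_level I d (Suc i) j \<and> point I d (Suc i) j \<le> of_rat (upper I (Suc i))"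

definition step :: "real \<Rightarrow> feo \<Rightarrow> nat \<Rightarrow> nat \<Rightarrow> nat \<Rightarrow> nat \<Rightarrow> nat" where
  "step p I d i j k = merge p I d k (power_level p I d (Suc i) j)"

definition table :: "real \<Rightarrow> feo \<Rightarrow> nat \<Rightarrow> nat \<Rightarrow> nat \<Rightarrow> nat \<Rightarrow> int" where
  "table p I d m = tab (admissible I d m) (step p I d) (cost I d) (inf_cost I d)
     (cap2 p I d + 2) (Suc (cap I d))"

definition approx_\<alpha> :: "real \<Rightarrow> real \<Rightarrow> feo \<Rightarrow> nat \<Rightarrow> int" where
  "approx_\<alpha> p \<alpha> I d = \<lfloor>\<alpha> * 2 ^ prec p I d\<rfloor>"

text \<open>The factors \<open>2 ^ prec\<close> and \<open>fineness ^ cap2\<close> clear all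
  denominators, so the floor is exact; see \<open>objective_eq\<close>.\<close>

definition objective :: "real \<Rightarrow> real \<Rightarrow> feo \<Rightarrow> nat \<Rightarrow> nat \<Rightarrow> nat \<Rightarrow> int" where
  "objective p \<alpha> I d m k = \<lfloor>(approx_\<alpha> p \<alpha> I d * base I d ^ root_level p I d k +
     (2 ^ prec p I d - approx_\<alpha> p \<alpha> I d) * base I d ^ m) * fineness I d ^ cap2 p I d\<rfloor>"

text \<open>The objective is the high part and the table entry the low part of one integer, so
  maximizing the score also carries along the solution. Dividing the entry by the power of
  \<open>Suc (cap I d)\<close> isolates its total weight for the bandwidth test.\<close>

definition score :: "real \<Rightarrow> real \<Rightarrow> feo \<Rightarrow> nat \<Rightarrow> nat \<Rightarrow> nat \<Rightarrow> int" where
  "score p \<alpha> I d m k = (let y = table p I d m (users I) k in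
     if y < inf_cost I d \<and> y div int (Suc (cap I d)) ^ users I \<le> \<lfloor>of_rat (bandwidth I) * scale I d\<rfloor>
     then objective p \<alpha> I d m k * (inf_cost I d + 1) + y else - 1)"

definition best :: "real \<Rightarrow> real \<Rightarrow> feo \<Rightarrow> nat \<Rightarrow> int" where
  "best p \<alpha> I d = Max (insert (- 1) ((\<lambda>m. Max (insert (- 1) (score p \<alpha> I d m ` {..<cap2 p I d + 2})))
     ` {..<Suc (cap I d)}))"

text \<open>The remainder of \<open>best\<close> is the winning table entry, and its low digits are
  the grid indices of the users.\<close>

definition choice :: "real \<Rightarrow> real \<Rightarrow> feo \<Rightarrow> nat \<Rightarrow> nat \<Rightarrow> nat" where
  "choice p \<alpha> I d i = nat (best p \<alpha> I d mod (inf_cost I d + 1) div int (Suc (cap I d)) ^ i mod int (Suc (cap I d)))"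

lemma pnorm_le:
  fixes a b :: "nat \<Rightarrow> real"
  assumes "1 \<le> p" "0 \<le> c" "\<And>i. i < n \<Longrightarrow> 0 \<le> a i \<and> a i \<le> c * b i \<and> 0 \<le> b i"
  shows "(\<Sum>i<n. a i powr p) powr (1 / p) \<le> c * (\<Sum>i<n. b i powr p) powr (1 / p)"
proof -
  have "(\<Sum>i<n. a i powr p) \<le> (\<Sum>i<n. (c * b i) powr p)"
    using assms by (intro sum_mono powr_mono2) auto
  also have "\<dots> = c powr p * (\<Sum>i<n. b i powr p)"
    using assms by (simp add: powr_mult sum_distrib_left)
  finally have "(\<Sum>i<n. a i powr p) powr (1 / p) \<le> (c powr p * (\<Sum>i<n. b i powr p)) powr (1 / p)"
    using assms(1) by (intro powr_mono2) (auto intro: sum_nonneg)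
  also have "\<dots> = c * (\<Sum>i<n. b i powr p) powr (1 / p)"
    using assms(1,2) by (simp add: powr_mult powr_powr sum_nonneg)
  finally show ?thesis .
qed

section \<open>Rounding errors of the dynamic program\<close>

context scheme
begin

abbreviation "A \<equiv> approx_p p I d"
abbreviation "S \<equiv> run (step p I d)"

lemma caps: "K \<le> K2" "R \<le> K2" "K2 \<le> Pr" "real Pr \<le> 2 ^ Pr"
proof -
  have "1 \<le> nat \<lceil>p\<rceil>" using p by linarith
  then have "1 * K \<le> nat \<lceil>p\<rceil> * K" by (intro mult_right_mono) auto
  then show "K \<le> K2" unfolding cap2_def by linarith
  have "R * 1 \<le> M * N" using M N by (intro mult_mono) auto
  then show "R \<le> K2" unfolding cap2_def by simp
  show "K2 \<le> Pr" by (simp add: prec_def)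
  have "Pr \<le> 2 ^ Pr" by (rule less_imp_le) (rule less_exp)
  then show "real Pr \<le> 2 ^ Pr" by (metis of_nat_le_iff of_nat_numeral of_nat_power)
qed

lemma approx_p_bounds: "p - 1 / 2 ^ Pr < A / 2 ^ Pr" "A / 2 ^ Pr \<le> p" "1 \<le> A / 2 ^ Pr" "0 < A"
proof -
  show "p - 1 / 2 ^ Pr < A / 2 ^ Pr" "A / 2 ^ Pr \<le> p"
    unfolding approx_p_def by (rule floor_mult_power2)+
  have "1 * 2 ^ Pr \<le> p * 2 ^ Pr" using p by (intro mult_right_mono) auto
  then have A: "2 ^ Pr \<le> A" unfolding approx_p_def by (simp add: le_floor_iff)
  then show "0 < A" by (smt (verit) zero_less_power)
  have "real_of_int (2 ^ Pr) \<le> A" using A by (simp only: of_int_le_iff)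
  then show "1 \<le> A / 2 ^ Pr" by simp
qed

lemma real_nat_div:
  fixes a b :: int
  assumes "0 \<le> a" "0 < b"
  shows "real (nat (a div b)) \<le> a / b" "a / b - 1 < real (nat (a div b))"
proof -
  have e: "real (nat (a div b)) = of_int \<lfloor>a / b\<rfloor>"
    using assms by (simp add: floor_divide_of_int_eq pos_imp_zdiv_nonneg_iff)
  show "real (nat (a div b)) \<le> a / b" "a / b - 1 < real (nat (a div b))"
    unfolding e by linarith+
qed

text \<open>Two levels may be lost: one by truncating \<open>p\<close>, since the value level is at
  most \<open>2 ^ Pr\<close>, and one by the integer division.\<close>

lemma power_level_bounds:
  defines "v \<equiv> value_level I d"
  shows "real (power_level p I d i j) \<le> p * v i j"
    and "p * v i j - 2 < real (power_level p I d i j)"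
    and "power_level p I d i j \<le> nat \<lceil>p\<rceil> * K"
proof -
  have r: "real (power_level p I d i j) \<le> v i j * (A / 2 ^ Pr)"
      "v i j * (A / 2 ^ Pr) - 1 < real (power_level p I d i j)"
    using real_nat_div[of "int (v i j) * A" "2 ^ Pr"] approx_p_bounds(4)
    unfolding power_level_def v_def by simp_all
  have v: "real (v i j) \<le> K" unfolding v_def value_level_def using lev_le by simp
  have "v i j * (A / 2 ^ Pr) \<le> v i j * p" by (intro mult_left_mono approx_p_bounds) simp
  then show *: "real (power_level p I d i j) \<le> p * v i j" using r(1) by (simp add: mult.commute)
  have "real (v i j) \<le> 2 ^ Pr" using v caps by linarith
  then have "v i j * (1 / 2 ^ Pr) \<le> 1" by simp
  moreover have "v i j * (p - 1 / 2 ^ Pr) \<le> v i j * (A / 2 ^ Pr)"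
    using approx_p_bounds(1) by (intro mult_left_mono) auto
  ultimately have "v i j * p - 1 \<le> v i j * (A / 2 ^ Pr)" unfolding right_diff_distrib by linarith
  then show "p * v i j - 2 < real (power_level p I d i j)" using r(2) unfolding mult.commute[of p] by linarith
  have "p * v i j \<le> real (nat \<lceil>p\<rceil>) * K" using p v by (intro mult_mono) (auto intro: real_nat_ceiling_ge)
  then have "real (power_level p I d i j) \<le> real (nat \<lceil>p\<rceil> * K)" using * by simp
  then show "power_level p I d i j \<le> nat \<lceil>p\<rceil> * K" by (simp only: of_nat_le_iff)
qed

lemma base_powr: "\<beta> ^ n = \<beta> powr n"
  using base by (simp add: powr_realpow)

lemma power_level_powr:
  "\<beta> ^ power_level p I d i j \<le> (\<beta> ^ value_level I d i j) powr p"
  "(\<beta> ^ value_level I d i j) powr p \<le> \<beta> ^ 2 * \<beta> ^ power_level p I d i j"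
proof -
  have e: "(\<beta> ^ value_level I d i j) powr p = \<beta> powr (p * value_level I d i j)"
    unfolding base_powr by (simp add: powr_powr mult.commute)
  show "\<beta> ^ power_level p I d i j \<le> (\<beta> ^ value_level I d i j) powr p"
    unfolding e unfolding base_powr using power_level_bounds(1) base by (intro powr_mono) auto
  have "\<beta> powr (p * value_level I d i j) \<le> \<beta> powr (real (2 + power_level p I d i j))"
    using power_level_bounds(2)[of i j] base by (intro powr_mono) auto
  then show "(\<beta> ^ value_level I d i j) powr p \<le> \<beta> ^ 2 * \<beta> ^ power_level p I d i j"
    unfolding e base_powr[symmetric] by (simp add: power2_eq_square mult.assoc)
qed

text \<open>The truncated \<open>p\<close> is too small, which raises the quotient by at most one
  level because \<open>k - 1 \<le> 2 ^ Pr\<close>; the integer division lowers it by less than one.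
  Hence one factor \<beta> in either direction.\<close>

lemma root_level_bounds:
  assumes "k \<le> Suc K2"
  shows "\<beta> ^ root_level p I d k \<le> \<beta> * (\<beta> ^ (k - 1)) powr (1 / p)"
    and "(\<beta> ^ (k - 1)) powr (1 / p) \<le> \<beta> * \<beta> ^ root_level p I d k"
    and "root_level p I d k \<le> K2"
proof -
  define a where "a = A / 2 ^ Pr"
  have a: "1 \<le> a" "a \<le> p" "p - a \<le> 1 / 2 ^ Pr" using approx_p_bounds by (auto simp: a_def)
  define n where "n = k - 1"
  define t where "t = root_level p I d k"
  have n: "n \<le> K2" using assms by (simp add: n_def)
  have t: "real t \<le> n / a" "n / a - 1 < real t"
    using real_nat_div[of "int n * 2 ^ Pr" A] approx_p_bounds(4)
    unfolding root_level_def t_def n_def a_def by simp_all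
  have "n / a - n / p = n * ((p - a) / (a * p))" using a by (simp add: field_simps)
  also have "\<dots> \<le> n * ((p - a) / 1)"
    using a mult_mono[of 1 a 1 p] by (intro mult_left_mono divide_left_mono) auto
  also have "\<dots> \<le> n * (1 / 2 ^ Pr)" using a(3) by (intro mult_left_mono) auto
  also have "\<dots> \<le> 1"
  proof -
    have "real n \<le> 2 ^ Pr" using n caps by linarith
    then show ?thesis by simp
  qed
  finally have up: "n / a \<le> n / p + 1" by simp
  have low: "n / p \<le> n / a" using a by (intro divide_left_mono) auto
  have e: "(\<beta> ^ n) powr (1 / p) = \<beta> powr (n / p)" unfolding base_powr by (simp add: powr_powr)
  have e1: "\<beta> * \<beta> powr x = \<beta> powr (x + 1)" for x using base by (simp add: powr_add)
  show "\<beta> ^ root_level p I d k \<le> \<beta> * (\<beta> ^ (k - 1)) powr (1 / p)"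
    unfolding t_def[symmetric] n_def[symmetric] e e1 unfolding base_powr using base t up
    by (intro powr_mono) auto
  have "\<beta> powr (n / p) \<le> \<beta> powr (real t + 1)" using base t low by (intro powr_mono) auto
  then show "(\<beta> ^ (k - 1)) powr (1 / p) \<le> \<beta> * \<beta> ^ root_level p I d k"
    unfolding t_def[symmetric] n_def[symmetric] e e1[symmetric] unfolding base_powr .
  have "n / a \<le> n / 1" using a by (intro divide_left_mono) auto
  then have "real t \<le> n" using t by simp
  then show "root_level p I d k \<le> K2" using n unfolding t_def by simp
qed

text \<open>Each merge rounds down by at most a factor \<beta>, and the earlier errors persist, so
  \<open>i\<close> merges lose at most \<open>\<beta> ^ i\<close>. The bound on the states shows
  that the capped search never saturates.\<close>

lemma state_bounds:
  assumes "i \<le> N"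
  shows "state_val I d (S js i) \<le> (\<Sum>l<i. \<beta> ^ power_level p I d (Suc l) (js l))"
    and "(\<Sum>l<i. \<beta> ^ power_level p I d (Suc l) (js l)) \<le> state_val I d (S js i) * \<beta> ^ i"
    and "S js i < K2 + 2"
    and "0 < i \<Longrightarrow> 0 < S js i"
proof -
  define r where "r l = power_level p I d (Suc l) (js l)" for l
  have sum_le: "(\<Sum>l<i. \<beta> ^ r l) \<le> \<beta> ^ K2" if "i \<le> N" for i
  proof -
    have "(\<Sum>l<i. \<beta> ^ r l) \<le> (\<Sum>l<i. \<beta> ^ (nat \<lceil>p\<rceil> * K))"
      unfolding r_def using base power_level_bounds(3) by (intro sum_mono power_increasing) auto
    also have "\<dots> = real i * \<beta> ^ (nat \<lceil>p\<rceil> * K)" by simp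
    also have "\<dots> \<le> 2 ^ N * \<beta> ^ (nat \<lceil>p\<rceil> * K)"
    proof (rule mult_right_mono)
      have "i \<le> 2 ^ N" using that less_exp[of N] by linarith
      then show "real i \<le> 2 ^ N" by (metis of_nat_le_iff of_nat_numeral of_nat_power)
    qed (use base in auto)
    also have "\<dots> \<le> (\<beta> ^ M) ^ N * \<beta> ^ (nat \<lceil>p\<rceil> * K)" using base by (intro mult_right_mono power_mono) auto
    also have "\<dots> = \<beta> ^ K2" unfolding cap2_def power_add power_mult[of \<beta> M N] by (rule mult.commute)
    finally show ?thesis .
  qed
  have "state_val I d (S js i) \<le> (\<Sum>l<i. \<beta> ^ r l) \<and> (\<Sum>l<i. \<beta> ^ r l) \<le> state_val I d (S js i) * \<beta> ^ i
      \<and> S js i < K2 + 2 \<and> (0 < i \<longrightarrow> 0 < S js i)"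
    using assms
  proof (induction i)
    case 0
    show ?case by (simp add: state_val_def)
  next
    case (Suc i)
    define y where "y = state_val I d (S js i) + \<beta> ^ r i"
    have IH: "state_val I d (S js i) \<le> (\<Sum>l<i. \<beta> ^ r l)" "(\<Sum>l<i. \<beta> ^ r l) \<le> state_val I d (S js i) * \<beta> ^ i"
      using Suc by auto
    have "0 \<le> state_val I d (S js i)" using base by (simp add: state_val_def)
    then have "1 \<le> y" using base one_le_power[of \<beta> "r i"] unfolding y_def by linarith
    have y: "y \<le> (\<Sum>l<Suc i. \<beta> ^ r l)" unfolding y_def using IH by simp
    also have "\<dots> \<le> \<beta> ^ K2" by (rule sum_le[OF Suc.prems])
    also have "\<dots> < \<beta> ^ Suc K2" using base by simp
    finally have "y < \<beta> ^ Suc K2" .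
    note l = lev_bounds[OF base(1) \<open>1 \<le> y\<close> this]
    have S: "S js (Suc i) = Suc (lev \<beta> K2 y)" by (simp add: step_def merge_def y_def r_def)
    \<comment> \<open>The new summand is exact but is charged like the old ones, so that
      \<open>\<beta> ^ i\<close> can be factored out.\<close>
    have "(\<Sum>l<Suc i. \<beta> ^ r l) \<le> state_val I d (S js i) * \<beta> ^ i + \<beta> ^ r i * \<beta> ^ i"
    proof -
      have "\<beta> ^ r i * 1 \<le> \<beta> ^ r i * \<beta> ^ i"
        using base by (intro mult_left_mono one_le_power) auto
      then show ?thesis using IH(2) by simp
    qed
    also have "\<dots> = y * \<beta> ^ i" by (simp add: y_def distrib_right)
    also have "\<dots> \<le> \<beta> ^ Suc (lev \<beta> K2 y) * \<beta> ^ i" using l(2) base by (intro mult_right_mono) auto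
    finally show ?case using l(1) y S lev_le[of \<beta> K2 y] by (simp add: state_val_def mult_ac)
  qed
  then show "state_val I d (S js i) \<le> (\<Sum>l<i. \<beta> ^ power_level p I d (Suc l) (js l))"
    "(\<Sum>l<i. \<beta> ^ power_level p I d (Suc l) (js l)) \<le> state_val I d (S js i) * \<beta> ^ i"
    "S js i < K2 + 2" "0 < i \<Longrightarrow> 0 < S js i" unfolding r_def by auto
qed

text \<open>The objective as seen by the dynamic program, from the guessed minimum level and the
  final state, with the exact weight \<alpha>.\<close>

definition G :: "nat \<Rightarrow> nat \<Rightarrow> real" where
  "G m k = \<alpha> * \<beta> ^ root_level p I d k + (1 - \<alpha>) * \<beta> ^ m"

lemma users_shift: "{1..N} = Suc ` {..<N}"
  by (simp add: image_Suc_lessThan)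

lemma F_norm_lessThan: "F_norm p I x = (\<Sum>i<N. u I (Suc i) (x (Suc i)) powr p) powr (1 / p)"
  by (simp add: F_norm_def sum.atLeast1_atMost_eq)

text \<open>Soundness: the estimate overshoots the scaled true value only slightly. Roundings down
  are harmless in this direction; what remains is one \<beta> from the root and the upward error of
  the logarithms. A guess \<open>m\<close> below the true minimum only makes the estimate
  smaller.\<close>

lemma F_lower:
  assumes js: "\<And>i. i < N \<Longrightarrow> admissible I d m i (js i)"
    and x: "\<And>i. i < N \<Longrightarrow> x (Suc i) = point I d (Suc i) (js i)"
  shows "G m (S js N) \<le> \<beta> * ((1 + 1 / R) * (4 * ln 2)) * F p \<alpha> I x"
proof -
  define c where "c = (1 + 1 / R) * (4 * ln 2 :: real)"
  have c: "0 < c" unfolding c_def by (intro mult_pos_pos add_pos_nonneg) auto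
  define k where "k = S js N"
  have k: "0 < k" "k \<le> Suc K2" using state_bounds(3,4)[of N js] N by (auto simp: k_def)
  have v: "\<beta> ^ value_level I d (Suc i) (js i) \<le> c * u I (Suc i) (x (Suc i))" if "i < N" for i
    using value_level_bounds(1)[of "Suc i" "js i"] js[OF that] x[OF that] that
    by (simp add: admissible_def c_def mult.assoc)
  have u0: "0 \<le> u I (Suc i) (x (Suc i))" if "i < N" for i
  proof -
    have "0 < c * u I (Suc i) (x (Suc i))"
      using v[OF that] base zero_less_power[of \<beta> "value_level I d (Suc i) (js i)"] by linarith
    then show ?thesis using c by (simp add: zero_less_mult_iff)
  qed
  have "\<beta> ^ root_level p I d k \<le> \<beta> * (\<beta> ^ (k - 1)) powr (1 / p)"
    by (rule root_level_bounds) (use k in auto)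
  also have "\<dots> \<le> \<beta> * (\<Sum>i<N. \<beta> ^ power_level p I d (Suc i) (js i)) powr (1 / p)"
    using state_bounds(1)[of N js] k p base by (intro mult_left_mono powr_mono2) (auto simp: state_val_def k_def)
  also have "\<dots> \<le> \<beta> * (\<Sum>i<N. (\<beta> ^ value_level I d (Suc i) (js i)) powr p) powr (1 / p)"
    using power_level_powr(1) p base by (intro mult_left_mono powr_mono2 sum_mono) (auto intro!: sum_nonneg)
  also have "\<dots> \<le> \<beta> * (c * (\<Sum>i<N. u I (Suc i) (x (Suc i)) powr p) powr (1 / p))"
    using v u0 c p base by (intro mult_left_mono pnorm_le) auto
  finally have norm: "\<beta> ^ root_level p I d k \<le> \<beta> * c * F_norm p I x"
    unfolding F_norm_lessThan by (simp add: mult.assoc)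
  have "\<beta> ^ m / (\<beta> * c) \<le> F_min I x"
    unfolding F_min_def
  proof (rule Min.boundedI)
    fix z assume "z \<in> (\<lambda>i. u I i (x i)) ` {1..N}"
    then obtain i where i: "i < N" "z = u I (Suc i) (x (Suc i))" unfolding users_shift by auto
    have "\<beta> ^ m \<le> \<beta> ^ value_level I d (Suc i) (js i)"
      using js[OF i(1)] base by (intro power_increasing) (auto simp: admissible_def)
    also have "\<dots> \<le> c * z" using v[OF i(1)] i by simp
    \<comment> \<open>A spare \<beta>, inserted so that minimum and norm carry the same
      factor.\<close>
    also have "\<dots> \<le> \<beta> * (c * z)" using base mult_right_mono[of 1 \<beta> "c * z"] c u0[OF i(1)] i(2) by simp
    finally show "\<beta> ^ m / (\<beta> * c) \<le> z" using base c by (simp add: divide_le_eq mult_ac)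
  qed (use N in auto)
  then have min: "\<beta> ^ m \<le> \<beta> * c * F_min I x" using base c by (simp add: divide_le_eq mult_ac)
  have "G m k \<le> \<alpha> * (\<beta> * c * F_norm p I x) + (1 - \<alpha>) * (\<beta> * c * F_min I x)"
    unfolding G_def using norm min \<alpha> by (intro add_mono mult_left_mono) auto
  also have "\<dots> = \<beta> * c * F p \<alpha> I x" unfolding F_def by (simp add: algebra_simps)
  finally show ?thesis unfolding k_def c_def .
qed

text \<open>Rounding down respects the bandwidth and the upper bounds, and starting the grid at
  \<open>lo i\<close> respects the lower ones.\<close>

lemma round_to_point:
  assumes y: "y \<in> feasible I" and i: "i \<in> {1..N}"
  obtains j where "j \<le> K" "point I d i j \<le> y i" "y i \<le> \<beta> * point I d i j"
proof -
  note us = user[OF i]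
  have yi: "lo i \<le> y i" "y i \<le> up i" using y i by (auto simp: feasible_def)
  define j where "j = lev \<beta> K (y i / lo i)"
  have pos: "0 \<le> tau I i / lo i" "0 \<le> nu I i * up i" "0 \<le> 4 * nu I i * up i / T" "0 < tau I i"
    using us T by auto
  have K: "\<beta> ^ K \<le> \<beta> ^ Suc K" using base by (intro power_increasing) auto
  have "y i / lo i \<le> up i / lo i" using yi us(3) by (intro divide_right_mono) linarith+
  then have "y i / lo i < \<beta> ^ Suc K"
    using size_bound_less[OF i] K pos unfolding size_bound_def by linarith
  moreover have "1 \<le> y i / lo i" using yi us(3) by (simp only: le_divide_eq_1_pos)
  ultimately have l: "\<beta> ^ j \<le> y i / lo i" "y i / lo i < \<beta> ^ Suc j"
    using lev_bounds[OF base(1)] unfolding j_def by blast+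
  have "lo i * \<beta> ^ j \<le> y i" using l(1) us(3) by (simp only: pos_le_divide_eq mult.commute)
  moreover have "y i \<le> \<beta> * (lo i * \<beta> ^ j)"
    using l(2) us(3) by (simp only: pos_divide_less_eq power_Suc mult_ac)
  ultimately show ?thesis
    using that[of j] lev_le unfolding point_def j_def by blast
qed

text \<open>Completeness. The exponent collects all roundings: 2 for the point and its value level,
  \<open>N + 2\<close> for the power level and the merges, 1 for the root. The middle part stands
  under the root, which is bounded by the part itself, as this is at least 1.\<close>

lemma F_upper:
  assumes y: "y \<in> feasible I"
  obtains js m where "\<And>i. i < N \<Longrightarrow> js i \<le> K" "m \<le> K" "\<And>i. i < N \<Longrightarrow> admissible I d m i (js i)"
    "\<And>i. i < N \<Longrightarrow> point I d (Suc i) (js i) \<le> y (Suc i)"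
    "(1 - 2 / R) * (4 * ln 2) * F p \<alpha> I y \<le> \<beta> ^ (N + 5) * G m (S js N)"
proof -
  have "\<exists>j. j \<le> K \<and> point I d (Suc i) j \<le> y (Suc i) \<and> y (Suc i) \<le> \<beta> * point I d (Suc i) j"
    if "i < N" for i
    by (rule round_to_point[OF y, of "Suc i"]) (use that in auto)
  then obtain js where js: "\<And>i. i < N \<Longrightarrow> js i \<le> K \<and> point I d (Suc i) (js i) \<le> y (Suc i) \<and>
      y (Suc i) \<le> \<beta> * point I d (Suc i) (js i)" by metis
  define v where "v i = value_level I d (Suc i) (js i)" for i
  \<comment> \<open>The right guess is the least level that occurs: every user is admissible, and
    the minimum suffers only its own rounding.\<close>
  define m where "m = Min (v ` {..<N})"
  have "m \<in> v ` {..<N}" unfolding m_def using N by (intro Min_in) (auto simp: lessThan_empty_iff)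
  then obtain i0 where i0: "i0 < N" "m = v i0" by auto
  have m: "m \<le> v i" if "i < N" for i unfolding m_def using that by auto
  have up: "y (Suc i) \<le> up (Suc i)" if "i < N" for i using y that by (auto simp: feasible_def)
  have adm: "admissible I d m i (js i)" if "i < N" for i
    unfolding admissible_def using m[OF that] js[OF that] up[OF that] by (auto simp: v_def)
  define c where "c = (1 - 2 / R) * (4 * ln 2 :: real)"
  have c: "0 < c" unfolding c_def using R(1) by (intro mult_pos_pos) auto
  have v: "c * u I (Suc i) (y (Suc i)) \<le> \<beta> ^ 2 * \<beta> ^ v i" and u0: "0 \<le> u I (Suc i) (y (Suc i))"
    if "i < N" for i
  proof -
    have i: "Suc i \<in> {1..N}" using that by auto
    let ?x = "point I d (Suc i) (js i)"
    have x: "lo (Suc i) \<le> ?x" by (rule point_ge[OF i])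
    have x0: "0 < lo (Suc i)" using user[OF i] by blast
    have "u I (Suc i) (y (Suc i)) \<le> \<beta> * u I (Suc i) ?x"
      by (rule u_scale(1)[OF i]) (use less_le_trans[OF x0 x] js[OF that] base in auto)
    then have "c * u I (Suc i) (y (Suc i)) \<le> c * (\<beta> * u I (Suc i) ?x)" using c by (intro mult_left_mono) auto
    also have "\<dots> = \<beta> * ((1 - 2 / R) * (4 * ln 2 * u I (Suc i) ?x))" by (simp add: c_def mult_ac)
    also have "\<dots> \<le> \<beta> * \<beta> ^ Suc (v i)"
      unfolding v_def using js[OF that] up[OF that] base
      by (intro mult_left_mono value_level_bounds(2)[OF i]) auto
    finally show "c * u I (Suc i) (y (Suc i)) \<le> \<beta> ^ 2 * \<beta> ^ v i" by (simp add: power2_eq_square mult_ac)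
    have "u I (Suc i) (lo (Suc i)) \<le> u I (Suc i) (y (Suc i))"
      by (rule u_scale(2)[OF i x0, where b = "y (Suc i) / lo (Suc i)"]) (use x x0 js[OF that] in auto)
    then show "0 \<le> u I (Suc i) (y (Suc i))" using user(5)[OF i] by linarith
  qed
  define k where "k = S js N"
  have k: "0 < k" "k \<le> Suc K2" using state_bounds(3,4)[of N js] N by (auto simp: k_def)
  have r1: "1 \<le> \<beta> ^ n" for n using base by (intro one_le_power) auto
  have powr_le: "x powr (1 / p) \<le> x" if "1 \<le> x" for x :: real
    using powr_mono[of "1 / p" 1 x] that p by (simp add: field_simps)
  have "c * F_norm p I y \<le> \<beta> ^ 2 * (\<Sum>i<N. (\<beta> ^ v i) powr p) powr (1 / p)"
  proof -
    have "(\<Sum>i<N. u I (Suc i) (y (Suc i)) powr p) powr (1 / p) \<le>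
        (\<beta> ^ 2 / c) * (\<Sum>i<N. (\<beta> ^ v i) powr p) powr (1 / p)"
      using v u0 c p base by (intro pnorm_le) (auto simp: pos_le_divide_eq mult_ac)
    then show ?thesis unfolding F_norm_lessThan using c by (simp add: field_simps)
  qed
  also have "\<dots> \<le> \<beta> ^ 2 * (\<beta> ^ 2 * (\<beta> ^ N * \<beta> ^ (k - 1))) powr (1 / p)"
  proof (intro mult_left_mono powr_mono2)
    have "(\<Sum>i<N. (\<beta> ^ v i) powr p) \<le> (\<Sum>i<N. \<beta> ^ 2 * \<beta> ^ power_level p I d (Suc i) (js i))"
      unfolding v_def using power_level_powr(2) by (rule sum_mono)
    also have "\<dots> = \<beta> ^ 2 * (\<Sum>i<N. \<beta> ^ power_level p I d (Suc i) (js i))" by (simp add: sum_distrib_left)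
    also have "\<dots> \<le> \<beta> ^ 2 * (state_val I d k * \<beta> ^ N)"
      unfolding k_def using state_bounds(2)[of N js] base by (intro mult_left_mono) auto
    finally show "(\<Sum>i<N. (\<beta> ^ v i) powr p) \<le> \<beta> ^ 2 * (\<beta> ^ N * \<beta> ^ (k - 1))"
      using k by (simp add: state_val_def mult_ac)
  qed (use p base in \<open>auto intro: sum_nonneg\<close>)
  also have "\<dots> = \<beta> ^ 2 * ((\<beta> ^ (N + 2)) powr (1 / p) * (\<beta> ^ (k - 1)) powr (1 / p))"
  proof -
    have e: "\<beta> ^ 2 * (\<beta> ^ N * \<beta> ^ (k - 1)) = \<beta> ^ (N + 2) * \<beta> ^ (k - 1)"
      by (simp add: power_add power2_eq_square)
    have "(\<beta> ^ (N + 2) * \<beta> ^ (k - 1)) powr (1 / p) = (\<beta> ^ (N + 2)) powr (1 / p) * (\<beta> ^ (k - 1)) powr (1 / p)"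
      by (rule powr_mult; use base in simp)
    then show ?thesis by (simp only: e)
  qed
  also have "\<dots> \<le> \<beta> ^ 2 * (\<beta> ^ (N + 2) * (\<beta> * \<beta> ^ root_level p I d k))"
    by (intro mult_left_mono mult_mono root_level_bounds(2)[OF k(2)] powr_le[OF r1]) (use base in auto)
  also have "\<dots> = \<beta> ^ (N + 5) * \<beta> ^ root_level p I d k"
    by (simp add: power_add eval_nat_numeral mult_ac)
  finally have norm: "c * F_norm p I y \<le> \<beta> ^ (N + 5) * \<beta> ^ root_level p I d k" .
  have "F_min I y \<le> u I (Suc i0) (y (Suc i0))"
    unfolding F_min_def using i0 by (intro Min_le) auto
  then have "c * F_min I y \<le> c * u I (Suc i0) (y (Suc i0))" using c by (intro mult_left_mono) auto
  also have "\<dots> \<le> \<beta> ^ 2 * \<beta> ^ m" using v[OF i0(1)] i0(2) by simp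
  also have "\<dots> \<le> \<beta> ^ (N + 5) * \<beta> ^ m"
    using base by (intro mult_right_mono power_increasing) auto
  finally have min: "c * F_min I y \<le> \<beta> ^ (N + 5) * \<beta> ^ m" .
  have "c * F p \<alpha> I y = \<alpha> * (c * F_norm p I y) + (1 - \<alpha>) * (c * F_min I y)"
    by (simp add: F_def algebra_simps)
  also have "\<dots> \<le> \<alpha> * (\<beta> ^ (N + 5) * \<beta> ^ root_level p I d k) + (1 - \<alpha>) * (\<beta> ^ (N + 5) * \<beta> ^ m)"
    using norm min \<alpha> by (intro add_mono mult_left_mono) auto
  also have "\<dots> = \<beta> ^ (N + 5) * G m k" by (simp add: G_def algebra_simps)
  finally have "c * F p \<alpha> I y \<le> \<beta> ^ (N + 5) * G m (S js N)" unfolding k_def .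
  moreover have "m \<le> K" unfolding i0(2) v_def value_level_def by (rule lev_le)
  ultimately show ?thesis using that[of js m] js adm unfolding c_def by blast
qed

end

section \<open>Exact integer arithmetic and recovery of the best solution\<close>

context scheme
begin

abbreviation "J \<equiv> int (Suc K)"
abbreviation "\<Lambda> \<equiv> scale I d"
abbreviation "Z \<equiv> inf_cost I d + 1"

text \<open>This is where \<open>\<beta> = (M + 1) / M\<close> is used: a power of \<open>M\<close>
  is a common denominator for a whole range of grid points.\<close>

lemma grid_integral:
  assumes "j \<le> n"
  shows "\<beta> ^ j * real M ^ n = real ((M + 1) ^ j * M ^ (n - j))"
proof -
  have "\<beta> = (real M + 1) / real M" using M(3) by (simp add: base_def field_simps)
  moreover have "real M ^ n = real M ^ j * real M ^ (n - j)" using assms by (simp flip: power_add)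
  ultimately show ?thesis using M(3) by (simp add: power_divide add.commute)
qed

lemma scale_pos: "0 < \<Lambda>"
  unfolding scale_def using M(3) by (intro mult_pos_pos prod_pos zero_less_power) (auto simp: quotient_of_denom_pos')

lemma weight_eq:
  assumes "i < N" "j \<le> K"
  shows "of_int (weight I d i j) = point I d (Suc i) j * \<Lambda>"
proof -
  obtain a b where ab: "quotient_of (lower I (Suc i)) = (a, b)" by force
  then have l: "lo (Suc i) = of_int a / of_int b"
    using quotient_of_div[OF ab] by (simp add: of_rat_divide)
  have "b > 0" using quotient_of_denom_pos[OF ab] .
  let ?Q = "\<Prod>i<N. snd (quotient_of (lower I (Suc i)))"
  have "snd (quotient_of (lower I (Suc i))) dvd ?Q" by (rule dvd_prodI) (use assms in auto)
  then have "b dvd ?Q" using ab by simp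
  then obtain e where e: "?Q = b * e" by (rule dvdE)
  have "point I d (Suc i) j * \<Lambda> = lo (Suc i) * of_int ?Q * (\<beta> ^ j * real M ^ K)"
    by (simp add: point_def scale_def)
  also have "lo (Suc i) * of_int ?Q = of_int (a * e)" using l e \<open>b > 0\<close> by simp
  also have "of_int (a * e) * (\<beta> ^ j * real M ^ K) = of_int (a * e * int ((M + 1) ^ j * M ^ (K - j)))"
    unfolding grid_integral[OF assms(2)] by simp
  finally show ?thesis by (simp add: weight_def)
qed

lemma point_pos: "i < N \<Longrightarrow> 0 < point I d (Suc i) j"
  by (rule less_le_trans[OF user(3) point_ge]) auto

lemma weight_nonneg: "i < N \<Longrightarrow> 0 \<le> weight I d i j"
  unfolding weight_def using point_pos[of i j] scale_pos by (auto intro: mult_nonneg_nonneg)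

lemma cost_nonneg: "i < N \<Longrightarrow> 0 \<le> cost I d i j"
  unfolding cost_def using weight_nonneg by auto

lemma inf_cost_pos: "1 \<le> inf_cost I d"
  unfolding inf_cost_def by (auto simp: cost_nonneg intro!: sum_nonneg simp del: sum.lessThan_Suc)

lemma sum_cost_less:
  assumes "\<And>i. i < N \<Longrightarrow> js i \<le> K"
  shows "(\<Sum>i<N. cost I d i (js i)) < inf_cost I d"
proof -
  have "(\<Sum>i<N. cost I d i (js i)) \<le> (\<Sum>i<N. \<Sum>j<Suc K. cost I d i j)"
    by (intro sum_mono member_le_sum) (use assms cost_nonneg in \<open>auto simp: less_Suc_eq_le\<close>)
  then show ?thesis by (simp add: inf_cost_def)
qed

lemma sum_cost:
  "(\<Sum>i<N. cost I d i (js i)) = (\<Sum>i<N. weight I d i (js i)) * J ^ N + (\<Sum>i<N. int (js i) * J ^ i)"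
  unfolding cost_def by (simp add: sum.distrib sum_distrib_right)

lemma sum_cost_decode:
  assumes "\<And>i. i < N \<Longrightarrow> js i \<le> K"
  shows "(\<Sum>i<N. cost I d i (js i)) div J ^ N = (\<Sum>i<N. weight I d i (js i))"
    and "i < N \<Longrightarrow> (\<Sum>i<N. cost I d i (js i)) div J ^ i mod J = int (js i)"
proof -
  let ?W = "\<Sum>i<N. weight I d i (js i)"
  let ?D = "\<Sum>i<N. int (js i) * J ^ i"
  have c: "0 \<le> int (js i) \<and> int (js i) < J" if "i < N" for i using assms[OF that] by simp
  have D: "0 \<le> ?D" "?D < J ^ N" using digits_less[of N "\<lambda>i. int (js i)" J, OF c] by auto
  show "(\<Sum>i<N. cost I d i (js i)) div J ^ N = ?W"
    unfolding sum_cost using D by simp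
  assume i: "i < N"
  \<comment> \<open>Division by \<open>J ^ i\<close> leaves the weight part a multiple of
    \<open>J ^ (N - i)\<close>, hence of \<open>J\<close>, which disappears modulo
    \<open>J\<close>.\<close>
  have "?W * J ^ N = (?W * J ^ (N - i)) * J ^ i" using i by (simp add: mult.assoc flip: power_add)
  then have "(?W * J ^ N + ?D) div J ^ i = ?W * J ^ (N - i) + ?D div J ^ i"
    by (simp only:) (rule div_mult_self3, simp)
  moreover have "J ^ (N - i) = J * J ^ (N - i - 1)"
    using i by (subst power_Suc[symmetric]) (simp add: Suc_diff_Suc)
  ultimately have "(?W * J ^ N + ?D) div J ^ i mod J = ?D div J ^ i mod J"
    by (simp add: mult.left_commute[of ?W])
  also have "\<dots> = int (js i)" by (rule digit[OF c i])
  finally show "(\<Sum>i<N. cost I d i (js i)) div J ^ i mod J = int (js i)" unfolding sum_cost .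
qed

definition G' :: "nat \<Rightarrow> nat \<Rightarrow> real" where
  "G' m k = (approx_\<alpha> p \<alpha> I d * \<beta> ^ root_level p I d k + (2 ^ Pr - approx_\<alpha> p \<alpha> I d) * \<beta> ^ m) / 2 ^ Pr"

lemma objective_eq:
  assumes "m \<le> K" "k \<le> Suc K2"
  shows "of_int (objective p \<alpha> I d m k) = G' m k * (2 ^ Pr * real M ^ K2)"
proof -
  let ?a = "approx_\<alpha> p \<alpha> I d"
  let ?t = "root_level p I d k"
  have t: "?t \<le> K2" "m \<le> K2" using root_level_bounds(3)[OF assms(2)] assms(1) caps by auto
  have "(?a * \<beta> ^ ?t + (2 ^ Pr - ?a) * \<beta> ^ m) * real M ^ K2 =
      ?a * (\<beta> ^ ?t * real M ^ K2) + (2 ^ Pr - ?a) * (\<beta> ^ m * real M ^ K2)"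
    by (simp add: algebra_simps)
  also have "\<dots> = of_int (?a * int ((M + 1) ^ ?t * M ^ (K2 - ?t)) + (2 ^ Pr - ?a) * int ((M + 1) ^ m * M ^ (K2 - m)))"
    unfolding grid_integral[OF t(1)] grid_integral[OF t(2)] by simp
  finally have e: "(?a * \<beta> ^ ?t + (2 ^ Pr - ?a) * \<beta> ^ m) * real M ^ K2 =
    of_int (?a * int ((M + 1) ^ ?t * M ^ (K2 - ?t)) + (2 ^ Pr - ?a) * int ((M + 1) ^ m * M ^ (K2 - m)))" .
  show ?thesis unfolding objective_def G'_def e floor_of_int using e by simp
qed

lemma convex_ge_1:
  fixes a x y :: real
  assumes "0 \<le> a" "a \<le> 1" "1 \<le> x" "1 \<le> y"
  shows "1 \<le> a * x + (1 - a) * y"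
  using mult_left_mono[OF assms(3), of a] mult_left_mono[OF assms(4), of "1 - a"] assms by simp

text \<open>Truncating \<alpha> changes the value by at most
  \<open>\<beta> ^ K2 / 2 ^ Pr \<le> 1 / 2 ^ K2 \<le> 1 / R\<close>. As both values are at least 1,
  this additive error is also a relative one.\<close>

lemma G_bounds:
  assumes "m \<le> K" "k \<le> Suc K2"
  shows "1 \<le> G m k" "1 \<le> G' m k" "G m k \<le> (1 + 1 / R) * G' m k" "G' m k \<le> (1 + 1 / R) * G m k"
proof -
  define a where "a = approx_\<alpha> p \<alpha> I d / 2 ^ Pr"
  have a: "\<alpha> - 1 / 2 ^ Pr < a" "a \<le> \<alpha>"
    unfolding a_def approx_\<alpha>_def by (rule floor_mult_power2)+
  have a0: "0 \<le> a" unfolding a_def approx_\<alpha>_def using \<alpha>(1) by (intro divide_nonneg_nonneg) auto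
  define x y where "x = \<beta> ^ root_level p I d k" and "y = \<beta> ^ m"
  have xy: "1 \<le> x" "1 \<le> y" unfolding x_def y_def using base by (intro one_le_power; simp)+
  have "root_level p I d k \<le> K2" "m \<le> K2" using root_level_bounds(3)[OF assms(2)] assms(1) caps by auto
  then have xy2: "x \<le> \<beta> ^ K2" "y \<le> \<beta> ^ K2" unfolding x_def y_def using base by (intro power_increasing; simp)+
  have G': "G' m k = a * x + (1 - a) * y" unfolding G'_def a_def x_def y_def by (simp add: add_divide_distrib diff_divide_distrib left_diff_distrib)
  have G: "G m k = \<alpha> * x + (1 - \<alpha>) * y" by (simp add: G_def x_def y_def)
  show g: "1 \<le> G m k" unfolding G by (intro convex_ge_1 \<alpha> xy)
  show g': "1 \<le> G' m k" unfolding G' using a a0 \<alpha> by (intro convex_ge_1 xy) auto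
  have "\<bar>G m k - G' m k\<bar> = (\<alpha> - a) * \<bar>x - y\<bar>"
  proof -
    have "G m k - G' m k = (\<alpha> - a) * (x - y)" unfolding G G' by (simp add: algebra_simps)
    then show ?thesis using a by (simp add: abs_mult)
  qed
  also have "\<dots> \<le> 1 / 2 ^ Pr * \<beta> ^ K2" using a xy xy2 by (intro mult_mono) auto
  also have "\<dots> \<le> 1 / 2 ^ Pr * 2 ^ K2" using base by (intro mult_left_mono power_mono) auto
  also have "\<dots> = 1 / 2 ^ K2" by (simp add: prec_def mult_2 power_add)
  also have "\<dots> \<le> 1 / R"
  proof (rule divide_left_mono)
    have "R \<le> 2 ^ K2" using caps(2) less_exp[of K2] by linarith
    then show "real R \<le> 2 ^ K2" by (metis of_nat_le_iff of_nat_numeral of_nat_power)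
  qed (use R(1) in auto)
  finally have diff: "\<bar>G m k - G' m k\<bar> \<le> 1 / R" .
  have "1 / R * 1 \<le> 1 / R * G m k" "1 / R * 1 \<le> 1 / R * G' m k"
    using g g' by (intro mult_left_mono; simp)+
  then show "G m k \<le> (1 + 1 / R) * G' m k" "G' m k \<le> (1 + 1 / R) * G m k"
    using diff by (simp_all add: distrib_right)
qed

lemma table_range: "0 \<le> table p I d m N k \<and> table p I d m N k \<le> inf_cost I d"
  unfolding table_def by (rule tab_range[where n = N]) (use inf_cost_pos cost_nonneg in auto)

lemma table_attained:
  assumes "table p I d m N k < inf_cost I d"
  obtains js where "\<And>i. i < N \<Longrightarrow> js i \<le> K" "\<And>i. i < N \<Longrightarrow> admissible I d m i (js i)"
    "S js N = k" "table p I d m N k = (\<Sum>i<N. cost I d i (js i))"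
proof -
  have "\<exists>js. (\<forall>i'<N. js i' < Suc K \<and> admissible I d m i' (js i')) \<and> S js N = k \<and>
      table p I d m N k = (\<Sum>i'<N. cost I d i' (js i'))"
    unfolding table_def
    by (rule tab_attained[where n = N]) (use cost_nonneg assms in \<open>auto simp: table_def\<close>)
  then show ?thesis using that by (auto simp: less_Suc_eq_le)
qed

text \<open>The objective is positive and table entries are nonnegative, so \<open>- 1\<close> is an
  unambiguous mark of failure.\<close>

lemma score_nonneg_iff:
  assumes "m \<le> K" "k \<le> Suc K2"
  shows "0 \<le> score p \<alpha> I d m k \<longleftrightarrow> table p I d m N k < inf_cost I d \<and>
      table p I d m N k div J ^ N \<le> \<lfloor>of_rat (bandwidth I) * \<Lambda>\<rfloor>" (is "_ \<longleftrightarrow> ?C")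
    and "0 \<le> score p \<alpha> I d m k \<Longrightarrow>
      score p \<alpha> I d m k = objective p \<alpha> I d m k * Z + table p I d m N k"
proof -
  have "0 \<le> G' m k * (2 ^ Pr * real M ^ K2)"
    using G_bounds(2)[OF assms] by (intro mult_nonneg_nonneg) auto
  then have "0 \<le> real_of_int (objective p \<alpha> I d m k)" unfolding objective_eq[OF assms] .
  then have o: "0 \<le> objective p \<alpha> I d m k" by simp
  have s: "score p \<alpha> I d m k = (if ?C then objective p \<alpha> I d m k * Z + table p I d m N k else - 1)"
    by (simp add: score_def Let_def)
  have "0 \<le> objective p \<alpha> I d m k * Z + table p I d m N k"
    using o table_range[of m k] inf_cost_pos by (intro add_nonneg_nonneg mult_nonneg_nonneg) auto
  then show "0 \<le> score p \<alpha> I d m k \<longleftrightarrow> ?C" "0 \<le> score p \<alpha> I d m k \<Longrightarrow>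
      score p \<alpha> I d m k = objective p \<alpha> I d m k * Z + table p I d m N k"
    unfolding s by (auto split: if_splits)
qed

lemma score_le_best:
  assumes "m \<le> K" "k \<le> Suc K2"
  shows "score p \<alpha> I d m k \<le> best p \<alpha> I d"
proof -
  have "score p \<alpha> I d m k \<le> Max (insert (- 1) (score p \<alpha> I d m ` {..<K2 + 2}))"
    using assms by (intro Max_ge) auto
  also have "\<dots> \<le> best p \<alpha> I d" unfolding best_def using assms by (intro Max_ge) auto
  finally show ?thesis .
qed

lemma best_attained:
  assumes "0 \<le> best p \<alpha> I d"
  obtains m k where "m \<le> K" "k \<le> Suc K2" "best p \<alpha> I d = score p \<alpha> I d m k"
proof -
  let ?M = "\<lambda>m. Max (insert (- 1) (score p \<alpha> I d m ` {..<K2 + 2}))"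
  have "best p \<alpha> I d \<in> insert (- 1) (?M ` {..<Suc K})" unfolding best_def by (rule Max_in) auto
  then obtain m where m: "m \<le> K" "best p \<alpha> I d = ?M m"
    using assms by (auto simp: less_Suc_eq_le)
  have "?M m \<in> insert (- 1) (score p \<alpha> I d m ` {..<K2 + 2})" by (rule Max_in) auto
  then obtain k where "k \<le> Suc K2" "?M m = score p \<alpha> I d m k"
    using assms m(2) by (auto simp: less_Suc_eq_le)
  then show ?thesis using that m by simp
qed

text \<open>The table entry may stem from another choice than the rounding of \<open>y\<close>. It
  reaches the same state under the same guess \<open>m\<close> at no greater cost, hence with no
  greater weight, the weight being the high part of the cost; so it passes the bandwidth
  test.\<close>

lemma candidate:
  assumes y: "y \<in> feasible I"
  obtains m k where "m \<le> K" "k \<le> Suc K2" "0 \<le> score p \<alpha> I d m k"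
    "(1 - 2 / R) * (4 * ln 2) * F p \<alpha> I y \<le> \<beta> ^ (N + 5) * G m k"
proof -
  obtain js m where js: "\<And>i. i < N \<Longrightarrow> js i \<le> K" "m \<le> K" "\<And>i. i < N \<Longrightarrow> admissible I d m i (js i)"
    "\<And>i. i < N \<Longrightarrow> point I d (Suc i) (js i) \<le> y (Suc i)"
    "(1 - 2 / R) * (4 * ln 2) * F p \<alpha> I y \<le> \<beta> ^ (N + 5) * G m (S js N)"
    using F_upper[OF y] by blast
  have k: "S js N \<le> Suc K2" using state_bounds(3)[of N js] by simp
  have t: "table p I d m N (S js N) \<le> (\<Sum>i<N. cost I d i (js i))"
    unfolding table_def
    by (rule tab_le[where n = N]) (use js state_bounds(3)[of _ js] in \<open>auto simp: less_Suc_eq_le\<close>)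
  then have "table p I d m N (S js N) < inf_cost I d" using sum_cost_less[of js] js(1) by simp
  moreover have "table p I d m N (S js N) div J ^ N \<le> (\<Sum>i<N. weight I d i (js i))"
    using zdiv_mono1[OF t, of "J ^ N"] sum_cost_decode(1)[of js] js(1) by simp
  moreover have "(\<Sum>i<N. weight I d i (js i)) \<le> \<lfloor>of_rat (bandwidth I) * \<Lambda>\<rfloor>"
  proof -
    have "real_of_int (\<Sum>i<N. weight I d i (js i)) = (\<Sum>i<N. point I d (Suc i) (js i)) * \<Lambda>"
      using weight_eq js(1) by (simp add: sum_distrib_right)
    also have "\<dots> \<le> (\<Sum>i<N. y (Suc i)) * \<Lambda>"
      using js(4) scale_pos by (intro mult_right_mono sum_mono) auto
    also have "\<dots> \<le> of_rat (bandwidth I) * \<Lambda>"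
      using y scale_pos by (intro mult_right_mono) (auto simp: feasible_def sum.atLeast1_atMost_eq)
    finally show ?thesis by (simp only: le_floor_iff)
  qed
  ultimately have "0 \<le> score p \<alpha> I d m (S js N)" using score_nonneg_iff(1)[OF js(2) k] by linarith
  then show ?thesis using that js(2,5) k by blast
qed

text \<open>Some feasible point is needed twice: for a candidate with nonnegative score, and for the
  supremum in \<open>OPT\<close>.\<close>

lemma lower_feasible: "(\<lambda>i. of_rat (lower I i)) \<in> feasible I"
proof -
  have "(\<Sum>i\<in>{1..N}. lo i) = of_rat (\<Sum>i\<in>{1..N}. lower I i)" by (simp add: of_rat_sum)
  also have "\<dots> \<le> of_rat (bandwidth I)" using I by (simp add: feo_instance_def of_rat_less_eq)
  finally show ?thesis
    unfolding feasible_def using user(3,4,6) by (auto intro: less_imp_le)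
qed

text \<open>Decodes \<open>best\<close>: the returned indices form an admissible run within the
  bandwidth, and no candidate has a larger \<open>G'\<close>. Optimality is stated for
  \<open>G'\<close> because the program knows only the truncated \<alpha>.\<close>

lemma choice_cases:
  obtains js m k where "m \<le> K" "k \<le> Suc K2" "\<And>i. i < N \<Longrightarrow> js i \<le> K"
    "\<And>i. i < N \<Longrightarrow> admissible I d m i (js i)" "S js N = k"
    "(\<Sum>i<N. weight I d i (js i)) \<le> \<lfloor>of_rat (bandwidth I) * \<Lambda>\<rfloor>"
    "\<And>i. i < N \<Longrightarrow> choice p \<alpha> I d i = js i"
    "\<And>m' k'. m' \<le> K \<Longrightarrow> k' \<le> Suc K2 \<Longrightarrow> 0 \<le> score p \<alpha> I d m' k' \<Longrightarrow> G' m' k' \<le> G' m k"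
proof -
  obtain m0 k0 where 0: "m0 \<le> K" "k0 \<le> Suc K2" "0 \<le> score p \<alpha> I d m0 k0"
    using candidate[OF lower_feasible] by blast
  then have "0 \<le> best p \<alpha> I d" using score_le_best[OF 0(1,2)] by linarith
  then obtain m k where mk: "m \<le> K" "k \<le> Suc K2" "best p \<alpha> I d = score p \<alpha> I d m k"
    using best_attained by blast
  then have s: "0 \<le> score p \<alpha> I d m k" using \<open>0 \<le> best p \<alpha> I d\<close> by simp
  note c = score_nonneg_iff(1)[OF mk(1,2), THEN iffD1, OF s]
  note e = score_nonneg_iff(2)[OF mk(1,2) s]
  obtain js where js: "\<And>i. i < N \<Longrightarrow> js i \<le> K" "\<And>i. i < N \<Longrightarrow> admissible I d m i (js i)"
    "S js N = k" "table p I d m N k = (\<Sum>i<N. cost I d i (js i))"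
    using table_attained[OF conjunct1[OF c]] by blast
  have "best p \<alpha> I d mod Z = table p I d m N k"
    unfolding mk(3) e using table_range[of m k] by simp
  then have ch: "choice p \<alpha> I d i = js i" if "i < N" for i
    unfolding choice_def js(4) using sum_cost_decode(2)[of js i] js(1) that by simp
  have w: "(\<Sum>i<N. weight I d i (js i)) \<le> \<lfloor>of_rat (bandwidth I) * \<Lambda>\<rfloor>"
    using c sum_cost_decode(1)[of js] js(1,4) by simp
  have "G' m' k' \<le> G' m k" if *: "m' \<le> K" "k' \<le> Suc K2" "0 \<le> score p \<alpha> I d m' k'" for m' k'
  proof -
    \<comment> \<open>Table entries lie between 0 and \<open>inf_cost\<close>, hence below
      \<open>Z\<close>: scores are compared lexicographically and the objective decides
      first.\<close>
    have "objective p \<alpha> I d m' k' * Z + table p I d m' N k' \<le> objective p \<alpha> I d m k * Z + table p I d m N k"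
      using score_le_best[OF *(1,2)] unfolding mk(3) e score_nonneg_iff(2)[OF *] .
    then have "objective p \<alpha> I d m' k' * Z < (objective p \<alpha> I d m k + 1) * Z"
      using table_range[of m k] table_range[of m' k'] by (simp add: distrib_right)
    then have "objective p \<alpha> I d m' k' \<le> objective p \<alpha> I d m k"
      using inf_cost_pos by (simp add: mult_less_cancel_right)
    then have "real_of_int (objective p \<alpha> I d m' k') \<le> objective p \<alpha> I d m k" by simp
    then show ?thesis
      unfolding objective_eq[OF *(1,2)] objective_eq[OF mk(1,2)] using M(3) by (simp add: mult_le_cancel_right)
  qed
  then show ?thesis using that[OF mk(1,2) js(1,2,3) w ch] by blast
qed

definition x_sol :: "nat \<Rightarrow> real" where
  "x_sol i = point I d i (choice p \<alpha> I d (i - 1))"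

lemma one_minus_mult_ge:
  fixes a b x y :: real
  assumes "1 - a \<le> x" "1 - b \<le> y" "0 \<le> a" "0 \<le> b" "a \<le> 1" "b \<le> 1"
  shows "1 - (a + b) \<le> x * y"
proof -
  have "(1 - a) * (1 - b) \<le> x * y" using assms by (intro mult_mono) auto
  moreover have "1 - (a + b) \<le> (1 - a) * (1 - b)" using assms by (simp add: algebra_simps)
  ultimately show ?thesis by linarith
qed

lemma x_sol_feasible: "x_sol \<in> feasible I"
proof -
  obtain js m k where js: "\<And>i. i < N \<Longrightarrow> js i \<le> K" "\<And>i. i < N \<Longrightarrow> admissible I d m i (js i)"
    "(\<Sum>i<N. weight I d i (js i)) \<le> \<lfloor>of_rat (bandwidth I) * \<Lambda>\<rfloor>"
    "\<And>i. i < N \<Longrightarrow> choice p \<alpha> I d i = js i"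
    by (rule choice_cases) (rule that; assumption)
  have "(\<Sum>i\<in>{1..N}. x_sol i) * \<Lambda> = (\<Sum>i<N. point I d (Suc i) (js i) * \<Lambda>)"
    using js(4) by (simp add: x_sol_def sum.atLeast1_atMost_eq sum_distrib_right)
  also have "\<dots> = real_of_int (\<Sum>i<N. weight I d i (js i))" using weight_eq js(1) by simp
  also have "\<dots> \<le> of_rat (bandwidth I) * \<Lambda>" using js(3) by (simp only: le_floor_iff)
  finally have "(\<Sum>i\<in>{1..N}. x_sol i) \<le> of_rat (bandwidth I)" using scale_pos by simp
  moreover have "0 \<le> x_sol i \<and> lo i \<le> x_sol i \<and> x_sol i \<le> up i" if i: "i \<in> {1..N}" for i
  proof -
    obtain l where l: "i = Suc l" "l < N" using i by (cases i) auto
    then have "x_sol i = point I d i (js l)" using js(4) by (simp add: x_sol_def)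
    then show ?thesis using js(2)[OF l(2)] point_ge[OF i, of "js l"] less_imp_le[OF point_pos[OF l(2)]] l(1)
      by (simp add: admissible_def)
  qed
  ultimately show ?thesis by (simp add: feasible_def)
qed

text \<open>The output format: numerators are weights, and all users share the denominator
  \<open>scale\<close>.\<close>

lemma x_sol_weight:
  assumes "i \<in> {1..N}"
  shows "x_sol i = of_int (weight I d (i - 1) (choice p \<alpha> I d (i - 1))) / of_int \<Lambda>"
proof -
  obtain js where js: "\<And>i. i < N \<Longrightarrow> js i \<le> K" "\<And>i. i < N \<Longrightarrow> choice p \<alpha> I d i = js i"
    by (rule choice_cases) (rule that; assumption)
  obtain l where l: "i = Suc l" "l < N" using assms by (cases i) auto
  show ?thesis using weight_eq[OF l(2) js(1)[OF l(2)]] js(2)[OF l(2)] scale_pos by (simp add: x_sol_def l(1))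
qed

text \<open>Passing from \<open>y\<close> to the candidate costs \<open>\<beta> ^ (N + 5)\<close>
  and \<open>1 - 2 / R\<close>, exchanging \<open>G\<close> and \<open>G'\<close> twice costs
  \<open>(1 + 1 / R) ^ 2\<close>, and returning to \<open>F\<close> costs
  \<open>\<beta> * (1 + 1 / R)\<close>. The normalization \<open>4 * ln 2\<close> occurs on both
  sides and cancels.\<close>

lemma x_sol_approx:
  assumes y: "y \<in> feasible I"
  shows "0 \<le> F p \<alpha> I x_sol" and "(1 - 1 / d) * F p \<alpha> I y \<le> F p \<alpha> I x_sol"
proof -
  obtain js m k where js: "m \<le> K" "k \<le> Suc K2" "\<And>i. i < N \<Longrightarrow> admissible I d m i (js i)" "S js N = k"
    "\<And>i. i < N \<Longrightarrow> choice p \<alpha> I d i = js i"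
    "\<And>m' k'. m' \<le> K \<Longrightarrow> k' \<le> Suc K2 \<Longrightarrow> 0 \<le> score p \<alpha> I d m' k' \<Longrightarrow> G' m' k' \<le> G' m k"
    by (rule choice_cases) (rule that; assumption)
  define q where "q = 1 / real R"
  have R0: "12 \<le> real R" using R(1) by simp
  have q: "0 < q" "q \<le> 1 / 12" unfolding q_def using R0 by (auto simp: field_simps)
  define L where "L = 4 * ln (2::real)"
  have L: "0 < L" by (simp add: L_def)
  have low: "G m k \<le> \<beta> * ((1 + q) * L) * F p \<alpha> I x_sol"
    using F_lower[of m js x_sol] js(3,4,5) by (simp add: x_sol_def q_def L_def)
  have "0 < \<beta> * ((1 + q) * L)" using base q L by (intro mult_pos_pos) auto
  moreover have "0 < \<beta> * ((1 + q) * L) * F p \<alpha> I x_sol" using low G_bounds(1)[OF js(1,2)] by linarith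
  ultimately have pos: "0 < F p \<alpha> I x_sol" by (rule zero_less_mult_pos[rotated])
  then show "0 \<le> F p \<alpha> I x_sol" by simp
  obtain m' k' where c: "m' \<le> K" "k' \<le> Suc K2" "0 \<le> score p \<alpha> I d m' k'"
    "(1 - 2 * q) * L * F p \<alpha> I y \<le> \<beta> ^ (N + 5) * G m' k'"
    using candidate[OF y] unfolding L_def q_def by (auto simp: mult.assoc)
  have "G m' k' \<le> (1 + q) * G' m' k'" using G_bounds(3)[OF c(1,2)] by (simp add: q_def)
  also have "\<dots> \<le> (1 + q) * G' m k" using js(6)[OF c(1-3)] q by (intro mult_left_mono) auto
  also have "\<dots> \<le> (1 + q) * ((1 + q) * G m k)"
    using G_bounds(4)[OF js(1,2)] q by (intro mult_left_mono) (auto simp: q_def)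
  also have "\<dots> \<le> (1 + q) * ((1 + q) * (\<beta> * ((1 + q) * L) * F p \<alpha> I x_sol))"
    using low q by (intro mult_left_mono) auto
  finally have "\<beta> ^ (N + 5) * G m' k' \<le>
      \<beta> ^ (N + 5) * ((1 + q) * ((1 + q) * (\<beta> * ((1 + q) * L) * F p \<alpha> I x_sol)))"
    using base by (intro mult_left_mono) auto
  also have "\<dots> = \<beta> ^ (N + 6) * (1 + q) ^ 3 * F p \<alpha> I x_sol * L"
    by (simp add: power_add[of \<beta> N] eval_nat_numeral mult_ac)
  finally have "((1 - 2 * q) * F p \<alpha> I y) * L \<le> (\<beta> ^ (N + 6) * (1 + q) ^ 3 * F p \<alpha> I x_sol) * L"
    using c(4) by (simp add: mult_ac)
  then have main: "(1 - 2 * q) * F p \<alpha> I y \<le> \<beta> ^ (N + 6) * (1 + q) ^ 3 * F p \<alpha> I x_sol"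
    using L by simp
  show "(1 - 1 / d) * F p \<alpha> I y \<le> F p \<alpha> I x_sol"
  proof (cases "0 \<le> F p \<alpha> I y")
    case False
    have "1 / real d \<le> 1" using d by simp
    then have "(1 - 1 / d) * F p \<alpha> I y \<le> 0" using False by (intro mult_nonneg_nonpos) auto
    then show ?thesis using pos by simp
  next
    case True
    \<comment> \<open>Instead of dividing by the loss factors, the inequality is multiplied by
      \<open>b\<close> and \<open>(1 - q) ^ 3\<close>, which undo them because
      \<open>\<beta> * (1 - 1 / M) \<le> 1\<close> and
      \<open>(1 + q) * (1 - q) \<le> 1\<close>.\<close>
    define b where "b = (1 - 1 / real M) ^ (N + 6)"
    have M12: "1 \<le> real M" using M(3) by simp
    have "real (N + 6) * (1 / M) \<le> 7 * q"
    proof -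
      have "real (N + 6) \<le> 7 * real R" using N R(2) by simp
      then have "real (N + 6) * (1 / M) \<le> (7 * real R) * (1 / M)" by (intro mult_right_mono) auto
      also have "\<dots> = 7 * q" using R0 by (simp add: M(1) q_def power2_eq_square)
      finally show ?thesis .
    qed
    moreover have "1 + real (N + 6) * (- 1 / M) \<le> (1 + (- 1 / M)) ^ (N + 6)"
      using M12 by (intro Bernoulli_inequality) (simp add: field_simps)
    ultimately have b: "1 - 7 * q \<le> b" by (simp add: b_def)
    have b0: "0 \<le> b" unfolding b_def using M12 by (intro zero_le_power) (simp add: field_simps)
    have q1: "1 - 3 * q \<le> (1 - q) ^ 3"
      using Bernoulli_inequality[of "- q" 3] q by simp
    \<comment> \<open>The losses add up to \<open>12 * q = 1 / (d * N)\<close>, which is at most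
      \<open>1 / d\<close>.\<close>
    have prod: "1 - (2 * q + (3 * q + 7 * q)) \<le> (1 - 2 * q) * ((1 - q) ^ 3 * b)"
      by (intro one_minus_mult_ge q1 b) (use q in auto)
    have "d * 1 \<le> d * N" using N by (intro mult_left_mono) auto
    then have "real d \<le> real (d * N)" by (simp only: of_nat_le_iff mult_1_right)
    then have "1 / (d * N) \<le> 1 / d" using d N by (intro divide_left_mono) auto
    moreover have "12 * q = 1 / (d * N)"
      unfolding q_def R(3)[symmetric] by simp
    ultimately have "1 - 1 / d \<le> (1 - 2 * q) * ((1 - q) ^ 3 * b)" using prod by simp
    then have "(1 - 1 / d) * F p \<alpha> I y \<le> (1 - 2 * q) * ((1 - q) ^ 3 * b) * F p \<alpha> I y"
      using True by (intro mult_right_mono) auto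
    also have "\<dots> = ((1 - 2 * q) * F p \<alpha> I y) * ((1 - q) ^ 3 * b)" by simp
    also have "\<dots> \<le> (\<beta> ^ (N + 6) * (1 + q) ^ 3 * F p \<alpha> I x_sol) * ((1 - q) ^ 3 * b)"
      using main q b0 by (intro mult_right_mono) auto
    also have "\<dots> = ((\<beta> * (1 - 1 / M)) ^ (N + 6) * ((1 + q) * (1 - q)) ^ 3) * F p \<alpha> I x_sol"
      by (simp only: b_def power_mult_distrib mult_ac)
    also have "\<dots> \<le> (1 * 1) * F p \<alpha> I x_sol"
    proof (intro mult_right_mono mult_mono power_le_one)
      show "\<beta> * (1 - 1 / M) \<le> 1" by (simp add: base_def algebra_simps)
      show "0 \<le> \<beta> * (1 - 1 / M)" using base M12 by (intro mult_nonneg_nonneg) auto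
      show "(1 + q) * (1 - q) \<le> 1" by (simp add: algebra_simps)
    qed (use q pos in auto)
    finally show ?thesis by simp
  qed
qed

end

section \<open>Reading an instance\<close>

text \<open>The header takes 11 integers: the number of users and five fractions. User blocks vary
  in length with the dimensions of the gain vectors, so a program can find a block only by walking
  through the preceding ones.\<close>

definition off :: "feo \<Rightarrow> nat \<Rightarrow> nat" where
  "off I i = 11 + (\<Sum>l<i. length (enc_user I (Suc l)))"

definition offR :: "feo \<Rightarrow> nat \<Rightarrow> nat" where
  "offR I i = off I i + (1 + 4 * length (gainC I (Suc i)))"

definition offP :: "feo \<Rightarrow> nat \<Rightarrow> nat" where
  "offP I i = offR I i + (1 + 4 * length (gainR I (Suc i)))"

lemma length_enc_vec: "length (enc_vec h) = 1 + 4 * length h"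
proof -
  have "length (concat (map (\<lambda>(a, b). enc_rat a @ enc_rat b) h)) = 4 * length h"
    by (induction h) (auto simp: enc_rat_def)
  then show ?thesis by (simp add: enc_vec_def)
qed

lemma length_enc_user: "length (enc_user I i) = length (enc_vec (gainC I i)) + length (enc_vec (gainR I i)) + 8"
  by (simp add: enc_user_def enc_rat_def)

lemma off_Suc: "off I (Suc i) = offP I i + 8"
  by (simp add: off_def offP_def offR_def length_enc_user length_enc_vec)

lemma enc_vec_nth_0: "enc_vec h ! 0 = int (length h)"
  by (simp add: enc_vec_def)

lemma enc_vec_nth:
  assumes "e < length h" "k < 4"
  shows "enc_vec h ! (1 + 4 * e + k) = (enc_rat (fst (h ! e)) @ enc_rat (snd (h ! e))) ! k"
proof -
  have "concat (map (\<lambda>(a, b). enc_rat a @ enc_rat b) h) ! (4 * e + k) =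
      (enc_rat (fst (h ! e)) @ enc_rat (snd (h ! e))) ! k"
    using assms
  proof (induction h arbitrary: e)
    case (Cons ab h)
    show ?case
    proof (cases e)
      case 0
      then show ?thesis using Cons.prems by (auto simp: nth_append enc_rat_def split: prod.split)
    next
      case (Suc e')
      then show ?thesis using Cons.IH[of e'] Cons.prems
        by (cases ab) (simp add: nth_append enc_rat_def)
    qed
  qed simp
  then show ?thesis by (simp add: enc_vec_def)
qed

definition header :: "feo \<Rightarrow> int list" where
  "header I = int (users I) # enc_rat (bandwidth I) @ enc_rat (kappa I) @ enc_rat (boltzmann I) @
     enc_rat (temp I) @ enc_rat (pri I)"

lemma encode_split: "encode I = header I @ concat (map (\<lambda>l. enc_user I (Suc l)) [0..<users I])"
proof -
  have "[1..<Suc (users I)] = map Suc [0..<users I]" by (simp add: map_Suc_upt)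
  then show ?thesis by (simp add: encode_def header_def comp_def)
qed

lemma length_header: "length (header I) = 11"
  by (simp add: header_def enc_rat_def)

lemma arr_append:
  "k < length xs \<Longrightarrow> arr (xs @ ys) (int k) = xs ! k"
  "arr (xs @ ys) (int (length xs + k)) = arr ys (int k)"
  by (auto simp: arr_def nth_append nat_int_add)

lemma arr_header: "k < 11 \<Longrightarrow> arr (encode I) (int k) = header I ! k"
  unfolding encode_split by (rule arr_append(1)) (simp add: length_header)

lemma arr_user:
  assumes "i < users I" "k < length (enc_user I (Suc i))"
  shows "arr (encode I) (int (off I i + k)) = enc_user I (Suc i) ! k"
proof -
  let ?f = "\<lambda>l. enc_user I (Suc l)"
  have "[0..<users I] = [0..<i] @ i # [Suc i..<users I]"
    using assms(1) upt_add_eq_append[of 0 i "users I - i"] upt_conv_Cons[of i "users I"] by simp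
  then have "encode I = (header I @ concat (map ?f [0..<i])) @ (?f i @ concat (map ?f [Suc i..<users I]))"
    unfolding encode_split by simp
  moreover have "length (header I @ concat (map ?f [0..<i])) = off I i"
    by (simp add: length_header off_def length_concat comp_def interv_sum_list_conv_sum_set_nat atLeast0LessThan)
  ultimately show ?thesis
    using arr_append(2)[of "header I @ concat (map ?f [0..<i])" "?f i @ concat (map ?f [Suc i..<users I])" k]
      arr_append(1)[OF assms(2)] by simp
qed

lemma length_encode: "length (encode I) = off I (users I)"
  by (simp add: encode_split length_header off_def length_concat comp_def interv_sum_list_conv_sum_set_nat atLeast0LessThan)

lemma arr_user_vecC:
  assumes "i < users I" "k < length (enc_vec (gainC I (Suc i)))"
  shows "arr (encode I) (int (off I i + k)) = enc_vec (gainC I (Suc i)) ! k"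
  using assms arr_user[of i I k] by (simp add: enc_user_def nth_append)

lemma arr_user_vecR:
  assumes "i < users I" "k < length (enc_vec (gainR I (Suc i)))"
  shows "arr (encode I) (int (offR I i + k)) = enc_vec (gainR I (Suc i)) ! k"
proof -
  have "offR I i + k = off I i + (length (enc_vec (gainC I (Suc i))) + k)"
    by (simp add: offR_def length_enc_vec)
  then show ?thesis
    using assms arr_user[of i I "length (enc_vec (gainC I (Suc i))) + k"]
    by (simp add: enc_user_def nth_append add_ac)
qed

lemma arr_user_rest:
  assumes "i < users I" "k < 8"
  shows "arr (encode I) (int (offP I i + k)) = (enc_rat (powerC I (Suc i)) @ enc_rat (powerR I (Suc i)) @
    enc_rat (lower I (Suc i)) @ enc_rat (upper I (Suc i))) ! k"
proof -
  let ?n = "length (enc_vec (gainC I (Suc i)) @ enc_vec (gainR I (Suc i)))"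
  have "offP I i + k = off I i + (?n + k)" by (simp add: offP_def offR_def length_enc_vec)
  moreover have "enc_user I (Suc i) ! (?n + k) = (enc_rat (powerC I (Suc i)) @ enc_rat (powerR I (Suc i)) @
    enc_rat (lower I (Suc i)) @ enc_rat (upper I (Suc i))) ! k"
    unfolding enc_user_def append_assoc[symmetric, of "enc_vec (gainC I (Suc i))"] nth_append_length_plus ..
  ultimately show ?thesis
    using assms arr_user[of i I "?n + k"] by (simp add: length_enc_user add_ac)
qed

lemma off_mono: "i \<le> j \<Longrightarrow> off I i \<le> off I j"
  unfolding off_def by (auto intro!: sum_mono2)

lemma length_le_bits: "length zs \<le> (\<Sum>z\<leftarrow>zs. bits z)"
proof -
  have "1 \<le> bits z" for z by (simp add: bits_def)
  then have "sum_list (map (\<lambda>_. 1) zs) \<le> (\<Sum>z\<leftarrow>zs. bits z)" by (rule sum_list_mono)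
  then show ?thesis by (simp add: sum_list_triv)
qed

section \<open>Computability of the scheme\<close>

locale reals =
  fixes p \<alpha> :: real
  assumes p: "1 \<le> p" and \<alpha>: "0 \<le> \<alpha>" "\<alpha> \<le> 1"
begin

abbreviation "c \<equiv> fixed_reals p \<alpha>"

text \<open>Instance and accuracy are functions of the point, so the same lemmas apply inside nested
  loops after composition with \<open>fst\<close>. Requiring \<open>computable_nat\<close> of
  \<open>d\<close> permits it in loop lengths and exponents.\<close>

definition fctx :: "'q ctx \<Rightarrow> ('q \<Rightarrow> feo) \<Rightarrow> ('q \<Rightarrow> nat) \<Rightarrow> bool" where
  "fctx \<Gamma> I d \<longleftrightarrow> (\<forall>q\<in>pts \<Gamma>. feo_instance (I q) \<and> 1 \<le> d q \<and> inp \<Gamma> q = encode (I q)) \<and> computable_nat c \<Gamma> d"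

lemma fctx_ext: "fctx \<Gamma> I d \<Longrightarrow> fctx (ext \<Gamma> v S) (\<lambda>z. I (fst z)) (\<lambda>z. d (fst z))"
  unfolding fctx_def using computable_nat_ext by auto

lemma fctx_scheme: "fctx \<Gamma> I d \<Longrightarrow> q \<in> pts \<Gamma> \<Longrightarrow> scheme p \<alpha> (I q) (d q)"
  unfolding fctx_def scheme_def using p \<alpha> by simp

lemma fctx_d: "fctx \<Gamma> I d \<Longrightarrow> computable_nat c \<Gamma> d"
  unfolding fctx_def by blast

lemma fctx_inp: "fctx \<Gamma> I d \<Longrightarrow> computable c \<Gamma> h \<Longrightarrow> computable c \<Gamma> (\<lambda>q. arr (encode (I q)) (h q))"
  by (rule computable_cong[OF computable_input]) (auto simp: fctx_def)

lemma pb_length: "fctx \<Gamma> I d \<Longrightarrow> pb \<Gamma> (\<lambda>q. length (encode (I q)))"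
proof (rule pb_mono[OF pb_size])
  fix q assume "fctx \<Gamma> I d" "q \<in> pts \<Gamma>"
  then show "length (encode (I q)) \<le> sz \<Gamma> q"
    using length_le_bits[of "encode (I q)"] by (simp add: fctx_def sz_def)
qed

lemma computable_natI:
  assumes "computable c \<Gamma> h" "pb \<Gamma> b" "\<And>q. q \<in> pts \<Gamma> \<Longrightarrow> h q = int (n q)" "\<And>q. q \<in> pts \<Gamma> \<Longrightarrow> n q \<le> b q"
  shows "computable_nat c \<Gamma> n"
  unfolding computable_nat_def using computable_cong[OF assms(1,3)] pb_mono[OF assms(2,4)] by blast

context
  fixes \<Gamma> :: "'q ctx" and I d
  assumes F: "fctx \<Gamma> I d"
begin

text \<open>The number of users is polynomial in value, since every user contributes a nonempty
  block to the input; thus it may bound loops.\<close>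

lemma computable_users: "computable_nat c \<Gamma> (\<lambda>q. users (I q))"
proof (rule computable_natI[OF fctx_inp[OF F computable_const[of _ _ 0]] pb_length[OF F]])
  show "arr (encode (I q)) 0 = int (users (I q))" for q
    using arr_header[of 0 "I q"] by (simp add: header_def)
  have "n \<le> (\<Sum>l<n. length (enc_user (I q) (Suc l)))" for n q
    by (induction n) (auto simp: length_enc_user)
  then show "users (I q) \<le> length (encode (I q))" for q
    unfolding length_encode off_def by (simp add: trans_le_add2)
qed

lemma computable_encoded_rat:
  assumes "computable c \<Gamma> ps" "\<And>q. q \<in> pts \<Gamma> \<Longrightarrow> arr (encode (I q)) (ps q) = enc_rat (r q) ! 0"
    "\<And>q. q \<in> pts \<Gamma> \<Longrightarrow> arr (encode (I q)) (ps q + 1) = enc_rat (r q) ! 1"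
  shows "computable_rat c \<Gamma> (\<lambda>q. of_rat (r q))"
proof (rule computable_ratI)
  show "computable c \<Gamma> (\<lambda>q. arr (encode (I q)) (ps q))" "computable c \<Gamma> (\<lambda>q. arr (encode (I q)) (ps q + 1))"
    by (intro fctx_inp[OF F] computable_add computable_const assms)+
  fix q assume q: "q \<in> pts \<Gamma>"
  obtain a b where ab: "quotient_of (r q) = (a, b)" by force
  then have e: "arr (encode (I q)) (ps q) = a" "arr (encode (I q)) (ps q + 1) = b"
    using assms(2,3)[OF q] by (auto simp: enc_rat_def)
  show "0 < arr (encode (I q)) (ps q + 1)" unfolding e using quotient_of_denom_pos[OF ab] .
  show "of_rat (r q) = of_int (arr (encode (I q)) (ps q)) / of_int (arr (encode (I q)) (ps q + 1))"
    unfolding e using quotient_of_div[OF ab] by (simp add: of_rat_divide)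
qed

lemma computable_header:
  "computable_rat c \<Gamma> (\<lambda>q. of_rat (bandwidth (I q)))"
  "computable_rat c \<Gamma> (\<lambda>q. of_rat (kappa (I q)))"
  "computable_rat c \<Gamma> (\<lambda>q. of_rat (boltzmann (I q)))"
  "computable_rat c \<Gamma> (\<lambda>q. of_rat (temp (I q)))"
  "computable_rat c \<Gamma> (\<lambda>q. of_rat (pri (I q)))"
  by (rule computable_encoded_rat[OF computable_const[of _ _ "int 1"]],
      use arr_header[of 1] arr_header[of 2] in \<open>simp_all add: header_def enc_rat_def numeral_2_eq_2\<close>)
    (rule computable_encoded_rat[OF computable_const[of _ _ "int 3"]],
      use arr_header[of 3] arr_header[of 4] in \<open>simp_all add: header_def enc_rat_def eval_nat_numeral\<close>,
     rule computable_encoded_rat[OF computable_const[of _ _ "int 5"]],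
      use arr_header[of 5] arr_header[of 6] in \<open>simp_all add: header_def enc_rat_def eval_nat_numeral\<close>,
     rule computable_encoded_rat[OF computable_const[of _ _ "int 7"]],
      use arr_header[of 7] arr_header[of 8] in \<open>simp_all add: header_def enc_rat_def eval_nat_numeral\<close>,
     rule computable_encoded_rat[OF computable_const[of _ _ "int 9"]],
      use arr_header[of 9] arr_header[of 10] in \<open>simp_all add: header_def enc_rat_def eval_nat_numeral\<close>)

end

lemma computable_off:
  assumes F: "fctx \<Gamma> I d" and i: "computable_nat c \<Gamma> i" "\<And>q. q \<in> pts \<Gamma> \<Longrightarrow> i q \<le> users (I q)"
  shows "computable_nat c \<Gamma> (\<lambda>q. off (I q) (i q))"
proof -
  let ?A = "\<lambda>q k. int (off (I q) k)"
  let ?I = "\<lambda>z. encode (I (fst (fst z)))"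
  \<comment> \<open>From the start \<open>snd z\<close> of a block, \<open>?r\<close> is the
    position of the second vector: a vector takes its dimension and four integers per entry. The
    final 8 in \<open>?h\<close> skips the four fractions that close the block.\<close>
  let ?r = "\<lambda>z. snd z + 1 + 4 * arr (?I z) (snd z)"
  let ?h = "\<lambda>z. ?r z + 1 + 4 * arr (?I z) (?r z) + 8"
  have len: "off (I q) k \<le> length (encode (I q))" if "q \<in> pts \<Gamma>" "k \<le> i q" for q k
    unfolding length_encode using that i(2)[of q] by (intro off_mono) simp
  have "computable c \<Gamma> (\<lambda>q. ?A q (i q))"
  proof (rule computable_iter[where A = ?A and h = ?h])
    have acc: "computable c (iter \<Gamma> i ?A) snd"
    proof (rule computable_acc[OF pb_length[OF F]])
      fix q k assume "q \<in> pts \<Gamma>" "k < i q"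
      then show "\<bar>?A q k\<bar> \<le> 2 ^ length (encode (I q))"
        using abs_le_power_mono[OF int_le_power len[of q k]] by simp
    qed
    have F': "fctx (iter \<Gamma> i ?A) (\<lambda>z. I (fst (fst z))) (\<lambda>z. d (fst (fst z)))"
      unfolding iter_def loop_def by (rule fctx_ext[OF fctx_ext[OF F]])
    have acc': "computable c (iter \<Gamma> i ?A) (\<lambda>z. snd z)" using acc by simp
    show "computable c (iter \<Gamma> i ?A) ?h"
      by (intro computable_add computable_mult computable_const fctx_inp[OF F'] acc')
    fix q k assume q: "q \<in> pts \<Gamma>" "k < i q"
    then have k: "k < users (I q)" using i(2)[of q] by simp
    have C: "arr (encode (I q)) (int (off (I q) k)) = int (length (gainC (I q) (Suc k)))"
      using arr_user_vecC[OF k, of 0] by (simp add: length_enc_vec enc_vec_nth_0)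
    have R: "arr (encode (I q)) (int (offR (I q) k)) = int (length (gainR (I q) (Suc k)))"
      using arr_user_vecR[OF k, of 0] by (simp add: length_enc_vec enc_vec_nth_0)
    have r: "int (off (I q) k) + 1 + 4 * int (length (gainC (I q) (Suc k))) = int (offR (I q) k)"
      by (simp add: offR_def)
    show "?A q (Suc k) = ?h ((q, k), ?A q k)"
      by (simp add: C r R) (simp add: off_Suc offP_def)
  qed (use i computable_const in \<open>simp_all add: off_def\<close>)
  then show ?thesis
    by (rule computable_natI[OF _ pb_length[OF F]]) (use len in auto)
qed

context
  fixes \<Gamma> :: "'q ctx" and I d i
  assumes F: "fctx \<Gamma> I d" and i: "computable_nat c \<Gamma> i" "\<And>q. q \<in> pts \<Gamma> \<Longrightarrow> i q < users (I q)"
begin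

lemma off_le_length: "q \<in> pts \<Gamma> \<Longrightarrow> offP (I q) (i q) + 8 \<le> length (encode (I q))"
  using i(2)[of q] off_mono[of "Suc (i q)" "users (I q)" "I q"] by (simp add: length_encode off_Suc)

lemma computable_off': "computable_nat c \<Gamma> (\<lambda>q. off (I q) (i q))"
  by (rule computable_off[OF F i(1)]) (use i(2) in \<open>auto intro: less_imp_le\<close>)

lemma computable_lengthC: "computable_nat c \<Gamma> (\<lambda>q. length (gainC (I q) (Suc (i q))))"
proof (rule computable_natI[OF fctx_inp[OF F computable_int[OF computable_off']] pb_length[OF F]])
  fix q assume q: "q \<in> pts \<Gamma>"
  show "arr (encode (I q)) (int (off (I q) (i q))) = int (length (gainC (I q) (Suc (i q))))"
    using arr_user_vecC[OF i(2)[OF q], of 0] by (simp add: length_enc_vec enc_vec_nth_0)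
  show "length (gainC (I q) (Suc (i q))) \<le> length (encode (I q))"
    using off_le_length[OF q] by (simp add: offP_def offR_def)
qed

lemma computable_offR: "computable_nat c \<Gamma> (\<lambda>q. offR (I q) (i q))"
  unfolding offR_def
  by (intro computable_nat_add computable_nat_mult computable_nat_const computable_off' computable_lengthC)

lemma computable_lengthR: "computable_nat c \<Gamma> (\<lambda>q. length (gainR (I q) (Suc (i q))))"
proof (rule computable_natI[OF fctx_inp[OF F computable_int[OF computable_offR]] pb_length[OF F]])
  fix q assume q: "q \<in> pts \<Gamma>"
  show "arr (encode (I q)) (int (offR (I q) (i q))) = int (length (gainR (I q) (Suc (i q))))"
    using arr_user_vecR[OF i(2)[OF q], of 0] by (simp add: length_enc_vec enc_vec_nth_0)
  show "length (gainR (I q) (Suc (i q))) \<le> length (encode (I q))"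
    using off_le_length[OF q] by (simp add: offP_def)
qed

lemma computable_offP: "computable_nat c \<Gamma> (\<lambda>q. offP (I q) (i q))"
  unfolding offP_def
  by (intro computable_nat_add computable_nat_mult computable_nat_const computable_offR computable_lengthR)

lemma computable_user_rat:
  assumes k: "k \<in> {0, 2, 4, 6}"
    and r: "\<And>q. q \<in> pts \<Gamma> \<Longrightarrow> (enc_rat (powerC (I q) (Suc (i q))) @ enc_rat (powerR (I q) (Suc (i q))) @
      enc_rat (lower (I q) (Suc (i q))) @ enc_rat (upper (I q) (Suc (i q)))) ! k = enc_rat (r q) ! 0"
    "\<And>q. q \<in> pts \<Gamma> \<Longrightarrow> (enc_rat (powerC (I q) (Suc (i q))) @ enc_rat (powerR (I q) (Suc (i q))) @
      enc_rat (lower (I q) (Suc (i q))) @ enc_rat (upper (I q) (Suc (i q)))) ! (k + 1) = enc_rat (r q) ! 1"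
  shows "computable_rat c \<Gamma> (\<lambda>q. of_rat (r q))"
proof (rule computable_encoded_rat[OF F])
  show "computable c \<Gamma> (\<lambda>q. int (offP (I q) (i q) + k))"
    by (intro computable_int computable_nat_add computable_offP computable_nat_const)
  fix q assume q: "q \<in> pts \<Gamma>"
  show "arr (encode (I q)) (int (offP (I q) (i q) + k)) = enc_rat (r q) ! 0"
    using arr_user_rest[OF i(2)[OF q], of k] k r(1)[OF q] by auto
  have "int (offP (I q) (i q) + k) + 1 = int (offP (I q) (i q) + (k + 1))" by simp
  moreover have "k + 1 < 8" using k by auto
  ultimately show "arr (encode (I q)) (int (offP (I q) (i q) + k) + 1) = enc_rat (r q) ! 1"
    using arr_user_rest[OF i(2)[OF q], of "k + 1"] r(2)[OF q] by metis
qed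

lemma computable_user:
  "computable_rat c \<Gamma> (\<lambda>q. of_rat (powerC (I q) (Suc (i q))))"
  "computable_rat c \<Gamma> (\<lambda>q. of_rat (powerR (I q) (Suc (i q))))"
  "computable_rat c \<Gamma> (\<lambda>q. of_rat (lower (I q) (Suc (i q))))"
  "computable_rat c \<Gamma> (\<lambda>q. of_rat (upper (I q) (Suc (i q))))"
  by (rule computable_user_rat[of 0]; simp add: enc_rat_def)
    (rule computable_user_rat[of 2] computable_user_rat[of 4] computable_user_rat[of 6]; simp add: enc_rat_def; fail)+

lemma computable_lower_den: "computable c \<Gamma> (\<lambda>q. snd (quotient_of (lower (I q) (Suc (i q)))))"
proof (rule computable_cong)
  show "computable c \<Gamma> (\<lambda>q. arr (encode (I q)) (int (offP (I q) (i q) + 5)))"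
    by (intro fctx_inp[OF F] computable_int computable_nat_add computable_offP computable_nat_const)
  fix q assume q: "q \<in> pts \<Gamma>"
  show "arr (encode (I q)) (int (offP (I q) (i q) + 5)) = snd (quotient_of (lower (I q) (Suc (i q))))"
    using arr_user_rest[OF i(2)[OF q], of 5] by (simp add: enc_rat_def)
qed

end

text \<open>Only the square of the norm occurs in \<open>tau\<close> and \<open>nu\<close>, and it
  is rational even when the norm is not.\<close>

lemma computable_vec_norm:
  assumes F: "fctx \<Gamma> I d" and ps: "computable_nat c \<Gamma> ps" and l: "computable_nat c \<Gamma> (\<lambda>q. length (h q))"
    and h: "\<And>q k. q \<in> pts \<Gamma> \<Longrightarrow> k < length (enc_vec (h q)) \<Longrightarrow>
      arr (encode (I q)) (int (ps q + k)) = enc_vec (h q) ! k"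
  shows "computable_rat c \<Gamma> (\<lambda>q. (vec_norm (h q))\<^sup>2)"
proof -
  let ?n = "\<lambda>q. length (h q)"
  have F': "fctx (loop \<Gamma> ?n) (\<lambda>z. I (fst z)) (\<lambda>z. d (fst z))"
    unfolding loop_def by (rule fctx_ext[OF F])
  have ps': "computable_nat c (loop \<Gamma> ?n) (\<lambda>z. ps (fst z))"
    unfolding loop_def by (rule computable_nat_ext[OF ps])
  have e: "computable_nat c (loop \<Gamma> ?n) (\<lambda>z. snd z)" using computable_nat_last[OF l] by simp
  have a: "arr (encode (I q)) (int (ps q + (1 + 4 * k + j))) = (enc_rat (fst (h q ! k)) @ enc_rat (snd (h q ! k))) ! j"
    if "q \<in> pts \<Gamma>" "k < length (h q)" "j < 4" for q k j
    using h[OF that(1), of "1 + 4 * k + j"] enc_vec_nth[OF that(2,3)] that by (simp add: length_enc_vec)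
  have re: "computable_rat c (loop \<Gamma> ?n) (\<lambda>z. of_rat (fst (h (fst z) ! snd z)))"
  proof (rule computable_encoded_rat[OF F'])
    show "computable c (loop \<Gamma> ?n) (\<lambda>z. int (ps (fst z) + (1 + 4 * snd z + 0)))"
      by (intro computable_int computable_nat_add computable_nat_mult computable_nat_const ps' e)
    fix z assume "z \<in> pts (loop \<Gamma> ?n)"
    then have z: "fst z \<in> pts \<Gamma>" "snd z < length (h (fst z))" by (auto simp: loop_def)
    have s: "int (ps (fst z) + (1 + 4 * snd z + 0)) + 1 = int (ps (fst z) + (1 + 4 * snd z + 1))" by simp
    show "arr (encode (I (fst z))) (int (ps (fst z) + (1 + 4 * snd z + 0))) = enc_rat (fst (h (fst z) ! snd z)) ! 0"
      unfolding a[OF z, of 0, simplified] using a[OF z, of 0] by (simp add: enc_rat_def)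
    show "arr (encode (I (fst z))) (int (ps (fst z) + (1 + 4 * snd z + 0)) + 1) = enc_rat (fst (h (fst z) ! snd z)) ! 1"
      unfolding s using a[OF z, of 1] by (simp add: enc_rat_def)
  qed
  have im: "computable_rat c (loop \<Gamma> ?n) (\<lambda>z. of_rat (snd (h (fst z) ! snd z)))"
  proof (rule computable_encoded_rat[OF F'])
    show "computable c (loop \<Gamma> ?n) (\<lambda>z. int (ps (fst z) + (1 + 4 * snd z + 2)))"
      by (intro computable_int computable_nat_add computable_nat_mult computable_nat_const ps' e)
    fix z assume "z \<in> pts (loop \<Gamma> ?n)"
    then have z: "fst z \<in> pts \<Gamma>" "snd z < length (h (fst z))" by (auto simp: loop_def)
    have s: "int (ps (fst z) + (1 + 4 * snd z + 2)) + 1 = int (ps (fst z) + (1 + 4 * snd z + 3))" by simp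
    show "arr (encode (I (fst z))) (int (ps (fst z) + (1 + 4 * snd z + 2))) = enc_rat (snd (h (fst z) ! snd z)) ! 0"
      using a[OF z, of 2] by (simp add: enc_rat_def)
    show "arr (encode (I (fst z))) (int (ps (fst z) + (1 + 4 * snd z + 2)) + 1) = enc_rat (snd (h (fst z) ! snd z)) ! 1"
      unfolding s using a[OF z, of 3] by (simp add: enc_rat_def)
  qed
  have "computable_rat c \<Gamma> (\<lambda>q. \<Sum>k<?n q. of_rat (fst (h q ! k)) * of_rat (fst (h q ! k)) +
      of_rat (snd (h q ! k)) * of_rat (snd (h q ! k)))"
    by (intro computable_rat_sum l computable_rat_add computable_rat_mult re im)
  then show ?thesis
  proof (rule computable_rat_cong)
    fix q
    have "(\<Sum>(a, b)\<leftarrow>h q. (cmod (Complex (of_rat a) (of_rat b)))\<^sup>2) =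
        (\<Sum>(a, b)\<leftarrow>h q. (of_rat a)\<^sup>2 + (of_rat b)\<^sup>2)"
      by (simp add: cmod_def)
    also have "\<dots> = (\<Sum>k<?n q. of_rat (fst (h q ! k)) * of_rat (fst (h q ! k)) +
      of_rat (snd (h q ! k)) * of_rat (snd (h q ! k)))"
      by (simp add: sum_list_sum_nth atLeast0LessThan case_prod_unfold power2_eq_square)
    finally have e: "(\<Sum>(a, b)\<leftarrow>h q. (cmod (Complex (of_rat a) (of_rat b)))\<^sup>2) = \<dots>" .
    show "(\<Sum>k<?n q. of_rat (fst (h q ! k)) * of_rat (fst (h q ! k)) +
      of_rat (snd (h q ! k)) * of_rat (snd (h q ! k))) = (vec_norm (h q))\<^sup>2"
      unfolding vec_norm_def e by (simp add: sum_nonneg)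
  qed
qed

end

section \<open>Computability of levels, costs and objectives\<close>

context reals
begin

lemma computable_lev:
  assumes K: "computable_nat c \<Gamma> K" and b: "computable_rat c \<Gamma> b" and y: "computable_rat c \<Gamma> y"
  shows "computable_nat c \<Gamma> (\<lambda>q. lev (b q) (K q) (y q))"
proof (rule computable_natI[OF _ computable_nat_pb[OF K]])
  show "computable c \<Gamma> (\<lambda>q. \<Sum>k<K q. of_bool (b q ^ Suc k \<le> y q))"
  proof (intro computable_sum K computable_of_bool computable_rat_le computable_rat_power computable_nat_Suc)
    show "computable_nat c (loop \<Gamma> K) (\<lambda>z. snd z)" using computable_nat_last[OF K] by simp
  qed (unfold loop_def, rule computable_rat_ext[OF b], rule computable_rat_ext[OF y])
  show "(\<Sum>k<K q. of_bool (b q ^ Suc k \<le> y q)) = int (lev (b q) (K q) (y q))" for q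
    by (simp only: lev_def of_nat_sum of_nat_of_bool)
qed (rule lev_le)

context
  fixes \<Gamma> :: "'q ctx" and I d
  assumes F: "fctx \<Gamma> I d"
begin

lemma scheme: "q \<in> pts \<Gamma> \<Longrightarrow> scheme p \<alpha> (I q) (d q)"
  using fctx_scheme[OF F] .

lemma computable_acc_param: "computable_nat c \<Gamma> (\<lambda>q. acc (I q) (d q))"
  unfolding acc_def by (intro computable_nat_mult computable_nat_const computable_users[OF F] fctx_d[OF F])

lemma computable_fineness: "computable_nat c \<Gamma> (\<lambda>q. fineness (I q) (d q))"
  unfolding fineness_def power2_eq_square by (intro computable_nat_mult computable_acc_param)

lemma computable_base: "computable_rat c \<Gamma> (\<lambda>q. base (I q) (d q))"
  unfolding base_def
proof (intro computable_rat_add computable_rat_divide computable_rat_1 computable_rat_nat computable_fineness)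
  fix q assume "q \<in> pts \<Gamma>"
  then show "0 < real (fineness (I q) (d q))" using scheme.M(3)[OF scheme] by fastforce
qed

end

context
  fixes \<Gamma> :: "'q ctx" and I d i
  assumes F: "fctx \<Gamma> I d" and i: "computable_nat c \<Gamma> i" "\<And>q. q \<in> pts \<Gamma> \<Longrightarrow> i q < users (I q)"
begin

lemma const_pos:
  assumes "q \<in> pts \<Gamma>"
  shows "0 < (of_rat (boltzmann (I q)) * of_rat (temp (I q)) :: real)" "0 < (of_rat (pri (I q)) :: real)"
  using F assms by (auto simp: fctx_def feo_instance_def)

lemma lower_pos: "q \<in> pts \<Gamma> \<Longrightarrow> 0 < (of_rat (lower (I q) (Suc (i q))) :: real)"
  using scheme.user(3)[OF fctx_scheme[OF F]] i(2) by force

lemma computable_tau: "computable_rat c \<Gamma> (\<lambda>q. tau (I q) (Suc (i q)))"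
  unfolding tau_def
proof (intro computable_rat_divide computable_rat_mult computable_header[OF F] computable_user[OF F i] const_pos)
  show "computable_rat c \<Gamma> (\<lambda>q. (vec_norm (gainC (I q) (Suc (i q))))\<^sup>2)"
    by (rule computable_vec_norm[OF F computable_off'[OF F i] computable_lengthC[OF F i]])
      (use arr_user_vecC i(2) in auto)
qed

lemma computable_nu: "computable_rat c \<Gamma> (\<lambda>q. nu (I q) (Suc (i q)))"
  unfolding nu_def
proof (intro computable_rat_divide computable_rat_mult computable_header[OF F] computable_user[OF F i] const_pos)
  show "computable_rat c \<Gamma> (\<lambda>q. (vec_norm (gainR (I q) (Suc (i q))))\<^sup>2)"
    by (rule computable_vec_norm[OF F computable_offR[OF F i] computable_lengthR[OF F i]])
      (use arr_user_vecR i(2) in auto)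
qed

lemma computable_size_bound: "computable_rat c \<Gamma> (\<lambda>q. size_bound (I q) (Suc (i q)))"
  unfolding size_bound_def
  by (intro computable_rat_add computable_rat_mult computable_rat_divide computable_rat_1 computable_rat_numeral
      computable_tau computable_nu computable_user[OF F i] computable_header[OF F] const_pos lower_pos)

end

lemma fctx_loop: "fctx \<Gamma> I d \<Longrightarrow> fctx (loop \<Gamma> n) (\<lambda>z. I (fst z)) (\<lambda>z. d (fst z))"
  unfolding loop_def by (rule fctx_ext)

lemma computable_loop_var: "computable_nat c \<Gamma> n \<Longrightarrow> computable_nat c (loop \<Gamma> n) (\<lambda>z. snd z)"
  using computable_nat_last[of c \<Gamma> n] by simp

lemma computable_nat_loop: "computable_nat c \<Gamma> m \<Longrightarrow> computable_nat c (loop \<Gamma> n) (\<lambda>z. m (fst z))"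
  unfolding loop_def by (rule computable_nat_ext)

lemma computable_loop: "computable c \<Gamma> m \<Longrightarrow> computable c (loop \<Gamma> n) (\<lambda>z. m (fst z))"
  unfolding loop_def by (rule computable_ext)

lemma pts_loop [simp]: "z \<in> pts (loop \<Gamma> n) \<longleftrightarrow> fst z \<in> pts \<Gamma> \<and> snd z < n (fst z)"
  by (simp add: loop_def)

context
  fixes \<Gamma> :: "'q ctx" and I d
  assumes F: "fctx \<Gamma> I d"
begin

lemma computable_cap: "computable_nat c \<Gamma> (\<lambda>q. cap (I q) (d q))"
  unfolding cap_def
  by (intro computable_nat_mult computable_fineness[OF F] computable_bitlen computable_add computable_const
      computable_floor computable_rat_sum computable_users[OF F]
      computable_size_bound[OF fctx_loop[OF F] computable_loop_var[OF computable_users[OF F]]]) simp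

lemma computable_approx_ln:
  assumes "computable_rat c \<Gamma> y"
  shows "computable_rat c \<Gamma> (\<lambda>q. approx_ln (I q) (d q) (y q))"
  unfolding approx_ln_def
proof (intro computable_rat_if computable_rat_less computable_rat_divide computable_rat_1 assms computable_rat_nat
    computable_acc_param[OF F] computable_fineness[OF F] computable_lev computable_cap computable_base[OF F] computable_rat_add)
  fix q assume q: "q \<in> pts \<Gamma>"
  show "0 < real (fineness (I q) (d q))" using scheme.M(3)[OF fctx_scheme[OF F q]] by simp
  show "0 < real (acc (I q) (d q))" using scheme.R(1)[OF fctx_scheme[OF F q]] by simp
qed

lemma computable_cap2: "computable_nat c \<Gamma> (\<lambda>q. cap2 p (I q) (d q))"
  unfolding cap2_def
  by (intro computable_nat_add computable_nat_mult computable_nat_const computable_cap computable_fineness[OF F] computable_users[OF F])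

lemma computable_prec: "computable_nat c \<Gamma> (\<lambda>q. prec p (I q) (d q))"
  unfolding prec_def by (intro computable_nat_mult computable_nat_const computable_cap2)

lemma computable_approx_p: "computable c \<Gamma> (\<lambda>q. approx_p p (I q) (d q))"
  using computable_approx[of c \<Gamma> "\<lambda>q. prec p (I q) (d q)" 0] computable_prec
  by (simp add: computable_nat_def fixed_reals_def approx_p_def)

lemma computable_approx_\<alpha>: "computable c \<Gamma> (\<lambda>q. approx_\<alpha> p \<alpha> (I q) (d q))"
  using computable_approx[of c \<Gamma> "\<lambda>q. prec p (I q) (d q)" 1] computable_prec
  by (simp add: computable_nat_def fixed_reals_def approx_\<alpha>_def)

lemma computable_state_val:
  assumes "computable_nat c \<Gamma> k"
  shows "computable_rat c \<Gamma> (\<lambda>q. state_val (I q) (d q) (k q))"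
proof -
  have "computable_rat c \<Gamma> (\<lambda>q. if int (k q) = 0 then 0 else base (I q) (d q) ^ (k q - 1))"
    by (intro computable_rat_if computable_eq computable_int computable_const computable_rat_0
        computable_rat_power computable_base[OF F] computable_nat_diff computable_nat_const assms)
  then show ?thesis by (simp add: state_val_def)
qed

lemma computable_merge:
  assumes "computable_nat c \<Gamma> k" "computable_nat c \<Gamma> r"
  shows "computable_nat c \<Gamma> (\<lambda>q. merge p (I q) (d q) (k q) (r q))"
  unfolding merge_def
  by (intro computable_nat_Suc computable_lev computable_base[OF F] computable_cap2 computable_rat_add
      computable_state_val computable_rat_power assms)

text \<open>The root level becomes an exponent, so its value has to be polynomial;
  \<open>root_level_bounds\<close> provides this for genuine states \<open>k\<close>.\<close>

lemma computable_root_level: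
  assumes k: "computable_nat c \<Gamma> k" and "\<And>q. q \<in> pts \<Gamma> \<Longrightarrow> k q \<le> Suc (cap2 p (I q) (d q))"
  shows "computable_nat c \<Gamma> (\<lambda>q. root_level p (I q) (d q) (k q))"
proof (rule computable_natI[OF _ computable_nat_pb[OF computable_cap2]])
  show "computable c \<Gamma> (\<lambda>q. int (k q - 1) * 2 ^ prec p (I q) (d q) div approx_p p (I q) (d q))"
    by (intro computable_div computable_mult computable_int computable_nat_diff k computable_nat_const
        computable_power computable_const computable_prec computable_approx_p)
  fix q assume q: "q \<in> pts \<Gamma>"
  show "root_level p (I q) (d q) (k q) \<le> cap2 p (I q) (d q)"
    by (rule scheme.root_level_bounds(3)[OF fctx_scheme[OF F q] assms(2)[OF q]])
  show "int (k q - 1) * 2 ^ prec p (I q) (d q) div approx_p p (I q) (d q) = int (root_level p (I q) (d q) (k q))"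
    using scheme.approx_p_bounds(4)[OF fctx_scheme[OF F q]]
    by (simp add: root_level_def pos_imp_zdiv_nonneg_iff)
qed

lemma computable_objective:
  assumes "computable_nat c \<Gamma> k" "\<And>q. q \<in> pts \<Gamma> \<Longrightarrow> k q \<le> Suc (cap2 p (I q) (d q))" "computable_nat c \<Gamma> m"
  shows "computable c \<Gamma> (\<lambda>q. objective p \<alpha> (I q) (d q) (m q) (k q))"
  unfolding objective_def of_nat_power
  by (intro computable_floor computable_rat_mult computable_rat_add computable_rat_int computable_approx_\<alpha>
      computable_rat_power computable_base[OF F] computable_root_level computable_diff computable_power computable_prec
      computable_const computable_rat_nat computable_fineness[OF F] computable_cap2 assms)

lemma computable_scale: "computable c \<Gamma> (\<lambda>q. scale (I q) (d q))"
  unfolding scale_def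
  by (intro computable_mult computable_prod computable_users[OF F] computable_power computable_int
      computable_fineness[OF F] computable_cap
      computable_lower_den[OF fctx_loop[OF F] computable_loop_var[OF computable_users[OF F]]]) simp

end

context
  fixes \<Gamma> :: "'q ctx" and I d i j
  assumes F: "fctx \<Gamma> I d" and i: "computable_nat c \<Gamma> i" "\<And>q. q \<in> pts \<Gamma> \<Longrightarrow> i q < users (I q)"
    and j: "computable_nat c \<Gamma> j"
begin

lemma computable_point: "computable_rat c \<Gamma> (\<lambda>q. point (I q) (d q) (Suc (i q)) (j q))"
  unfolding point_def
  by (intro computable_rat_mult computable_rat_power computable_base[OF F] j computable_user[OF F i])

lemma computable_approx_u: "computable_rat c \<Gamma> (\<lambda>q. approx_u (I q) (d q) (Suc (i q)) (j q))"
  unfolding approx_u_def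
proof (intro computable_rat_add computable_rat_mult computable_rat_divide computable_approx_ln[OF F] computable_point
    computable_rat_numeral computable_tau[OF F i] computable_nu[OF F i] computable_header[OF F])
  fix q assume q: "q \<in> pts \<Gamma>"
  show "0 < point (I q) (d q) (Suc (i q)) (j q)"
    by (rule scheme.point_pos[OF fctx_scheme[OF F q] i(2)[OF q]])
  show "0 < 2 * (of_rat (pri (I q)) :: real)" using const_pos(2)[OF F i q] by simp
qed

lemma computable_value_level: "computable_nat c \<Gamma> (\<lambda>q. value_level (I q) (d q) (Suc (i q)) (j q))"
  unfolding value_level_def
  by (intro computable_lev computable_cap[OF F] computable_base[OF F] computable_rat_mult computable_rat_numeral
      computable_approx_u)

lemma computable_power_level: "computable_nat c \<Gamma> (\<lambda>q. power_level p (I q) (d q) (Suc (i q)) (j q))"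
proof (rule computable_natI)
  show "computable c \<Gamma> (\<lambda>q. int (value_level (I q) (d q) (Suc (i q)) (j q)) * approx_p p (I q) (d q) div 2 ^ prec p (I q) (d q))"
    by (intro computable_div computable_mult computable_int computable_value_level computable_power
        computable_const computable_prec[OF F] computable_approx_p[OF F])
  show "pb \<Gamma> (\<lambda>q. nat \<lceil>p\<rceil> * cap (I q) (d q))"
    by (intro pb_intros computable_nat_pb[OF computable_cap[OF F]])
  fix q assume q: "q \<in> pts \<Gamma>"
  show "power_level p (I q) (d q) (Suc (i q)) (j q) \<le> nat \<lceil>p\<rceil> * cap (I q) (d q)"
    by (rule scheme.power_level_bounds(3)[OF fctx_scheme[OF F q]])
  show "int (value_level (I q) (d q) (Suc (i q)) (j q)) * approx_p p (I q) (d q) div 2 ^ prec p (I q) (d q) =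
      int (power_level p (I q) (d q) (Suc (i q)) (j q))"
    using scheme.approx_p_bounds(4)[OF fctx_scheme[OF F q]]
    by (simp add: power_level_def pos_imp_zdiv_nonneg_iff)
qed

lemma computable_weight: "computable c \<Gamma> (\<lambda>q. weight (I q) (d q) (i q) (j q))"
  unfolding weight_def
  by (intro computable_floor computable_rat_mult computable_point computable_rat_int computable_scale[OF F])

lemma computable_cost: "computable c \<Gamma> (\<lambda>q. cost (I q) (d q) (i q) (j q))"
  unfolding cost_def
  by (intro computable_add computable_mult computable_weight computable_power computable_int computable_nat_Suc
      computable_cap[OF F] computable_users[OF F] i j)

lemma computable_admissible:
  assumes "computable_nat c \<Gamma> m"
  shows "computable_pred c \<Gamma> (\<lambda>q. admissible (I q) (d q) (m q) (i q) (j q))"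
proof -
  have "computable_pred c \<Gamma> (\<lambda>q. int (m q) \<le> int (value_level (I q) (d q) (Suc (i q)) (j q)) \<and>
      point (I q) (d q) (Suc (i q)) (j q) \<le> of_rat (upper (I q) (Suc (i q))))"
    by (intro computable_and computable_le computable_int computable_value_level assms computable_rat_le
        computable_point computable_user[OF F i])
  then show ?thesis by (simp add: admissible_def)
qed

lemma computable_step:
  assumes "computable_nat c \<Gamma> k"
  shows "computable_nat c \<Gamma> (\<lambda>q. step p (I q) (d q) (i q) (j q) (k q))"
  unfolding step_def by (intro computable_merge[OF F] computable_power_level assms)

end

lemma computable_inf_cost:
  assumes F: "fctx \<Gamma> I d"
  shows "computable c \<Gamma> (\<lambda>q. inf_cost (I q) (d q))"
proof -
  note N = computable_users[OF F]
  note F1 = fctx_loop[OF F, of "\<lambda>q. users (I q)"]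
  note K = computable_nat_Suc[OF computable_cap[OF F1]]
  show ?thesis
    unfolding inf_cost_def
    by (intro computable_add computable_const computable_sum N K
        computable_cost[OF fctx_loop[OF F1] computable_nat_loop[OF computable_loop_var[OF N]] _ computable_loop_var[OF K]]) simp
qed

end

section \<open>The table as an iteration over packed rows\<close>

lemma (in scheme) table_bounds:
  "i \<le> N \<Longrightarrow> 0 \<le> table p I d m i k \<and> table p I d m i k < Z"
  unfolding table_def using tab_range[of "inf_cost I d" N "Suc K" "cost I d" i] inf_cost_pos cost_nonneg
  by (smt (verit))

context reals
begin

lemma computable_nat_eq:
  assumes "computable_nat c \<Gamma> m" "computable_nat c \<Gamma> n"
  shows "computable_pred c \<Gamma> (\<lambda>q. m q = n q)"
  using computable_eq[OF computable_int[OF assms(1)] computable_int[OF assms(2)]] by simp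

text \<open>One entry of the next row, where \<open>a\<close> packs the previous row as digits to
  base \<open>inf_cost + 1\<close>.\<close>

lemma computable_row:
  assumes F: "fctx \<Gamma> I d" and i: "computable_nat c \<Gamma> i" "\<And>q. q \<in> pts \<Gamma> \<Longrightarrow> i q < users (I q)"
    and m: "computable_nat c \<Gamma> m" and k': "computable_nat c \<Gamma> k'" and a: "computable c \<Gamma> a"
  shows "computable c \<Gamma> (\<lambda>q. Min (insert (inf_cost (I q) (d q)) ((\<lambda>k. Min (insert (inf_cost (I q) (d q)) ((\<lambda>j.
      if admissible (I q) (d q) (m q) (i q) j \<and> step p (I q) (d q) (i q) j k = k' q
      then a q div (inf_cost (I q) (d q) + 1) ^ k mod (inf_cost (I q) (d q) + 1) + cost (I q) (d q) (i q) j
      else inf_cost (I q) (d q)) ` {..<Suc (cap (I q) (d q))}))) ` {..<cap2 p (I q) (d q) + 2})))"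
proof -
  define n where "n q = cap2 p (I q) (d q) + 2" for q
  have n: "computable_nat c \<Gamma> n"
    unfolding n_def by (intro computable_nat_add computable_nat_const computable_cap2[OF F])
  let ?\<Gamma>1 = "loop \<Gamma> n"
  note F1 = fctx_loop[OF F, of n]
  have J: "computable_nat c ?\<Gamma>1 (\<lambda>z. Suc (cap (I (fst z)) (d (fst z))))"
    by (intro computable_nat_Suc computable_cap[OF F1])
  let ?\<Gamma>2 = "loop ?\<Gamma>1 (\<lambda>z. Suc (cap (I (fst z)) (d (fst z))))"
  note F2 = fctx_loop[OF F1, of "\<lambda>z. Suc (cap (I (fst z)) (d (fst z)))"]
  have i2: "computable_nat c ?\<Gamma>2 (\<lambda>z. i (fst (fst z)))" "\<And>z. z \<in> pts ?\<Gamma>2 \<Longrightarrow> i (fst (fst z)) < users (I (fst (fst z)))"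
    by (intro computable_nat_loop i) (use i in auto)
  have m2: "computable_nat c ?\<Gamma>2 (\<lambda>z. m (fst (fst z)))" by (intro computable_nat_loop m)
  have k2': "computable_nat c ?\<Gamma>2 (\<lambda>z. k' (fst (fst z)))" by (intro computable_nat_loop k')
  have a2: "computable c ?\<Gamma>2 (\<lambda>z. a (fst (fst z)))" by (intro computable_loop a)
  have j2: "computable_nat c ?\<Gamma>2 (\<lambda>z. snd z)" by (rule computable_loop_var[OF J])
  have k2: "computable_nat c ?\<Gamma>2 (\<lambda>z. snd (fst z))" by (intro computable_nat_loop computable_loop_var n)
  show ?thesis
    unfolding n_def[symmetric]
    by (intro computable_Min n J computable_if computable_and computable_nat_eq computable_add computable_mod
        computable_div computable_power computable_const
        computable_admissible[OF F2 i2 j2 m2] computable_step[OF F2 i2 j2 k2] computable_cost[OF F2 i2 j2]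
        computable_inf_cost F F1 F2 k2' a2 k2)
qed

text \<open>A whole row has to fit into the single accumulator of \<open>computable_iter\<close>.
  Entries are at most \<open>inf_cost\<close>, so they can be digits to base
  \<open>inf_cost + 1\<close> and are recovered by \<open>digit\<close>.\<close>

lemma computable_table:
  assumes F: "fctx \<Gamma> I d" and i: "computable_nat c \<Gamma> i" "\<And>q. q \<in> pts \<Gamma> \<Longrightarrow> i q \<le> users (I q)"
    and m: "computable_nat c \<Gamma> m"
    and k: "computable_nat c \<Gamma> k" "\<And>q. q \<in> pts \<Gamma> \<Longrightarrow> k q < cap2 p (I q) (d q) + 2"
  shows "computable c \<Gamma> (\<lambda>q. table p (I q) (d q) (m q) (i q) (k q))"
proof -
  define L where "L q = inf_cost (I q) (d q)" for q
  define n where "n q = cap2 p (I q) (d q) + 2" for q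
  define A where "A q i = (\<Sum>k<n q. table p (I q) (d q) (m q) i k * (L q + 1) ^ k)" for q i
  have n: "computable_nat c \<Gamma> n"
    unfolding n_def by (intro computable_nat_add computable_nat_const computable_cap2[OF F])
  have L: "computable c \<Gamma> L" unfolding L_def by (rule computable_inf_cost[OF F])
  have range: "0 \<le> table p (I q) (d q) (m q) i' k' \<and> table p (I q) (d q) (m q) i' k' < L q + 1"
    if "q \<in> pts \<Gamma>" "i' \<le> i q" for q i' k'
    unfolding L_def using scheme.table_bounds[OF fctx_scheme[OF F that(1)]] that(2) i(2)[OF that(1)] by simp
  have L0: "0 < L q + 1" if "q \<in> pts \<Gamma>" for q using range[OF that, of 0 0] by simp
  have dig: "A q i' div (L q + 1) ^ k' mod (L q + 1) = table p (I q) (d q) (m q) i' k'"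
    if "q \<in> pts \<Gamma>" "i' \<le> i q" "k' < n q" for q i' k'
    unfolding A_def by (rule digit) (use range that in auto)
  define row where "row q i a k' = Min (insert (inf_cost (I q) (d q)) ((\<lambda>k. Min (insert (inf_cost (I q) (d q)) ((\<lambda>j.
      if admissible (I q) (d q) (m q) i j \<and> step p (I q) (d q) i j k = k'
      then a div (inf_cost (I q) (d q) + 1) ^ k mod (inf_cost (I q) (d q) + 1) + cost (I q) (d q) i j
      else inf_cost (I q) (d q)) ` {..<Suc (cap (I q) (d q))}))) ` {..<cap2 p (I q) (d q) + 2}))" for q i a k'
  let ?h = "\<lambda>z. \<Sum>k'<n (fst (fst z)). row (fst (fst z)) (snd (fst z)) (snd z) k' * (L (fst (fst z)) + 1) ^ k'"
  have "computable c \<Gamma> (\<lambda>q. A q (i q))"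
  proof (rule computable_iter[where A = A and h = ?h])
    show "computable_nat c \<Gamma> i" by (rule i)
    have "computable c \<Gamma> (\<lambda>q. \<Sum>k<n q. (if int k = 0 then 0 else L q) * (L q + 1) ^ k)"
      by (intro computable_sum n computable_mult computable_if computable_eq computable_int computable_const
          computable_power computable_add computable_loop_var computable_loop L)
    then show "computable c \<Gamma> (\<lambda>q. A q 0)"
      by (simp only: A_def table_def tab.simps L_def of_nat_eq_0_iff)
    \<comment> \<open>The a priori bound on the accumulator: a packed row is below
      \<open>(L + 1) ^ n\<close>, which has polynomially many bits because \<open>n\<close> is
      polynomial in value.\<close>
    obtain B where B: "pb \<Gamma> B" "\<And>q. q \<in> pts \<Gamma> \<Longrightarrow> \<bar>(L q + 1) ^ n q\<bar> \<le> 2 ^ B q"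
      using computable_bound[OF computable_power[OF n computable_add[OF L computable_const[of _ _ 1]]]] by blast
    have acc: "computable c (iter \<Gamma> i A) (\<lambda>z. snd z)"
    proof -
      have "computable c (iter \<Gamma> i A) snd"
      proof (rule computable_acc[OF B(1)])
        fix q k assume q: "q \<in> pts \<Gamma>" "k < i q"
        have "0 \<le> A q k \<and> A q k < (L q + 1) ^ n q"
          unfolding A_def by (rule digits_less) (use range[OF q(1)] q L0 in auto)
        then show "\<bar>A q k\<bar> \<le> 2 ^ B q" using B(2)[OF q(1)] by simp
      qed
      then show ?thesis by simp
    qed
    let ?\<Delta> = "iter \<Gamma> i A"
    have FD: "fctx ?\<Delta> (\<lambda>z. I (fst (fst z))) (\<lambda>z. d (fst (fst z)))"
      unfolding iter_def loop_def by (rule fctx_ext[OF fctx_ext[OF F]])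
    have nD: "computable_nat c ?\<Delta> (\<lambda>z. x (fst (fst z)))" if "computable_nat c \<Gamma> x" for x
      unfolding iter_def by (rule computable_nat_ext[OF computable_nat_loop[OF that]])
    have iD: "computable_nat c ?\<Delta> (\<lambda>z. snd (fst z))"
      unfolding iter_def by (rule computable_nat_ext[OF computable_loop_var[OF i(1)]])
    have LD: "computable c ?\<Delta> (\<lambda>z. L (fst (fst z)))"
      unfolding iter_def by (rule computable_ext[OF computable_loop[OF L]])
    have ptsD: "fst (fst z) \<in> pts \<Gamma> \<and> snd (fst z) < i (fst (fst z))" if "z \<in> pts ?\<Delta>" for z
      using that by (auto simp: iter_def)
    let ?\<Delta>' = "loop ?\<Delta> (\<lambda>z. n (fst (fst z)))"
    have "computable c ?\<Delta>' (\<lambda>z. row (fst (fst (fst z))) (snd (fst (fst z))) (snd (fst z)) (snd z))"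
      unfolding row_def
    proof (rule computable_row[where I = "\<lambda>z. I (fst (fst (fst z)))" and d = "\<lambda>z. d (fst (fst (fst z)))"])
      show "fctx ?\<Delta>' (\<lambda>z. I (fst (fst (fst z)))) (\<lambda>z. d (fst (fst (fst z))))" by (rule fctx_loop[OF FD])
      show "computable_nat c ?\<Delta>' (\<lambda>z. snd (fst (fst z)))" by (rule computable_nat_loop[OF iD])
      show "computable_nat c ?\<Delta>' (\<lambda>z. m (fst (fst (fst z))))" by (rule computable_nat_loop[OF nD[OF m]])
      show "computable_nat c ?\<Delta>' (\<lambda>z. snd z)" by (rule computable_loop_var[OF nD[OF n]])
      show "computable c ?\<Delta>' (\<lambda>z. snd (fst z))" by (rule computable_loop[OF acc])
      fix z assume "z \<in> pts ?\<Delta>'"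
      then show "snd (fst (fst z)) < users (I (fst (fst (fst z))))"
        using ptsD[of "fst z"] i(2)[of "fst (fst (fst z))"] by auto
    qed
    then show "computable c ?\<Delta> ?h"
      by (intro computable_sum nD n computable_mult computable_power computable_add computable_const
          computable_loop LD computable_loop_var)
    fix q k assume q: "q \<in> pts \<Gamma>" "k < i q"
    have "table p (I q) (d q) (m q) (Suc k) k' = row q k (A q k) k'" for k'
    proof -
      have "table p (I q) (d q) (m q) (Suc k) k' = Min (insert (inf_cost (I q) (d q)) ((\<lambda>k1. Min (insert (inf_cost (I q) (d q)) ((\<lambda>j.
      if admissible (I q) (d q) (m q) k j \<and> step p (I q) (d q) k j k1 = k'
      then table p (I q) (d q) (m q) k k1 + cost (I q) (d q) k j
      else inf_cost (I q) (d q)) ` {..<Suc (cap (I q) (d q))}))) ` {..<cap2 p (I q) (d q) + 2}))"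
        by (simp add: table_def)
      also have "\<dots> = row q k (A q k) k'"
        unfolding row_def
        by (intro arg_cong[where f = Min] arg_cong[where f = "insert _"] image_cong refl if_cong)
          (use dig[OF q(1), of k] q(2) in \<open>simp add: L_def n_def\<close>)
      finally show ?thesis .
    qed
    then show "A q (Suc k) = ?h ((q, k), A q k)" by (simp add: A_def)
  qed
  then have "computable c \<Gamma> (\<lambda>q. A q (i q) div (L q + 1) ^ k q mod (L q + 1))"
    by (intro computable_mod computable_div computable_power computable_add computable_const L k)
  then show ?thesis
    by (rule computable_cong) (use dig k(2) in \<open>auto simp: n_def\<close>)
qed

lemma computable_best:
  assumes F: "fctx \<Gamma> I d"
  shows "computable c \<Gamma> (\<lambda>q. best p \<alpha> (I q) (d q))"
proof -
  note K = computable_nat_Suc[OF computable_cap[OF F]]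
  let ?\<Gamma>1 = "loop \<Gamma> (\<lambda>q. Suc (cap (I q) (d q)))"
  note F1 = fctx_loop[OF F, of "\<lambda>q. Suc (cap (I q) (d q))"]
  have n: "computable_nat c ?\<Gamma>1 (\<lambda>z. cap2 p (I (fst z)) (d (fst z)) + 2)"
    by (intro computable_nat_add computable_nat_const computable_cap2[OF F1])
  let ?\<Gamma>2 = "loop ?\<Gamma>1 (\<lambda>z. cap2 p (I (fst z)) (d (fst z)) + 2)"
  note F2 = fctx_loop[OF F1, of "\<lambda>z. cap2 p (I (fst z)) (d (fst z)) + 2"]
  have m: "computable_nat c ?\<Gamma>2 (\<lambda>z. snd (fst z))" by (rule computable_nat_loop[OF computable_loop_var[OF K]])
  have k: "computable_nat c ?\<Gamma>2 (\<lambda>z. snd z)" by (rule computable_loop_var[OF n])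
  have t: "computable c ?\<Gamma>2 (\<lambda>z. table p (I (fst (fst z))) (d (fst (fst z))) (snd (fst z)) (users (I (fst (fst z)))) (snd z))"
    by (rule computable_table[OF F2 computable_users[OF F2] _ m k]) auto
  have o: "computable c ?\<Gamma>2 (\<lambda>z. objective p \<alpha> (I (fst (fst z))) (d (fst (fst z))) (snd (fst z)) (snd z))"
    by (rule computable_objective[OF F2 k _ m]) auto
  have s: "computable c ?\<Gamma>2 (\<lambda>z. score p \<alpha> (I (fst (fst z))) (d (fst (fst z))) (snd (fst z)) (snd z))"
    unfolding score_def Let_def
    by (intro computable_if computable_and computable_less computable_le computable_add computable_mult computable_div
        computable_power computable_int computable_nat_Suc computable_const t o computable_inf_cost[OF F2]
        computable_users[OF F2] computable_cap[OF F2] computable_floor computable_rat_mult computable_header[OF F2]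
        computable_rat_int computable_scale[OF F2])
  show ?thesis
    unfolding best_def by (intro computable_Max K n computable_const s)
qed

text \<open>The last \<open>mod\<close> bounds the index by \<open>cap\<close>, which gives the
  polynomial value bound.\<close>

lemma computable_choice:
  assumes F: "fctx \<Gamma> I d" and i: "computable_nat c \<Gamma> i"
  shows "computable_nat c \<Gamma> (\<lambda>q. choice p \<alpha> (I q) (d q) (i q))"
proof (rule computable_natI[OF _ computable_nat_pb[OF computable_cap[OF F]]])
  show "computable c \<Gamma> (\<lambda>q. best p \<alpha> (I q) (d q) mod (inf_cost (I q) (d q) + 1) div
      int (Suc (cap (I q) (d q))) ^ i q mod int (Suc (cap (I q) (d q))))"
    by (intro computable_mod computable_div computable_power computable_add computable_int computable_nat_Suc
        computable_const computable_best computable_inf_cost computable_cap F i)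
  fix q
  let ?x = "best p \<alpha> (I q) (d q) mod (inf_cost (I q) (d q) + 1) div int (Suc (cap (I q) (d q))) ^ i q"
  have "0 \<le> ?x mod int (Suc (cap (I q) (d q)))" "?x mod int (Suc (cap (I q) (d q))) < int (Suc (cap (I q) (d q)))"
    by (rule pos_mod_sign pos_mod_bound, simp)+
  then show "?x mod int (Suc (cap (I q) (d q))) = int (choice p \<alpha> (I q) (d q) (i q))"
    "choice p \<alpha> (I q) (d q) (i q) \<le> cap (I q) (d q)"
    unfolding choice_def by linarith+
qed

end

text \<open>Here arrays are written beyond index 0. The output names belong to the protected set
  \<open>X\<close>, so computing later entries does not damage earlier ones; the shift to
  \<open>Suc k\<close> matches the numbering of users from 1.\<close>

lemma computable_output:
  assumes n: "computable_nat c \<Gamma> n"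
    and a: "computable c (loop \<Gamma> n) (\<lambda>z. a (fst z) (snd z))"
    and b: "computable c (loop \<Gamma> n) (\<lambda>z. b (fst z) (snd z))"
    and ns: "length ns = length (vars \<Gamma>)" "x \<noteq> y" "x \<notin> insert ''in'' (set ns)" "y \<notin> insert ''in'' (set ns)"
  shows "\<exists>P T. pb \<Gamma> T \<and> (\<forall>q\<in>pts \<Gamma>. \<forall>s. matches \<Gamma> ns q s \<longrightarrow>
    (\<exists>t s'. exec c P s t s' \<and> t \<le> T q \<and> (\<forall>k<n q. s' x (int (Suc k)) = a q k \<and> s' y (int (Suc k)) = b q k)))"
proof -
  define X where "X = insert x (insert y (insert ''in'' (set ns)))"
  have X: "finite X" "''in'' \<in> X" "set ns \<subseteq> X" by (auto simp: X_def)
  obtain Pn rn Tn where Pn: "rn \<notin> X" "pb \<Gamma> Tn" "realizes c \<Gamma> X ns Pn rn Tn (\<lambda>q. int (n q))"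
    using computableE[OF computable_int[OF n] X ns(1)] .
  obtain i where i: "i \<notin> insert rn X" by (rule fresh_name[of "insert rn X"]) (use X in auto)
  define X' where "X' = insert i (insert rn X)"
  have X': "finite X'" "''in'' \<in> X'" "set (i # ns) \<subseteq> X'" "length (i # ns) = length (vars (loop \<Gamma> n))"
    using X ns(1) by (auto simp: X'_def loop_def)
  obtain Pa ra Ta where Pa: "ra \<notin> X'" "pb (loop \<Gamma> n) Ta"
      "realizes c (loop \<Gamma> n) X' (i # ns) Pa ra Ta (\<lambda>z. a (fst z) (snd z))"
    using computableE[OF a X'] .
  obtain Pb rb Tb where Pb: "rb \<notin> X'" "pb (loop \<Gamma> n) Tb"
      "realizes c (loop \<Gamma> n) X' (i # ns) Pb rb Tb (\<lambda>z. b (fst z) (snd z))"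
    using computableE[OF b X'] .
  \<comment> \<open>The counter does not change the size, so the times inside the loop are bounded
    by functions of \<open>q\<close> alone.\<close>
  have "\<exists>B. pb \<Gamma> B \<and> (\<forall>q\<in>pts \<Gamma>. \<forall>k<n q. t (q, k) \<le> B q)" if t: "pb (loop \<Gamma> n) t" for t
  proof -
    obtain j where j: "\<forall>z\<in>pts (loop \<Gamma> n). t z \<le> sz (loop \<Gamma> n) z ^ j" using t unfolding pb_def by blast
    have "t (q, k) \<le> sz \<Gamma> q ^ j" if "q \<in> pts \<Gamma>" "k < n q" for q k
      using j[rule_format, of "(q, k)"] that by (simp add: loop_def)
    moreover have "pb \<Gamma> (\<lambda>q. sz \<Gamma> q ^ j)" unfolding pb_def by auto
    ultimately show ?thesis by blast
  qed
  from this[OF Pa(2)] this[OF Pb(2)] obtain Ba Bb where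
    B: "pb \<Gamma> Ba" "pb \<Gamma> Bb" "\<And>q k. q \<in> pts \<Gamma> \<Longrightarrow> k < n q \<Longrightarrow> Ta (q, k) \<le> Ba q"
      "\<And>q k. q \<in> pts \<Gamma> \<Longrightarrow> k < n q \<Longrightarrow> Tb (q, k) \<le> Bb q" by blast
  let ?k = "Plus (Read i (Const 0)) (Const 1)"
  let ?body = "Seq Pa (Seq (Write x ?k (Read ra (Const 0)))
      (Seq Pb (Seq (Write y ?k (Read rb (Const 0))) (Write i (Const 0) ?k))))"
  let ?b = "Less (Read i (Const 0)) (Read rn (Const 0))"
  let ?P = "Seq Pn (Seq (Write i (Const 0) (Const 0)) (While ?b ?body))"
  define U where "U q = 2 * Ba q + 2 * Bb q + 10 * n q + 80" for q
  define V where "V q = Tn q + (3 + (n q + 1) * U q)" for q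
  have V: "pb \<Gamma> V" unfolding V_def U_def by (intro pb_intros B Pn computable_nat_pb[OF n])
  have bn: "bits (int k) \<le> k + 2" for k using bits_le[OF int_le_power] .
  have b1: "bits 1 \<le> 3" using bn[of 1] by simp
  have "\<exists>t s'. exec c ?P s t s' \<and> t \<le> V q \<and> (\<forall>k<n q. s' x (int (Suc k)) = a q k \<and> s' y (int (Suc k)) = b q k)"
    if q: "q \<in> pts \<Gamma>" and s: "matches \<Gamma> ns q s" for q s
  proof -
    obtain t0 s0 where e0: "exec c Pn s t0 s0" "t0 \<le> Tn q" "s0 rn 0 = int (n q)" "\<And>x. x \<in> X \<Longrightarrow> s0 x = s x"
      using realizes_exec[OF Pn(3) q s] by blast
    define s1 where "s1 = s0(i := (s0 i)(0 := 0))"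
    have e1: "exec c (Write i (Const 0) (Const 0)) s0 3 s1"
      using write_exec[of c i "Const 0" s0] by (simp add: s1_def)
    define Inv where "Inv k s' \<longleftrightarrow> s' i 0 = int k \<and> s' rn 0 = int (n q) \<and> matches \<Gamma> ns q s' \<and>
      (\<forall>l<k. s' x (int (Suc l)) = a q l \<and> s' y (int (Suc l)) = b q l)" for k and s' :: state
    have m1: "matches \<Gamma> ns q s1"
      by (rule matches_frame[OF s _ X(2,3)]) (use e0(4) i in \<open>auto simp: s1_def\<close>)
    have I0: "Inv 0 s1" unfolding Inv_def using m1 e0(3) i by (auto simp: s1_def)
    have "\<exists>t s'. exec c (While ?b ?body) s1 t s' \<and> Inv (n q) s' \<and> t \<le> (n q - 0 + 1) * U q"
    proof (rule while_exec[where I = Inv])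
      fix k s' assume k: "k < n q" and I: "Inv k s'"
      let ?z = "(q, k)"
      have z: "?z \<in> pts (loop \<Gamma> n)" using q k by (simp add: loop_def)
      have m: "matches (loop \<Gamma> n) (i # ns) ?z s'" using I by (simp add: loop_def Inv_def)
      obtain t2 s2 where e2: "exec c Pa s' t2 s2" "t2 \<le> Ta ?z" "s2 ra 0 = a q k" "\<And>x. x \<in> X' \<Longrightarrow> s2 x = s' x"
        using realizes_exec[OF Pa(3) z m] by auto
      define s3 where "s3 = s2(x := (s2 x)(int (Suc k) := a q k))"
      have i2: "s2 i 0 = int k" using e2(4)[of i] I by (simp add: X'_def Inv_def)
      have e3: "exec c (Write x ?k (Read ra (Const 0))) s2
          (3 + bits (int k) + bits 1 + bits (int (Suc k)) + bits (a q k)) s3"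
        using exec.Write[of c x ?k "Read ra (Const 0)" s2] e2(3) i2
        by (simp add: s3_def eval_nat_numeral add_ac)
      have m3: "matches (loop \<Gamma> n) (i # ns) ?z s3"
        by (rule matches_frame[OF m, of "insert i (insert ''in'' (set ns))"])
          (use e2(4) i ns in \<open>auto simp: s3_def X'_def X_def\<close>)
      obtain t4 s4 where e4: "exec c Pb s3 t4 s4" "t4 \<le> Tb ?z" "s4 rb 0 = b q k" "\<And>x. x \<in> X' \<Longrightarrow> s4 x = s3 x"
        using realizes_exec[OF Pb(3) z m3] by auto
      define s5 where "s5 = s4(y := (s4 y)(int (Suc k) := b q k))"
      have i4: "s4 i 0 = int k" using e4(4)[of i] i2 i by (auto simp: X'_def s3_def X_def)
      have e5: "exec c (Write y ?k (Read rb (Const 0))) s4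
          (3 + bits (int k) + bits 1 + bits (int (Suc k)) + bits (b q k)) s5"
        using exec.Write[of c y ?k "Read rb (Const 0)" s4] e4(3) i4
        by (simp add: s5_def eval_nat_numeral add_ac)
      define s6 where "s6 = s5(i := (s5 i)(0 := int (Suc k)))"
      have i5: "s5 i 0 = int k" using i4 i by (auto simp: s5_def X_def)
      have e6: "exec c (Write i (Const 0) ?k) s5 (3 + bits (int k) + bits 1 + bits (int (Suc k))) s6"
        using write_exec[of c i ?k s5] i5 by (simp add: s6_def eval_nat_numeral add_ac)
      note e = exec.Seq[OF e2(1) exec.Seq[OF e3 exec.Seq[OF e4(1) exec.Seq[OF e5 e6]]]]
      have fr: "s6 w = s' w" if "w \<in> X'" "w \<noteq> i" "w \<noteq> x" "w \<noteq> y" for w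
        using that e2(4) e4(4) by (simp add: s6_def s5_def s3_def)
      have xs: "s6 x = (s' x)(int (Suc k) := a q k)" "s6 y = (s' y)(int (Suc k) := b q k)"
        using e2(4)[of x] e2(4)[of y] e4(4)[of x] e4(4)[of y] i ns(2)
        by (auto simp: s6_def s5_def s3_def X'_def X_def)
      have I': "Inv (Suc k) s6"
        unfolding Inv_def
      proof (intro conjI)
        show "s6 i 0 = int (Suc k)" by (simp add: s6_def)
        have "rn \<in> X'" "rn \<noteq> i" "rn \<noteq> x" "rn \<noteq> y" using i Pn(1) by (auto simp: X'_def X_def)
        then show "s6 rn 0 = int (n q)" using I fr[of rn] by (simp add: Inv_def)
        show "matches \<Gamma> ns q s6"
          by (rule matches_frame[of _ _ _ s' "insert ''in'' (set ns)"])
            (use I fr ns i in \<open>auto simp: Inv_def X'_def X_def\<close>)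
        show "\<forall>l<Suc k. s6 x (int (Suc l)) = a q l \<and> s6 y (int (Suc l)) = b q l"
          using I unfolding xs Inv_def by (auto simp: less_Suc_eq)
      qed
      have bd: "bval c ?b s'" using I k by (simp add: Inv_def)
      have bc: "bcost c ?b s' = 3 + bits (int k) + bits (int (n q))" using I by (simp add: Inv_def)
      have ba: "bits (a q k) \<le> Ba q + 2" "bits (b q k) \<le> Bb q + 2"
        using bits_le[OF realizes_bound[OF Pa(3) z]] bits_le[OF realizes_bound[OF Pb(3) z]] B(3,4)[OF q k]
        by simp_all
      have "1 + bcost c ?b s' + (t2 + ((3 + bits (int k) + bits 1 + bits (int (Suc k)) + bits (a q k)) +
          (t4 + ((3 + bits (int k) + bits 1 + bits (int (Suc k)) + bits (b q k)) +
          (3 + bits (int k) + bits 1 + bits (int (Suc k))))))) \<le> U q"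
        unfolding bc U_def
        using B(3,4)[OF q k] e2(2) e4(2) ba bn[of k] bn[of "Suc k"] bn[of "n q"] b1 k by linarith
      with bd e I' show "bval c ?b s' \<and> (\<exists>t s''. exec c ?body s' t s'' \<and> Inv (Suc k) s'' \<and>
          1 + bcost c ?b s' + t \<le> U q)" by blast
    next
      fix s' assume "Inv (n q) s'"
      then show "\<not> bval c ?b s' \<and> 1 + bcost c ?b s' \<le> U q"
        using bn[of "n q"] by (auto simp: Inv_def U_def)
    qed (use I0 in auto)
    then obtain t s' where w: "exec c (While ?b ?body) s1 t s'" "Inv (n q) s'" "t \<le> (n q + 1) * U q" by auto
    have "exec c ?P s (t0 + (3 + t)) s'" by (rule exec.Seq[OF e0(1) exec.Seq[OF e1 w(1)]])
    moreover have "t0 + (3 + t) \<le> V q" unfolding V_def using e0(2) w(3) by linarith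
    moreover have "\<forall>k<n q. s' x (int (Suc k)) = a q k \<and> s' y (int (Suc k)) = b q k"
      using w(2) unfolding Inv_def by blast
    ultimately show ?thesis by blast
  qed
  with V show ?thesis by blast
qed

text \<open>The program controls its output only on \<open>{1..users I}\<close>, while
  \<open>x_sol\<close> is a function on all indices; both are identified through this lemma and
  \<open>feasible_cong\<close>.\<close>

lemma F_cong:
  assumes "\<And>i. i \<in> {1..users I} \<Longrightarrow> x i = y i"
  shows "F p \<alpha> I x = F p \<alpha> I y"
proof -
  have "(\<Sum>i\<in>{1..users I}. u I i (x i) powr p) = (\<Sum>i\<in>{1..users I}. u I i (y i) powr p)"
    by (rule sum.cong) (use assms in auto)
  then have "F_norm p I x = F_norm p I y" by (simp only: F_norm_def)
  moreover have "(\<lambda>i. u I i (x i)) ` {1..users I} = (\<lambda>i. u I i (y i)) ` {1..users I}"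
    by (rule image_cong) (use assms in auto)
  then have "F_min I x = F_min I y" by (simp only: F_min_def)
  ultimately show ?thesis by (simp add: F_def)
qed

lemma feasible_cong:
  assumes "\<And>i. i \<in> {1..users I} \<Longrightarrow> x i = y i" "x \<in> feasible I"
  shows "y \<in> feasible I"
proof -
  have "(\<Sum>i\<in>{1..users I}. y i) = (\<Sum>i\<in>{1..users I}. x i)" by (rule sum.cong) (use assms in auto)
  then show ?thesis using assms by (auto simp: feasible_def)
qed

text \<open>The constants precede \<delta>. This is possible because the program depends on \<delta>
  only through one constant written to the variable \<open>D\<close>; what follows is a single
  program for all pairs \<open>(I, d)\<close>, with one polynomial time bound.\<close>

theorem theorem1:
  fixes p \<alpha> :: real
  assumes "p \<ge> 1" and "0 \<le> \<alpha>" and "\<alpha> \<le> 1"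
  shows "\<exists>(C::real) (a::nat) (b::nat). \<forall>\<delta>::real. 0 < \<delta> \<longrightarrow> \<delta> < 1 \<longrightarrow>
    (\<exists>A::com. \<forall>I. feo_instance I \<longrightarrow>
      (\<exists>t s. exec (fixed_reals p \<alpha>) A (init (encode I)) t s \<and>
         result s \<in> feasible I \<and>
         F p \<alpha> I (result s) \<ge> (1 - \<delta>) * OPT p \<alpha> I \<and>
         real t \<le> C * (1 / \<delta>) ^ a * real (input_size I) ^ b))"
proof -
  interpret reals p \<alpha> by unfold_locales (use assms in auto)
  \<comment> \<open>\<open>extra = snd\<close> counts \<open>d\<close> by its value, and the single
    program variable holds \<open>d\<close>.\<close>
  define \<Gamma> :: "(feo \<times> nat) ctx" where
    "\<Gamma> = \<lparr>pts = {q. feo_instance (fst q) \<and> 1 \<le> snd q}, inp = \<lambda>q. encode (fst q), extra = snd,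
      vars = [\<lambda>q. int (snd q)]\<rparr>"
  have pb: "pb \<Gamma> snd" by (rule pb_mono[OF pb_size]) (simp add: sz_def \<Gamma>_def)
  have "computable c \<Gamma> (vars \<Gamma> ! 0)"
    by (rule computable_var[OF _ pb]) (use int_le_power in \<open>auto simp: \<Gamma>_def\<close>)
  then have F: "fctx \<Gamma> fst snd" using pb unfolding fctx_def computable_nat_def by (simp add: \<Gamma>_def)
  note N = computable_users[OF F]
  note F1 = fctx_loop[OF F, of "\<lambda>q. users (fst q)"]
  note i = computable_loop_var[OF N]
  have "\<exists>P T. pb \<Gamma> T \<and> (\<forall>q\<in>pts \<Gamma>. \<forall>s. matches \<Gamma> [''D''] q s \<longrightarrow>
    (\<exists>t s'. exec c P s t s' \<and> t \<le> T q \<and> (\<forall>k<users (fst q).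
      s' ''num'' (int (Suc k)) = weight (fst q) (snd q) k (choice p \<alpha> (fst q) (snd q) k) \<and>
      s' ''den'' (int (Suc k)) = scale (fst q) (snd q))))"
  proof (rule computable_output[OF N])
    show "computable c (loop \<Gamma> (\<lambda>q. users (fst q)))
        (\<lambda>z. weight (fst (fst z)) (snd (fst z)) (snd z) (choice p \<alpha> (fst (fst z)) (snd (fst z)) (snd z)))"
      by (rule computable_weight[OF F1 i _ computable_choice[OF F1 i]]) simp
    show "computable c (loop \<Gamma> (\<lambda>q. users (fst q))) (\<lambda>z. scale (fst (fst z)) (snd (fst z)))"
      by (rule computable_scale[OF F1])
  qed (simp_all add: \<Gamma>_def)
  then obtain P T where T: "pb \<Gamma> T" and P: "\<And>q s. q \<in> pts \<Gamma> \<Longrightarrow> matches \<Gamma> [''D''] q s \<Longrightarrow>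
    (\<exists>t s'. exec c P s t s' \<and> t \<le> T q \<and> (\<forall>k<users (fst q).
      s' ''num'' (int (Suc k)) = weight (fst q) (snd q) k (choice p \<alpha> (fst q) (snd q) k) \<and>
      s' ''den'' (int (Suc k)) = scale (fst q) (snd q)))" by blast
  obtain k where k: "\<forall>q\<in>pts \<Gamma>. T q \<le> sz \<Gamma> q ^ k" using T unfolding pb_def by blast
  show ?thesis
  \<comment> \<open>With \<open>z = 2 + d + input_size I\<close>, the initial write and the program
    take time at most \<open>2 * z + z ^ k \<le> 3 * z ^ Suc k\<close>, while
    \<open>2 + d \<le> 4 / \<delta>\<close> gives
    \<open>z \<le> 5 * (1 / \<delta>) * input_size I\<close>.\<close>
  proof (rule exI[of _ "3 * 5 ^ Suc k"], rule exI[of _ "Suc k"], rule exI[of _ "Suc k"], intro allI impI,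
      rule exI, intro allI impI)
    fix \<delta> :: real and I
    assume \<delta>: "0 < \<delta>" "\<delta> < 1" and I: "feo_instance I"
    \<comment> \<open>Rounding up ensures \<open>1 / d \<le> \<delta>\<close> for the accuracy, and
      \<open>d \<le> 2 / \<delta>\<close> for the time.\<close>
    define d where "d = nat \<lceil>1 / \<delta>\<rceil>"
    have "1 < 1 / \<delta>" using \<delta> by simp
    then have d': "1 / \<delta> \<le> real d" "real d \<le> 2 * (1 / \<delta>)" "1 \<le> d" unfolding d_def by linarith+
    let ?A = "Seq (Write ''D'' (Const 0) (Const (int (nat \<lceil>1 / \<delta>\<rceil>)))) P"
    let ?s = "(init (encode I))(''D'' := (init (encode I) ''D'')(0 := int d))"
    let ?q = "(I, d)"
    have q: "?q \<in> pts \<Gamma>" using I d'(3) by (simp add: \<Gamma>_def)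
    have m: "matches \<Gamma> [''D''] ?q ?s" by (auto simp: matches_def \<Gamma>_def init_def arr_def)
    obtain t s where s: "exec c P ?s t s" "t \<le> T ?q" "\<And>k. k < users I \<Longrightarrow>
      s ''num'' (int (Suc k)) = weight I d k (choice p \<alpha> I d k) \<and> s ''den'' (int (Suc k)) = scale I d"
      using P[OF q m] by auto
    have e: "exec c ?A (init (encode I)) (2 + bits (int d) + t) s"
      using exec.Seq[OF write_exec[of c "''D''" "Const (int d)" "init (encode I)"]] s(1) by (simp add: d_def)
    interpret scheme p \<alpha> I d using fctx_scheme[OF F q] by simp
    have x: "x_sol i = result s i" if iI: "i \<in> {1..users I}" for i
    proof -
      obtain l where l: "i = Suc l" "l < users I" using iI by (cases i) auto
      show ?thesis using x_sol_weight[OF iI] s(3)[OF l(2)] l(1) by (simp add: result_def)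
    qed
    have "(1 - \<delta>) * OPT p \<alpha> I \<le> F p \<alpha> I x_sol"
    proof -
      have "F p \<alpha> I y \<le> F p \<alpha> I x_sol / (1 - \<delta>)" if y: "y \<in> feasible I" for y
      proof -
        have "1 / real d \<le> \<delta>" using d'(1,3) \<delta> by (simp add: field_simps)
        \<comment> \<open>If the value at \<open>y\<close> is nonnegative,
          \<open>1 - \<delta>\<close> may be replaced by the larger \<open>1 - 1 / d\<close>; if it
          is negative, the left side is at most 0.\<close>
        then have "(1 - \<delta>) * F p \<alpha> I y \<le> F p \<alpha> I x_sol"
          using x_sol_approx[OF y] \<delta> mult_right_mono[of "1 - \<delta>" "1 - 1 / real d" "F p \<alpha> I y"]
            mult_nonneg_nonpos[of "1 - \<delta>" "F p \<alpha> I y"] by (cases "0 \<le> F p \<alpha> I y") auto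
        then show ?thesis using \<delta> by (simp add: pos_le_divide_eq mult.commute)
      qed
      then have "OPT p \<alpha> I \<le> F p \<alpha> I x_sol / (1 - \<delta>)"
        unfolding OPT_def using lower_feasible by (intro cSUP_least) auto
      then show ?thesis using \<delta> by (simp add: pos_le_divide_eq mult.commute)
    qed
    then have "(1 - \<delta>) * OPT p \<alpha> I \<le> F p \<alpha> I (result s)" using F_cong[OF x] by simp
    moreover have "result s \<in> feasible I" by (rule feasible_cong[OF x x_sol_feasible])
    moreover have "real (2 + bits (int d) + t) \<le> 3 * 5 ^ Suc k * (1 / \<delta>) ^ Suc k * real (input_size I) ^ Suc k"
    proof -
      let ?z = "sz \<Gamma> ?q"
      have z: "?z = 2 + d + input_size I" by (simp add: sz_def \<Gamma>_def input_size_def)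
      have z1: "1 \<le> ?z ^ k" using z by simp
      have "bits (int d) \<le> d + 2" using bits_le[OF int_le_power] .
      then have "2 + bits (int d) + t \<le> 2 * ?z + ?z ^ k" using s(2) k[rule_format, OF q] z by linarith
      also have "\<dots> \<le> 2 * ?z ^ Suc k + ?z ^ Suc k"
      proof -
        have "?z * 1 \<le> ?z * ?z ^ k" by (intro mult_left_mono z1) simp
        moreover have "1 * ?z ^ k \<le> ?z * ?z ^ k" by (intro mult_right_mono) (simp_all add: z)
        ultimately show ?thesis unfolding power_Suc by linarith
      qed
      finally have "real (2 + bits (int d) + t) \<le> real (3 * ?z ^ Suc k)" by (simp only: of_nat_le_iff)
      also have "\<dots> = 3 * real ?z ^ Suc k" by simp
      also have "real ?z \<le> 5 * (1 / \<delta>) * real (input_size I)"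
      proof -
        have "1 \<le> input_size I" unfolding input_size_def encode_def by (simp add: bits_def)
        then have n: "1 \<le> real (input_size I)" by simp
        have "2 + real d \<le> 4 * (1 / \<delta>)" using d'(2) \<open>1 < 1 / \<delta>\<close> by linarith
        then have "2 + real d \<le> 4 * (1 / \<delta>) * real (input_size I)"
          using mult_left_mono[OF n, of "4 * (1 / \<delta>)"] \<delta> by simp
        moreover have "real (input_size I) \<le> 1 / \<delta> * real (input_size I)"
          using mult_right_mono[of 1 "1 / \<delta>" "real (input_size I)"] \<open>1 < 1 / \<delta>\<close> by simp
        ultimately show ?thesis unfolding z by simp
      qed
      then have "3 * real ?z ^ Suc k \<le> 3 * (5 * (1 / \<delta>) * real (input_size I)) ^ Suc k"
        by (intro mult_left_mono power_mono) auto
      finally show ?thesis by (simp only: power_mult_distrib mult.assoc)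
    qed
    ultimately show "\<exists>t s. exec c ?A (init (encode I)) t s \<and> result s \<in> feasible I \<and>
         (1 - \<delta>) * OPT p \<alpha> I \<le> F p \<alpha> I (result s) \<and>
         real t \<le> 3 * 5 ^ Suc k * (1 / \<delta>) ^ Suc k * real (input_size I) ^ Suc k"
      using e by blast
  qed
qed

end
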